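(* Let $X$ be a Banach space with a basis $(e_i)$. (a) If $\|s_1+s_2\|=2$ whenever $(s_n)$ is a spreading model of a normalized block basis of $(e_i)$, then $X$ contains a subspace isomorphic to $\ell_1$. (b) If $\|s_1+s_2\|=1$ whenever $(s_n)$ is a spreading model of a normalized block basis of $(e_i)$, then $X$ contains a subspace isomorphic to $c_0$.
   Context: Banach spaces are real and infinite dimensional; "basis" means Schauder basis. A block basis of $(e_i)$ is a sequence of nonzero vectors $x_k=\sum_{i=p_{k-1}+1}^{p_k} a_i e_i$ with $0\le p_0<p_1<\cdots$ and arbitrary real scalars $a_i$; it is normalized if $\|x_k\|=1$ for all $k$. Spreading model: let $(x_i)$ be a normalized basic sequence. A basic sequence $(s_i)$ (in some Banach space, whose norm is also denoted $\|\cdot\|$) is a spreading model of $(x_i)$ if for some sequence $\varepsilon_n\downarrow 0$, for all $n$ and all $(a_i)_1^n\in[-1,1]^n$, $$\left|\Big\|\sum_{i=1}^n a_i x_{k_i}\Big\|-\Big\|\sum_{i=1}^n a_i s_i\Big\|\right|<\varepsilon_n\quad\text{whenever } n\le k_1<\cdots<k_n.$$ *)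

theory Defs
  imports "HOL-Analysis.Analysis"
begin

text \<open>Sequences are indexed by \<^typ>\<open>nat\<close> starting at 0, so \<open>e n\<close> is the vector usually written
  \<open>e\<^sub>n\<^sub>+\<^sub>1\<close>. A space with a Schauder basis indexed by \<^typ>\<open>nat\<close> is automatically infinite dimensional.\<close>

definition schauder_basis_on :: "'a::real_normed_vector set \<Rightarrow> (nat \<Rightarrow> 'a) \<Rightarrow> bool" where
  "schauder_basis_on S e \<longleftrightarrow>
     range e \<subseteq> S \<and> (\<forall>x\<in>S. \<exists>!a::nat \<Rightarrow> real. (\<lambda>i. a i *\<^sub>R e i) sums x)"

abbreviation schauder_basis :: "(nat \<Rightarrow> 'a::real_normed_vector) \<Rightarrow> bool" where
  "schauder_basis \<equiv> schauder_basis_on UNIV"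

definition basic_sequence :: "(nat \<Rightarrow> 'a::real_normed_vector) \<Rightarrow> bool" where
  "basic_sequence x \<longleftrightarrow> schauder_basis_on (closure (span (range x))) x"

definition normalized :: "(nat \<Rightarrow> 'a::real_normed_vector) \<Rightarrow> bool" where
  "normalized x \<longleftrightarrow> (\<forall>k. norm (x k) = 1)"

definition block_basis :: "(nat \<Rightarrow> 'a::real_normed_vector) \<Rightarrow> (nat \<Rightarrow> 'a) \<Rightarrow> bool" where
  "block_basis e x \<longleftrightarrow>
     (\<exists>(p::nat \<Rightarrow> nat) (a::nat \<Rightarrow> real). strict_mono p \<and>
        (\<forall>k. x k = (\<Sum>i\<in>{p k..<p (Suc k)}. a i *\<^sub>R e i) \<and> x k \<noteq> 0))"

text \<open>With indices starting at 0, the condition \<open>n \<le> k\<^sub>1 < \<dots> < k\<^sub>n\<close> on indices starting at 1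
  becomes \<open>n \<le> k 0 + 1\<close> and \<open>k 0 < \<dots> < k (n - 1)\<close>. For \<open>n = 0\<close> the requirement only says
  \<open>0 < \<epsilon> 0\<close>, which is harmless.\<close>

definition spreading_model ::
    "(nat \<Rightarrow> 'a::real_normed_vector) \<Rightarrow> (nat \<Rightarrow> 'b::real_normed_vector) \<Rightarrow> bool" where
  "spreading_model x s \<longleftrightarrow>
     normalized x \<and> basic_sequence x \<and> basic_sequence s \<and>
     (\<exists>\<epsilon>::nat \<Rightarrow> real. decseq \<epsilon> \<and> \<epsilon> \<longlonglongrightarrow> 0 \<and>
        (\<forall>n (a::nat \<Rightarrow> real) (k::nat \<Rightarrow> nat).
           (\<forall>i<n. a i \<in> {-1..1}) \<longrightarrow> strict_mono_on {..<n} k \<longrightarrow> n \<le> Suc (k 0) \<longrightarrow>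
             \<bar>norm (\<Sum>i<n. a i *\<^sub>R x (k i)) - norm (\<Sum>i<n. a i *\<^sub>R s i)\<bar> < \<epsilon> n))"

text \<open>The Banach space containing a spreading model is arbitrary, but HOL cannot quantify over types
  inside a hypothesis. The type below is the Banach space of all bounded real sequences with the
  supremum norm (every function on the discrete space \<^typ>\<open>nat\<close> is continuous). It contains an
  isometric copy of every separable Banach space, so every spreading model has an isometric copy
  in it; see \<open>spreading_model_linf\<close> below.\<close>

type_synonym linf = "nat \<Rightarrow>\<^sub>C real"

instance bcontfun :: (metric_space, banach) banach ..

definition ell1 :: "(nat \<Rightarrow> real) set" where
  "ell1 = {a. summable (\<lambda>i. \<bar>a i\<bar>)}"

definition ell1_norm :: "(nat \<Rightarrow> real) \<Rightarrow> real" where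
  "ell1_norm a = (\<Sum>i. \<bar>a i\<bar>)"

definition c0 :: "(nat \<Rightarrow> real) set" where
  "c0 = {a. a \<longlonglongrightarrow> 0}"

definition c0_norm :: "(nat \<Rightarrow> real) \<Rightarrow> real" where
  "c0_norm a = (SUP i. \<bar>a i\<bar>)"

text \<open>\<open>isomorphic_to E N Y\<close>: the subspace \<open>Y\<close> is linearly homeomorphic to the space \<open>E\<close> of real
  sequences with pointwise operations and norm \<open>N\<close>.\<close>

definition isomorphic_to ::
    "(nat \<Rightarrow> real) set \<Rightarrow> ((nat \<Rightarrow> real) \<Rightarrow> real) \<Rightarrow> 'a::real_normed_vector set \<Rightarrow> bool" where
  "isomorphic_to E N Y \<longleftrightarrow>
     (\<exists>T::(nat \<Rightarrow> real) \<Rightarrow> 'a.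
        bij_betw T E Y \<and>
        (\<forall>a\<in>E. \<forall>b\<in>E. T (\<lambda>i. a i + b i) = T a + T b) \<and>
        (\<forall>a\<in>E. \<forall>c. T (\<lambda>i. c * a i) = c *\<^sub>R T a) \<and>
        (\<exists>c C. 0 < c \<and> (\<forall>a\<in>E. c * N a \<le> norm (T a) \<and> norm (T a) \<le> C * N a)))"

subsection \<open>Universality of the space of bounded sequences\<close>

definition sublinear :: "('b::real_vector \<Rightarrow> real) \<Rightarrow> bool" where
  "sublinear p \<longleftrightarrow> (\<forall>x y. p (x + y) \<le> p x + p y) \<and> (\<forall>c x. 0 < c \<longrightarrow> p (c *\<^sub>R x) = c * p x)"

lemma sublinear_zero: assumes "sublinear p" shows "p 0 = 0"
proof -
  have "p (2 *\<^sub>R 0) = 2 * p 0" using assms unfolding sublinear_def by (metis zero_less_numeral)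
  then show ?thesis by simp
qed

lemma sublinear_minus: assumes "sublinear p" shows "- p (- x) \<le> p x"
proof -
  have "p (x + - x) \<le> p x + p (- x)" using assms unfolding sublinear_def by blast
  then show ?thesis using sublinear_zero[OF assms] by simp
qed

lemma sublinear_shift:
  fixes p :: "'b::real_vector \<Rightarrow> real"
  assumes p: "sublinear p"
  obtains q where "sublinear q" "q \<le> p" "\<And>x. q x \<le> p (x + y) - p y"
proof -
  define q where "q = (\<lambda>x. INF t\<in>{0..}. p (x + t *\<^sub>R y) - t * p y)"
  have add: "p (u + v) \<le> p u + p v" for u v using p unfolding sublinear_def by blast
  have sc: "p (c *\<^sub>R u) = c * p u" if "0 \<le> c" for c u
    using p that sublinear_zero[OF p] unfolding sublinear_def by (cases "c = 0") auto
  have lower: "- p (- x) \<le> p (x + t *\<^sub>R y) - t * p y" if "t \<in> {0..}" for x t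
    using add[of "x + t *\<^sub>R y" "- x"] sc[of t y] that by simp
  have bdd: "bdd_below ((\<lambda>t. p (x + t *\<^sub>R y) - t * p y) ` {0..})" for x
    using lower by (intro bdd_belowI2[where m = "- p (- x)"]) auto
  have up: "q x \<le> p (x + t *\<^sub>R y) - t * p y" if "0 \<le> t" for x t
    unfolding q_def using that by (intro cINF_lower[OF bdd]) auto
  have q_add: "q (u + v) \<le> q u + q v" for u v
  proof -
    have 1: "q (u + v) - (p (v + t *\<^sub>R y) - t * p y) \<le> q u" if t: "0 \<le> t" for t
      unfolding q_def[THEN fun_cong, of u]
    proof (rule cINF_greatest)
      fix r :: real assume r: "r \<in> {0..}"
      have "q (u + v) \<le> p ((u + v) + (r + t) *\<^sub>R y) - (r + t) * p y" using r t by (intro up) auto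
      also have "p ((u + v) + (r + t) *\<^sub>R y) \<le> p (u + r *\<^sub>R y) + p (v + t *\<^sub>R y)"
        using add[of "u + r *\<^sub>R y" "v + t *\<^sub>R y"] by (simp add: algebra_simps)
      finally show "q (u + v) - (p (v + t *\<^sub>R y) - t * p y) \<le> p (u + r *\<^sub>R y) - r * p y"
        by (simp add: algebra_simps)
    qed auto
    have "q (u + v) - q u \<le> q v"
      unfolding q_def[THEN fun_cong, of v]
    proof (rule cINF_greatest)
      fix t :: real assume "t \<in> {0..}"
      then show "q (u + v) - q u \<le> p (v + t *\<^sub>R y) - t * p y" using 1[of t] by simp
    qed auto
    then show ?thesis by simp
  qed
  have q_le: "q (c *\<^sub>R x) \<le> c * q x" if c: "0 < c" for c x
  proof -
    have "q (c *\<^sub>R x) / c \<le> q x"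
      unfolding q_def[THEN fun_cong, of x]
    proof (rule cINF_greatest)
      fix t :: real assume t: "t \<in> {0..}"
      have "q (c *\<^sub>R x) \<le> p (c *\<^sub>R x + (c * t) *\<^sub>R y) - (c * t) * p y" using t c by (intro up) auto
      also have "\<dots> = c * (p (x + t *\<^sub>R y) - t * p y)"
        using sc[of c "x + t *\<^sub>R y"] c by (simp add: algebra_simps)
      finally show "q (c *\<^sub>R x) / c \<le> p (x + t *\<^sub>R y) - t * p y"
        using c by (simp add: field_simps)
    qed auto
    then show ?thesis using c by (simp add: field_simps)
  qed
  have q_sc: "q (c *\<^sub>R x) = c * q x" if c: "0 < c" for c x
  proof -
    have "q ((1 / c) *\<^sub>R (c *\<^sub>R x)) \<le> (1 / c) * q (c *\<^sub>R x)" using c by (intro q_le) auto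
    then have "c * q x \<le> q (c *\<^sub>R x)" using c by (simp add: field_simps)
    then show ?thesis using q_le[OF c, of x] by simp
  qed
  show thesis
  proof (rule that)
    show "sublinear q" using q_add q_sc unfolding sublinear_def by blast
    show "q \<le> p" using up[of 0] by (simp add: le_fun_def)
    show "q x \<le> p (x + y) - p y" for x using up[of 1 x] by simp
  qed
qed

lemma sublinear_minorant:
  fixes p :: "'b::real_vector \<Rightarrow> real"
  assumes p: "sublinear p"
  obtains f where "linear f" "f \<le> p"
proof -
  define A where "A = {q. sublinear q \<and> q \<le> p}"
  have "\<exists>m\<in>A. \<forall>q\<in>A. q \<le> m \<longrightarrow> q = m"
  proof (rule predicate_Zorn[where P = "\<lambda>m q. q \<le> m"])
    show "partial_order_on A (relation_of (\<lambda>m q. q \<le> m) A)"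
      by (intro partial_order_on_relation_ofI) auto
  next
    fix C assume C: "C \<in> Chains (relation_of (\<lambda>m q. q \<le> m) A)"
    have CA: "q \<in> A" if "q \<in> C" for q using C that unfolding Chains_def relation_of_def by auto
    have ch: "q \<le> r \<or> r \<le> q" if "q \<in> C" "r \<in> C" for q r
      using C that unfolding Chains_def relation_of_def by auto
    show "\<exists>u\<in>A. \<forall>a\<in>C. u \<le> a"
    proof (cases "C = {}")
      case True then show ?thesis using p unfolding A_def by auto
    next
      case False
      define u where "u = (\<lambda>x. INF q\<in>C. q x)"
      have add: "q (x + y) \<le> q x + q y" if "q \<in> C" for q x y
        using CA[OF that] unfolding A_def sublinear_def by blast
      have sc: "q (c *\<^sub>R x) = c * q x" if "q \<in> C" "0 < c" for q c x
        using CA[OF that(1)] that(2) unfolding A_def sublinear_def by blast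
      have lower: "- p (- x) \<le> q x" if "q \<in> C" for q x
      proof -
        have "q (- x) \<le> p (- x)" using CA[OF that] unfolding A_def by (auto simp: le_fun_def)
        then show ?thesis using sublinear_minus[of q x] CA[OF that] unfolding A_def by auto
      qed
      have bdd: "bdd_below ((\<lambda>q. q x) ` C)" for x
        using lower by (intro bdd_belowI2[where m = "- p (- x)"]) auto
      have up: "u x \<le> q x" if "q \<in> C" for q x
        unfolding u_def using that by (intro cINF_lower[OF bdd]) auto
      have u_add: "u (x + y) \<le> u x + u y" for x y
      proof -
        have 2: "u (x + y) \<le> q x + r y" if "q \<in> C" "r \<in> C" for q r
          using ch[OF that]
        proof
          assume "q \<le> r"
          then have "q y \<le> r y" by (simp add: le_fun_def)
          then show ?thesis using up[OF that(1), of "x + y"] add[OF that(1), of x y] by simp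
        next
          assume "r \<le> q"
          then have "r x \<le> q x" by (simp add: le_fun_def)
          then show ?thesis using up[OF that(2), of "x + y"] add[OF that(2), of x y] by simp
        qed
        have 1: "u (x + y) - r y \<le> u x" if "r \<in> C" for r
          unfolding u_def[THEN fun_cong, of x]
          using False 2[OF _ that] by (intro cINF_greatest) (auto simp: algebra_simps)
        have "u (x + y) - u x \<le> u y"
          unfolding u_def[THEN fun_cong, of y]
        proof (rule cINF_greatest[OF False])
          fix r assume "r \<in> C"
          then show "u (x + y) - u x \<le> r y" using 1[of r] by simp
        qed
        then show ?thesis by simp
      qed
      have u_le: "u (c *\<^sub>R x) \<le> c * u x" if c: "0 < c" for c x
      proof -
        have "u (c *\<^sub>R x) / c \<le> u x"
          unfolding u_def[THEN fun_cong, of x]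
        proof (rule cINF_greatest[OF False])
          fix q assume q: "q \<in> C"
          show "u (c *\<^sub>R x) / c \<le> q x"
            using up[OF q, of "c *\<^sub>R x"] sc[OF q c, of x] c by (simp add: field_simps)
        qed
        then show ?thesis using c by (simp add: field_simps)
      qed
      have u_sc: "u (c *\<^sub>R x) = c * u x" if c: "0 < c" for c x
      proof -
        have "u ((1 / c) *\<^sub>R (c *\<^sub>R x)) \<le> (1 / c) * u (c *\<^sub>R x)" using c by (intro u_le) auto
        then have "c * u x \<le> u (c *\<^sub>R x)" using c by (simp add: field_simps)
        then show ?thesis using u_le[OF c, of x] by simp
      qed
      obtain q where q: "q \<in> C" using False by blast
      have "u \<le> p"
        using up[OF q] CA[OF q] unfolding A_def by (auto simp: le_fun_def intro: order_trans)
      then have "u \<in> A" using u_add u_sc unfolding A_def sublinear_def by blast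
      then show ?thesis using up by (auto simp: le_fun_def)
    qed
  qed
  then obtain m where m: "m \<in> A" and min: "\<And>q. q \<in> A \<Longrightarrow> q \<le> m \<Longrightarrow> q = m" by blast
  have sm: "sublinear m" and mp: "m \<le> p" using m unfolding A_def by auto
  have madd: "m (x + y) = m x + m y" for x y
  proof -
    obtain q where q: "sublinear q" "q \<le> m" "\<And>x. q x \<le> m (x + y) - m y"
      using sublinear_shift[OF sm, of y] by blast
    have "q = m" using q mp by (intro min) (auto simp: A_def)
    then have "m x \<le> m (x + y) - m y" using q(3) by simp
    moreover have "m (x + y) \<le> m x + m y" using sm unfolding sublinear_def by blast
    ultimately show ?thesis by simp
  qed
  have mneg: "m (- x) = - m x" for x using madd[of x "- x"] sublinear_zero[OF sm] by simp
  have "linear m"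
  proof (rule linearI)
    show "m (x + y) = m x + m y" for x y by (rule madd)
    show "m (c *\<^sub>R x) = c *\<^sub>R m x" for c x
    proof -
      consider "0 < c" | "c = 0" | "0 < - c" by linarith
      then show ?thesis
      proof cases
        case 1 then show ?thesis using sm unfolding sublinear_def by simp
      next
        case 2 then show ?thesis using sublinear_zero[OF sm] by simp
      next
        case 3
        then have "m ((- c) *\<^sub>R x) = (- c) * m x" using sm unfolding sublinear_def by blast
        then show ?thesis using mneg[of "c *\<^sub>R x"] by simp
      qed
    qed
  qed
  then show thesis using mp that by blast
qed

lemma norming_functional:
  fixes x :: "'b::real_normed_vector"
  obtains f :: "'b \<Rightarrow> real" where "linear f" "\<And>y. \<bar>f y\<bar> \<le> norm y" "f x = norm x"
proof -
  have n: "sublinear (norm :: 'b \<Rightarrow> real)" by (auto simp: sublinear_def norm_triangle_ineq)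
  obtain q where q: "sublinear q" "q \<le> norm" "\<And>z. q z \<le> norm (z + x) - norm x"
    using sublinear_shift[OF n, of x] by blast
  obtain f where f: "linear f" "f \<le> q" using sublinear_minorant[OF q(1)] by blast
  have fn: "f y \<le> norm y" for y using f(2) q(2) by (meson le_fun_def order_trans)
  have fm: "f (- y) = - f y" for y using linear_neg[OF f(1)] .
  have abs: "\<bar>f y\<bar> \<le> norm y" for y using fn[of y] fn[of "- y"] fm[of y] by simp
  have "f (- x) \<le> - norm x" using f(2) q(3)[of "- x"] by (auto simp: le_fun_def intro: order_trans)
  then have "f x = norm x" using fm[of x] fn[of x] by simp
  then show thesis using that f(1) abs by blast
qed

lemma isometric_embedding_linf:
  fixes s :: "nat \<Rightarrow> 'b::real_normed_vector"
  obtains T :: "'b \<Rightarrow> linf"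
  where "bounded_linear T" "\<And>x. x \<in> closure (span (range s)) \<Longrightarrow> norm (T x) = norm x"
proof -
  define E where "E = rec_nat {0} (\<lambda>_ Y. (\<lambda>(r::rat, i, y). of_rat r *\<^sub>R s i + y) ` (UNIV \<times> UNIV \<times> Y))"
  define D where "D = (\<Union>n. E n)"
  have E0: "E 0 = {0}"
    and ES: "E (Suc n) = (\<lambda>(r::rat, i, y). of_rat r *\<^sub>R s i + y) ` (UNIV \<times> UNIV \<times> E n)" for n
    unfolding E_def by simp_all
  have "countable (E n)" for n by (induction n) (auto simp: E0 ES)
  then have cD: "countable D" unfolding D_def by auto
  have D0: "0 \<in> D" unfolding D_def using E0 by blast
  have D_step: "of_rat r *\<^sub>R s i + y \<in> D" if y: "y \<in> D" for r i y
  proof -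
    obtain n where "y \<in> E n" using y unfolding D_def by blast
    then have "of_rat r *\<^sub>R s i + y \<in> E (Suc n)" unfolding ES by force
    then show ?thesis unfolding D_def by blast
  qed
  have "x \<in> closure D" if "x \<in> span (range s)" for x
    using that
  proof (induction rule: span_induct_alt)
    case base then show ?case using D0 closure_subset by blast
  next
    case (step c v y)
    obtain i where v: "v = s i" using step by blast
    have "(c, y) \<in> closure (range of_rat) \<times> closure D"
      using step Rats_closure_real by (auto simp: Rats_def)
    then have cl: "(c, y) \<in> closure (range of_rat \<times> D)" by (simp add: closure_Times)
    define g where "g = (\<lambda>(r, y). r *\<^sub>R s i + y)"
    have "continuous_on (closure (range of_rat \<times> D)) g"
      unfolding g_def case_prod_unfold by (intro continuous_intros)
    then have "g ` closure (range of_rat \<times> D) \<subseteq> closure D"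
      by (rule image_closure_subset) (auto simp: g_def intro!: D_step closure_subset[THEN subsetD])
    then show ?case using cl unfolding v g_def by auto
  qed
  then have sub: "closure (span (range s)) \<subseteq> closure D"
    by (intro closure_minimal) auto
  define d where "d = from_nat_into D"
  have rd: "range d = D" unfolding d_def using cD D0 by (intro range_from_nat_into) auto
  have "\<exists>f::'b \<Rightarrow> real. linear f \<and> (\<forall>y. \<bar>f y\<bar> \<le> norm y) \<and> f (d n) = norm (d n)" for n
    by (rule norming_functional[of "d n"]) auto
  then obtain f where f: "\<And>n. linear (f n)" "\<And>n y. \<bar>f n y\<bar> \<le> norm y" "\<And>n. f n (d n) = norm (d n)"
    by metis
  define T :: "'b \<Rightarrow> linf" where "T = (\<lambda>y. Bcontfun (\<lambda>n. f n y))"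
  have Tapp: "apply_bcontfun (T y) = (\<lambda>n. f n y)" for y
    unfolding T_def by (rule Bcontfun_inverse, rule bcontfun_normI[where b = "norm y"]) (auto simp: f(2))
  have le: "norm (T y) \<le> norm y" for y by (rule norm_bound) (simp add: Tapp f(2))
  have bl: "bounded_linear T"
  proof (rule bounded_linear_intro[where K = 1])
    show "T (x + y) = T x + T y" for x y
      by (rule bcontfun_eqI) (simp add: Tapp linear_add[OF f(1)])
    show "T (r *\<^sub>R x) = r *\<^sub>R T x" for r x
      by (rule bcontfun_eqI) (simp add: Tapp linear_scale[OF f(1)])
    show "norm (T x) \<le> norm x * 1" for x using le by simp
  qed
  have "norm (T x) = norm x" if xD: "x \<in> D" for x
  proof -
    obtain n where n: "x = d n" using xD rd by blast
    have "norm x \<le> norm (T x)"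
      using norm_bounded[of "T x" n] f(3)[of n] by (simp add: Tapp n)
    then show ?thesis using le[of x] by simp
  qed
  then have "D \<subseteq> {x. norm (T x) = norm x}" by blast
  moreover have "closed {x. norm (T x) = norm x}"
    by (intro closed_Collect_eq continuous_intros bounded_linear.continuous_on[OF bl])
  ultimately have "closure D \<subseteq> {x. norm (T x) = norm x}" by (rule closure_minimal)
  then show thesis using sub bl that by blast
qed

lemma subspace_closure:
  fixes S :: "'b::real_normed_vector set"
  assumes S: "subspace S"
  shows "subspace (closure S)"
proof (rule subspaceI)
  show "0 \<in> closure S" using subspace_0[OF S] closure_subset by blast
  show "x + y \<in> closure S" if xy: "x \<in> closure S" "y \<in> closure S" for x y
  proof -
    obtain u v where "\<And>n. u n \<in> S" "u \<longlonglongrightarrow> x" "\<And>n. v n \<in> S" "v \<longlonglongrightarrow> y"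
      using xy unfolding closure_sequential by blast
    then show ?thesis unfolding closure_sequential
      by (intro exI[where x = "\<lambda>n. u n + v n"]) (auto intro: tendsto_add subspace_add[OF S])
  qed
  show "c *\<^sub>R x \<in> closure S" if x: "x \<in> closure S" for c x
  proof -
    obtain u where "\<And>n. u n \<in> S" "u \<longlonglongrightarrow> x" using x unfolding closure_sequential by blast
    then show ?thesis unfolding closure_sequential
      by (intro exI[where x = "\<lambda>n. c *\<^sub>R u n"])
        (auto intro: tendsto_scaleR tendsto_const subspace_scale[OF S])
  qed
qed

lemma basic_sequence_isometric_image:
  fixes s :: "nat \<Rightarrow> 'b::banach" and T :: "'b \<Rightarrow> 'c::real_normed_vector"
  assumes T: "bounded_linear T"
    and iso: "\<And>x. x \<in> closure (span (range s)) \<Longrightarrow> norm (T x) = norm x"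
    and s: "basic_sequence s"
  shows "basic_sequence (\<lambda>i. T (s i))"
proof -
  interpret T: bounded_linear T by (rule T)
  let ?S = "closure (span (range s))"
  have subS: "subspace ?S" by (intro subspace_closure) simp
  have sS: "s i \<in> ?S" for i by (meson closure_subset rangeI span_base subsetD)
  have span_im: "span (range (\<lambda>i. T (s i))) = T ` span (range s)"
    using linear_span_image[OF T.linear, of "range s"] by (simp add: image_image)
  have lim: "(\<lambda>n. T (u n)) \<longlonglongrightarrow> T x \<longleftrightarrow> u \<longlonglongrightarrow> x" if "\<And>n. u n \<in> ?S" "x \<in> ?S" for u x
  proof -
    have "norm (T (u n) - T x) = norm (u n - x)" for n
      using iso[OF subspace_diff[OF subS that(1)[of n] that(2)]] by (simp add: T.diff)
    then show ?thesis by (simp add: tendsto_iff dist_norm)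
  qed
  have "closure (T ` span (range s)) = T ` ?S"
  proof
    have "complete ?S" by (simp add: complete_eq_closed)
    have "complete (T ` ?S)"
      by (rule complete_isometric_image[where e = 1])
        (use T iso subS \<open>complete ?S\<close> in auto)
    then have "closed (T ` ?S)" by (rule complete_imp_closed)
    then show "closure (T ` span (range s)) \<subseteq> T ` ?S"
      by (intro closure_minimal image_mono closure_subset)
    show "T ` ?S \<subseteq> closure (T ` span (range s))"
      by (rule image_closure_subset) (auto intro: T.continuous_on continuous_on_id closure_subset[THEN subsetD])
  qed
  then have cl: "closure (span (range (\<lambda>i. T (s i)))) = T ` ?S" by (simp add: span_im)
  have sums: "(\<lambda>i. a i *\<^sub>R T (s i)) sums T x \<longleftrightarrow> (\<lambda>i. a i *\<^sub>R s i) sums x" if "x \<in> ?S" for a x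
  proof -
    have "(\<Sum>i<n. a i *\<^sub>R s i) \<in> ?S" for n
      by (intro subspace_sum[OF subS] subspace_scale[OF subS] sS)
    from lim[OF this that] show ?thesis by (simp add: sums_def T.sum T.scaleR)
  qed
  show ?thesis
    using s unfolding basic_sequence_def schauder_basis_on_def cl by (auto simp: sums sS)
qed

lemma spreading_model_linf:
  fixes x :: "nat \<Rightarrow> 'a::real_normed_vector" and s :: "nat \<Rightarrow> 'b::banach"
  assumes "spreading_model x s"
  obtains t :: "nat \<Rightarrow> linf"
  where "spreading_model x t"
    "\<And>(a::nat \<Rightarrow> real) n. norm (\<Sum>i<n. a i *\<^sub>R t i) = norm (\<Sum>i<n. a i *\<^sub>R s i)"
proof -
  obtain T :: "'b \<Rightarrow> linf"
    where T: "bounded_linear T" "\<And>x. x \<in> closure (span (range s)) \<Longrightarrow> norm (T x) = norm x"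
    using isometric_embedding_linf[of s] by blast
  interpret T: bounded_linear T by (rule T(1))
  have n: "norm (\<Sum>i<n. a i *\<^sub>R T (s i)) = norm (\<Sum>i<n. a i *\<^sub>R s i)" for a :: "nat \<Rightarrow> real" and n
  proof -
    have "(\<Sum>i<n. a i *\<^sub>R s i) \<in> span (range s)"
      by (intro span_sum span_scale span_base) auto
    then have "norm (T (\<Sum>i<n. a i *\<^sub>R s i)) = norm (\<Sum>i<n. a i *\<^sub>R s i)"
      using T(2) closure_subset by blast
    then show ?thesis by (simp add: T.sum T.scaleR)
  qed
  have "basic_sequence (\<lambda>i. T (s i))"
    using assms basic_sequence_isometric_image[OF T] unfolding spreading_model_def by blast
  then have "spreading_model x (\<lambda>i. T (s i))"
    using assms unfolding spreading_model_def n by blast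
  then show thesis using that n by blast
qed

end

theory Submission
  imports Defs "HOL-Library.Ramsey" "HOL-Complex_Analysis.Great_Picard"
begin

text \<open>
  By the existence of spreading models, the hypothesis says that every normalized block sequence
  contains pairs with \<open>\<parallel>y\<^sub>j + y\<^sub>k\<parallel>\<close> arbitrarily close to 2 (to 1). Call a finite set
  of unit vectors good up to \<open>\<epsilon>\<close> if some norm one functional is at least \<open>1 - \<epsilon>\<close> on all of it
  in (a), and if all its subset sums have norm at most \<open>1 + \<epsilon>\<close> in (b). For every ordinal \<open>a\<close> and
  every \<open>\<epsilon>\<close> there is a tree of good sets of rank at least \<open>\<omega>\<^sup>a\<close>; a tree of sufficiently large
  rank has an infinite branch.

  The ranks are increased by one step at the root. If this is impossible for some \<open>\<delta>\<close>, then for all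
  far out \<open>x\<close> the subtree of sets compatible with \<open>x\<close> has smaller rank than the tree of sets that are
  good up to a tiny \<open>\<epsilon>\<close>. In (a) this yields a branch with a convex combination that gives mass at
  most \<open>1 - \<theta>\<close> to every set compatible with one of finitely many given \<open>x\<close>, where \<open>\<theta>\<close> depends on
  the rank only. In (b) it yields a branch with many disjoint incompatible pieces, and a subset sum
  made of pieces that are almost independent for the witnessing functionals. Iterating, we obtain a
  normalized block sequence all of whose pairs (in (b), all of whose \<open>(k + 1)\<close>-subsets) contradict
  the hypothesis.

  In (b) an infinite branch spans \<open>c\<^sub>0\<close>. In (a) the branches, applied to normalized differences
  \<open>x\<^sub>m - x\<^sub>n\<close> along arbitrary subsequences, show that each subsequence has a further one on which
  a functional oscillates by a fixed amount; the Nash-Williams dichotomy makes this uniform, as in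
  Farahat's proof of Rosenthal's theorem, and gives \<open>\<ell>\<^sub>1\<close>.
\<close>

text \<open>Powers of \<omega> are additively indecomposable: a tree of rank \<omega>^a is never
  covered by finitely many hereditary families of smaller rank. This partition property lets
  finitely many given vectors be treated at once. Rank \<omega>^a demands every finite iterate of
  every smaller power; hence the step at the root is proved over an arbitrary list of exponents, and
  from all \<epsilon> simultaneously, since each step passes from a tiny \<epsilon> to a larger
  \<delta>. The two parts use different alphabets. In (a) the contradicting vectors only have to
  form a block basis of a fixed \<open>z\<close>, so nodes are indices. In (b) they must be nodes
  themselves, so trees branch over all unit vectors supported far out. This alphabet is uncountable,
  and a rank has to exceed any family of bounds indexed by it, whence the successor cardinal. Many
  disjoint pieces exist only inside a power with positive exponent. So finite ranks cannot enter the
  list in (b): any number \<open>k\<close> of root steps is taken at once, which is why pairs give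
  way to \<open>(k + 1)\<close>-subsets there.\<close>

subsection \<open>Trees of prescribed rank\<close>

text \<open>A well-order in which no image of \<^typ>\<open>'v\<close> is cofinal (for infinite \<^typ>\<open>'v\<close>).\<close>

typedef (overloaded) 'v succ_card = "Field (cardSuc (card_of (UNIV :: 'v set)))"
proof -
  let ?k = "card_of (UNIV :: 'v set)"
  have "(?k, cardSuc ?k) \<in> ordLess" by (rule cardSuc_greater[OF card_of_Card_order])
  moreover have "(?k, cardSuc ?k) \<notin> ordLess" if "Field (cardSuc ?k) = {}"
  proof -
    have "cardSuc ?k = {}" using that unfolding Field_def by (auto simp: Domain_def)
    then show ?thesis
      using card_of_empty2 that
      by (metis Card_order_iff_ordLeq_card_of Field_empty card_of_Card_order cardSuc_Card_order
          card_of_empty not_ordLess_ordLeq ordLeq_transitive)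
  qed
  ultimately show ?thesis by blast
qed

instantiation succ_card :: (type) wellorder
begin

definition less_eq_succ_card :: "'a succ_card \<Rightarrow> 'a succ_card \<Rightarrow> bool" where
  "x \<le> y \<longleftrightarrow> (Rep_succ_card x, Rep_succ_card y) \<in> cardSuc (card_of (UNIV :: 'a set))"

definition less_succ_card :: "'a succ_card \<Rightarrow> 'a succ_card \<Rightarrow> bool" where
  "(x :: 'a succ_card) < y \<longleftrightarrow> x \<le> y \<and> \<not> y \<le> x"

instance
proof
  let ?r = "cardSuc (card_of (UNIV :: 'a set))"
  have wo: "Well_order ?r"
    using cardSuc_Card_order card_of_Card_order unfolding card_order_on_def by blast
  then have lin: "Linear_order ?r" and wf: "wf (?r - Id)"
    unfolding well_order_on_def by auto
  have refl: "Refl ?r" and trans: "trans ?r" and anti: "antisym ?r" and tot: "Total ?r"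
    using lin unfolding linear_order_on_def partial_order_on_def preorder_on_def by auto
  fix x y z :: "'a succ_card"
  show "x < y \<longleftrightarrow> x \<le> y \<and> \<not> y \<le> x" by (fact less_succ_card_def)
  show "x \<le> x" using refl Rep_succ_card[of x] unfolding less_eq_succ_card_def refl_on_def by blast
  show "x \<le> y \<Longrightarrow> y \<le> z \<Longrightarrow> x \<le> z"
    using trans unfolding less_eq_succ_card_def trans_def by blast
  show eq: "x \<le> y \<Longrightarrow> y \<le> x \<Longrightarrow> x = y" for x y :: "'a succ_card"
    using anti unfolding less_eq_succ_card_def antisym_def Rep_succ_card_inject[symmetric] by blast
  show "x \<le> y \<or> y \<le> x"
    using tot refl Rep_succ_card[of x] Rep_succ_card[of y]
    unfolding less_eq_succ_card_def total_on_def refl_on_def by metis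
  fix P :: "'a succ_card \<Rightarrow> bool" and a
  assume step: "\<And>x. (\<And>y. y < x \<Longrightarrow> P y) \<Longrightarrow> P x"
  have "wf (inv_image (?r - Id) Rep_succ_card)" by (rule wf_inv_image[OF wf])
  then show "P a"
  proof (induction a rule: wf_induct_rule)
    case (less x)
    show ?case
    proof (rule step)
      fix y assume "y < x"
      then have "(y, x) \<in> inv_image (?r - Id) Rep_succ_card"
        unfolding less_succ_card_def by (auto simp: less_eq_succ_card_def)
      then show "P y" by (rule less.IH)
    qed
  qed
qed

end

text \<open>A successor cardinal is regular: the sublevel sets \<open>As\<close> of \<open>m\<close>
  form an increasing chain indexed by it and cover \<open>UNIV\<close>, so one of them already is
  \<open>UNIV\<close>. An infinite cardinal has no largest element, so one further step up makes the
  bound strict.\<close>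

lemma succ_card_bounded:
  fixes m :: "'v \<Rightarrow> 'v succ_card"
  assumes inf: "infinite (UNIV :: 'v set)"
  obtains a where "\<And>x. m x < a"
proof -
  let ?k = "card_of (UNIV :: 'v set)"
  let ?r = "cardSuc ?k"
  have k: "Card_order ?k" by (rule card_of_Card_order)
  have r: "Card_order ?r" by (rule cardSuc_Card_order[OF k])
  have infr: "infinite (Field ?r)" using inf k by (simp add: cardSuc_finite Field_card_of)
  have tr: "trans ?r" and rf: "Refl ?r"
    using r unfolding card_order_on_def well_order_on_def linear_order_on_def partial_order_on_def
      preorder_on_def by auto
  define As where "As = (\<lambda>i. {x. (Rep_succ_card (m x), i) \<in> ?r})"
  have "relChain ?r As" using tr unfolding relChain_def As_def trans_def by blast
  moreover have "UNIV \<subseteq> (\<Union>i\<in>Field ?r. As i)"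
    using rf Rep_succ_card unfolding As_def refl_on_def by blast
  moreover have "infinite (Field ?k)" using inf by (simp add: Field_card_of)
  moreover have "(card_of (UNIV :: 'v set), ?k) \<in> ordLeq" by (rule card_of_mono1) simp
  ultimately obtain i where i: "i \<in> Field ?r" "UNIV \<subseteq> As i"
    using cardSuc_UNION[OF k] by blast
  obtain j where j: "j \<in> Field ?r" "i \<noteq> j" "(i, j) \<in> ?r"
    using infinite_Card_order_limit[OF r infr i(1)] by blast
  obtain a b :: "'v succ_card" where ab: "i = Rep_succ_card a" "j = Rep_succ_card b"
    using i(1) j(1) by (metis Rep_succ_card_cases)
  have "a \<le> b" "a \<noteq> b" using j ab by (auto simp: less_eq_succ_card_def)
  then have "a < b" by simp
  moreover have "m x \<le> a" for x using i(2) unfolding As_def less_eq_succ_card_def ab by blast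
  ultimately show thesis using that le_less_trans by blast
qed

section \<open>Rank operators along a filter and their invariances\<close>

definition hered :: "('v set \<Rightarrow> bool) \<Rightarrow> bool" where
  "hered \<Phi> \<longleftrightarrow> (\<forall>A B. B \<subseteq> A \<longrightarrow> \<Phi> A \<longrightarrow> \<Phi> B)"

definition extend :: "'v filter \<Rightarrow> ('v set \<Rightarrow> bool) \<Rightarrow> 'v set \<Rightarrow> bool" where
  "extend F \<Phi> s \<longleftrightarrow> (\<exists>\<^sub>F x in F. \<Phi> (insert x s))"

text \<open>\<open>rext F a \<Phi> s\<close> says that above the node \<open>s\<close> there is a tree of rank at least \<open>\<omega>\<^sup>a\<close>, branching
  frequently along \<open>F\<close>, whose leaves satisfy \<open>\<Phi>\<close>. Iterating the operator adds the ranks, with the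
  outermost operator at the root, so that \<open>foldr\<close> over a list of exponents represents an arbitrary
  sum of powers of \<open>\<omega>\<close>.\<close>

function rext :: "'v filter \<Rightarrow> 'w::wellorder \<Rightarrow> ('v set \<Rightarrow> bool) \<Rightarrow> 'v set \<Rightarrow> bool" where
  "rext F a = (\<lambda>\<Phi> s. extend F \<Phi> s \<and> (\<forall>b. b < a \<longrightarrow> (\<forall>k. (rext F b ^^ k) \<Phi> s)))"
  by pat_completeness auto
termination by (relation "inv_image {(x, y). x < y} snd") (auto intro: wf)

declare rext.simps [simp del]

lemma rext_extend: "rext F a \<Phi> s \<Longrightarrow> extend F \<Phi> s"
  by (simp add: rext.simps[of F a])

lemma rext_less: "rext F a \<Phi> s \<Longrightarrow> b < a \<Longrightarrow> (rext F b ^^ k) \<Phi> s"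
  by (simp add: rext.simps[of F a])

lemma rext_mono_index: "rext F a \<Phi> s \<Longrightarrow> b \<le> a \<Longrightarrow> rext F b \<Phi> s"
  using rext_less[of F a \<Phi> s b 1] by (cases "a = b") auto

text \<open>Three invariances in one: monotonicity in the leaf condition, replacement of the root
  \<open>s\<close> by \<open>t\<close>, and deletion of the nodes outside a set \<open>V\<close>
  that is eventual along \<open>F\<close>. A rank operator sees only the finite sets
  \<open>B\<close> added above the root, so the three hold together and survive composition.\<close>

definition transfers :: "'v filter \<Rightarrow> (('v set \<Rightarrow> bool) \<Rightarrow> 'v set \<Rightarrow> bool) \<Rightarrow> bool" where
  "transfers F q \<longleftrightarrow> (\<forall>V \<Phi> \<Phi>' s t. (\<forall>\<^sub>F x in F. x \<in> V) \<longrightarrow>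
     (\<forall>B. finite B \<longrightarrow> B \<subseteq> V \<longrightarrow> \<Phi> (s \<union> B) \<longrightarrow> \<Phi>' (t \<union> B)) \<longrightarrow> q \<Phi> s \<longrightarrow> q \<Phi>' t)"

lemma transfersD:
  assumes "transfers F q" "\<forall>\<^sub>F x in F. x \<in> V" "q \<Phi> s"
    "\<And>B. finite B \<Longrightarrow> B \<subseteq> V \<Longrightarrow> \<Phi> (s \<union> B) \<Longrightarrow> \<Phi>' (t \<union> B)"
  shows "q \<Phi>' t"
  using assms unfolding transfers_def by blast

lemma transfers_mono:
  assumes "transfers F q" "q \<Phi> s"
    "\<And>B. finite B \<Longrightarrow> \<Phi> (s \<union> B) \<Longrightarrow> \<Phi>' (t \<union> B)"
  shows "q \<Phi>' t"
  by (rule transfersD[OF assms(1) _ assms(2), of UNIV]) (auto intro: assms(3))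

lemma transfers_id: "transfers F id"
  unfolding transfers_def id_def by (metis Un_empty_right empty_subsetI finite.emptyI)

lemma transfers_comp:
  assumes "transfers F q" "transfers F q'" shows "transfers F (q \<circ> q')"
  unfolding transfers_def comp_def
proof (intro allI impI)
  fix V \<Phi> \<Phi>' s t
  assume V: "\<forall>\<^sub>F x in F. x \<in> V" and B: "\<forall>B. finite B \<longrightarrow> B \<subseteq> V \<longrightarrow> \<Phi> (s \<union> B) \<longrightarrow> \<Phi>' (t \<union> B)"
    and q: "q (q' \<Phi>) s"
  show "q (q' \<Phi>') t"
  proof (rule transfersD[OF assms(1) V q])
    fix B assume *: "finite B" "B \<subseteq> V" "q' \<Phi> (s \<union> B)"
    show "q' \<Phi>' (t \<union> B)"
      by (rule transfersD[OF assms(2) V *(3)]) (use B * in \<open>auto simp: Un_assoc\<close>)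
  qed
qed

lemma transfers_pow: "transfers F q \<Longrightarrow> transfers F (q ^^ k)"
proof (induction k)
  case 0 show ?case unfolding funpow.simps foldr.simps by (rule transfers_id)
next
  case (Suc k) then show ?case
    unfolding funpow.simps by (intro transfers_comp) auto
qed

lemma transfers_extend: "transfers F (extend F)"
  unfolding transfers_def extend_def
proof (intro allI impI)
  fix V \<Phi> \<Phi>' s t
  assume V: "\<forall>\<^sub>F x in F. x \<in> V" and B: "\<forall>B. finite B \<longrightarrow> B \<subseteq> V \<longrightarrow> \<Phi> (s \<union> B) \<longrightarrow> \<Phi>' (t \<union> B)"
    and q: "\<exists>\<^sub>F x in F. \<Phi> (insert x s)"
  have "\<Phi>' (insert x t)" if "\<Phi> (insert x s)" "x \<in> V" for x
    using B[rule_format, of "{x}"] that by auto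
  with V q show "\<exists>\<^sub>F x in F. \<Phi>' (insert x t)"
    by (auto elim!: frequently_rev_mp eventually_mono)
qed

lemma transfers_rext: "transfers F (rext F a)"
proof (induction a rule: less_induct)
  case (less a)
  show ?case
    unfolding transfers_def
  proof (intro allI impI)
    fix V \<Phi> \<Phi>' s t
    assume V: "\<forall>\<^sub>F x in F. x \<in> V" and B: "\<forall>B. finite B \<longrightarrow> B \<subseteq> V \<longrightarrow> \<Phi> (s \<union> B) \<longrightarrow> \<Phi>' (t \<union> B)"
      and q: "rext F a \<Phi> s"
    show "rext F a \<Phi>' t"
      unfolding rext.simps[of F a]
    proof (intro conjI allI impI)
      show "extend F \<Phi>' t"
        by (rule transfersD[OF transfers_extend V rext_extend[OF q]]) (rule B[rule_format])
      show "(rext F b ^^ k) \<Phi>' t" if b: "b < a" for b k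
        by (rule transfersD[OF transfers_pow[OF less[OF b]] V rext_less[OF q b]]) (rule B[rule_format])
    qed
  qed
qed

lemma transfers_foldr: "transfers F (foldr (rext F) l)"
proof (induction l)
  case Nil show ?case unfolding funpow.simps foldr.simps by (rule transfers_id)
next
  case (Cons a l)
  show ?case
    unfolding foldr.simps by (rule transfers_comp[OF transfers_rext Cons.IH])
qed

lemma transfers_hered: "transfers F q \<Longrightarrow> hered \<Phi> \<Longrightarrow> hered (q \<Phi>)"
  unfolding hered_def
proof (intro allI impI)
  fix A B assume q: "transfers F q" and h: "\<forall>A B. B \<subseteq> A \<longrightarrow> \<Phi> A \<longrightarrow> \<Phi> B" and BA: "B \<subseteq> A" and qA: "q \<Phi> A"
  show "q \<Phi> B"
  proof (rule transfers_mono[OF q qA])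
    fix C assume "\<Phi> (A \<union> C)"
    moreover have "B \<union> C \<subseteq> A \<union> C" using BA by blast
    ultimately show "\<Phi> (B \<union> C)" using h by metis
  qed
qed

text \<open>Moves a root \<open>C\<close> into the leaf condition. Trees above different roots
  become conditions at the common root \<open>{}\<close>, where the partition property applies to
  finitely many of them.\<close>

lemma transfers_shift: "transfers F q \<Longrightarrow> q (\<lambda>B. \<Phi> (C \<union> B)) {} \<longleftrightarrow> q \<Phi> C"
  using transfers_mono[of F q "\<lambda>B. \<Phi> (C \<union> B)" "{}" \<Phi> C]
    transfers_mono[of F q \<Phi> C "\<lambda>B. \<Phi> (C \<union> B)" "{}"] by auto

lemma rext_imp:
  assumes "hered \<Phi>" "rext F a \<Phi> s" shows "\<Phi> s"
proof -
  obtain x where "\<Phi> (insert x s)"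
    using rext_extend[OF assms(2)] unfolding extend_def by (auto dest: frequently_ex)
  then show ?thesis using assms(1) unfolding hered_def by blast
qed

text \<open>The exponent is lowered in all iterates by monotonicity; surplus iterates are then
  peeled off at the root, where heredity enters through \<open>rext_imp\<close>.\<close>

lemma rext_pow_antimono:
  assumes h: "hered \<Phi>" and q: "(rext F a ^^ k) \<Phi> s" and b: "b \<le> a" and j: "j \<le> k"
  shows "(rext F b ^^ j) \<Phi> s"
proof -
  have "(rext F b ^^ k) \<Phi> s" using q
  proof (induction k arbitrary: s)
    case (Suc k)
    have 1: "rext F a ((rext F a ^^ k) \<Phi>) s" using Suc.prems by simp
    have "rext F a ((rext F b ^^ k) \<Phi>) s"
      by (rule transfers_mono[OF transfers_rext 1]) (rule Suc.IH)
    then show ?case using rext_mono_index b by fastforce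
  qed simp
  then show ?thesis using j
  proof (induction k)
    case (Suc k)
    have "hered ((rext F b ^^ k) \<Phi>)" by (rule transfers_hered[OF transfers_pow[OF transfers_rext] h])
    from rext_imp[OF this] Suc show ?case by (cases "j = Suc k") auto
  qed simp
qed

text \<open>If some \<open>b\<close> lies below \<open>a\<close>, a failing \<open>extend\<close> is
  also a failure of the first power of \<open>b\<close>. So a power witnesses every failure unless
  \<open>a\<close> is minimal, the case of rank one.\<close>

lemma not_rextE:
  assumes "\<not> rext F a \<Phi> s"
  obtains (extend) "\<And>b. \<not> b < a" "\<not> extend F \<Phi> s" "rext F a = extend F"
  | (power) b k where "b < a" "\<not> (rext F b ^^ k) \<Phi> s"
proof (cases "\<exists>b. b < a")
  case True
  then obtain b where b: "b < a" by blast
  from assms consider "\<not> extend F \<Phi> s" | c k where "c < a" "\<not> (rext F c ^^ k) \<Phi> s"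
    unfolding rext.simps[of F a] by blast
  then show thesis
  proof cases
    case 1
    then have "\<not> (rext F b ^^ 1) \<Phi> s" using rext_extend by auto
    then show thesis using b power by blast
  qed (rule power)
next
  case False
  then have "rext F a = extend F" unfolding rext.simps[of F a] by auto
  then show thesis using False assms extend by auto
qed

section \<open>The partition property of the ranks\<close>

definition distributes :: "(('v set \<Rightarrow> bool) \<Rightarrow> 'v set \<Rightarrow> bool) \<Rightarrow> bool" where
  "distributes q \<longleftrightarrow> (\<forall>\<Phi> \<Psi> s. hered \<Phi> \<longrightarrow> hered \<Psi> \<longrightarrow> q (\<lambda>A. \<Phi> A \<or> \<Psi> A) s \<longrightarrow> q \<Phi> s \<or> q \<Psi> s)"

lemma distributes_comp:
  assumes q: "distributes q" "transfers F q" and q': "distributes q'" "transfers F q'"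
  shows "distributes (q \<circ> q')"
  unfolding distributes_def comp_def
proof (intro allI impI)
  fix \<Phi> \<Psi> s assume h: "hered \<Phi>" "hered \<Psi>" and *: "q (q' (\<lambda>A. \<Phi> A \<or> \<Psi> A)) s"
  have "q (\<lambda>A. q' \<Phi> A \<or> q' \<Psi> A) s"
    by (rule transfers_mono[OF q(2) *]) (use q' h in \<open>auto simp: distributes_def\<close>)
  then show "q (q' \<Phi>) s \<or> q (q' \<Psi>) s"
    using q(1) transfers_hered[OF q'(2)] h unfolding distributes_def by blast
qed

lemma distributes_id: "distributes id"
  by (simp add: distributes_def)

lemma distributes_pow:
  assumes "distributes q" "transfers F q" shows "distributes (q ^^ k)"
proof (induction k)
  case 0 show ?case unfolding funpow.simps foldr.simps by (rule distributes_id)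
next
  case (Suc k)
  show ?case
    unfolding funpow.simps
    by (rule distributes_comp[OF assms Suc.IH transfers_pow[OF assms(2)]])
qed

lemma distributes_extend: "distributes (extend F)"
  by (auto simp: distributes_def extend_def frequently_disj_iff)

text \<open>A failing power \<open>k\<close> of \<open>b\<close> for \<Phi> and a failing power
  \<open>j\<close> of \<open>c\<close> for \<Psi> make the power \<open>max k j\<close> of
  \<open>max b c\<close> fail for both. The disjunction has that power, which distributes by
  induction. This is the additive indecomposability of \<omega>^a.\<close>

lemma distributes_rext: "distributes (rext F a)"
proof (induction a rule: less_induct)
  case (less a)
  show ?case
    unfolding distributes_def
  proof (intro allI impI, rule ccontr)
    fix \<Phi> \<Psi> s assume h: "hered \<Phi>" "hered \<Psi>" and q: "rext F a (\<lambda>A. \<Phi> A \<or> \<Psi> A) s"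
      and "\<not> (rext F a \<Phi> s \<or> rext F a \<Psi> s)"
    then have n: "\<not> rext F a \<Phi> s" "\<not> rext F a \<Psi> s" by auto
    from n(1) show False
    proof (cases rule: not_rextE)
      case extend
      then show False using q n distributes_extend h unfolding distributes_def by metis
    next
      case (power b k)
      note 1 = this
      from n(2) show False
      proof (cases rule: not_rextE)
        case extend then show False using 1 by blast
      next
        case (power c j)
        define d where "d = max b c"
        define m where "m = max k j"
        have d: "d < a" using 1 power by (simp add: d_def)
        have "(rext F d ^^ m) \<Phi> s \<or> (rext F d ^^ m) \<Psi> s"
          using distributes_pow[OF less[OF d] transfers_rext, of m] rext_less[OF q d, of m] h
          unfolding distributes_def by blast
        then show False
          using rext_pow_antimono[OF h(1), where a = d and k = m and b = b and j = k]
            rext_pow_antimono[OF h(2), where a = d and k = m and b = c and j = j] 1 power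
          by (auto simp: d_def m_def)
      qed
    qed
  qed
qed

lemma distributes_foldr: "distributes (foldr (rext F) l)"
proof (induction l)
  case Nil show ?case unfolding funpow.simps foldr.simps by (rule distributes_id)
next
  case (Cons a l)
  show ?case
    unfolding foldr.simps
    by (rule distributes_comp[OF distributes_rext transfers_rext Cons.IH transfers_foldr])
qed

lemma hered_Union:
  assumes "\<And>i. i \<in> I \<Longrightarrow> hered (\<Psi> i)" shows "hered (\<lambda>A. \<exists>i\<in>I. \<Psi> i A)"
  using assms unfolding hered_def by meson

text \<open>Applied with one family for each of finitely many obstacles; the premise on the
  constantly false condition settles the empty index set.\<close>

lemma distributes_finite:
  assumes q: "distributes q" "transfers F q" and I: "finite I" "\<And>i. i \<in> I \<Longrightarrow> hered (\<Psi> i)"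
    and n: "\<And>i. i \<in> I \<Longrightarrow> \<not> q (\<Psi> i) s" and ne: "\<not> q (\<lambda>_. False) s"
  shows "\<not> q (\<lambda>A. \<exists>i\<in>I. \<Psi> i A) s"
  using I n
proof (induction I rule: finite_induct)
  case empty then show ?case using ne by simp
next
  case (insert i I)
  have "hered (\<lambda>A. \<exists>i\<in>I. \<Psi> i A)" using insert.prems(1) by (intro hered_Union) auto
  moreover have "hered (\<Psi> i)" using insert.prems(1) by auto
  moreover have "\<not> q (\<lambda>A. \<exists>i\<in>I. \<Psi> i A) s" "\<not> q (\<Psi> i) s" using insert by auto
  ultimately show ?case using q(1) unfolding distributes_def by simp blast
qed

lemma extend_False: "\<not> extend F (\<lambda>_. False) s"
  by (auto simp: extend_def)

lemma rext_False: "\<not> rext F a (\<lambda>_. False) s"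
  using rext_extend extend_False by blast

lemma foldr_rext_False: "\<not> foldr (rext F) l (\<lambda>_. False) s"
proof (induction l arbitrary: s)
  case (Cons a l)
  then have "foldr (rext F) l (\<lambda>_. False) = (\<lambda>_. False)" by (intro ext) simp
  then show ?case by (simp add: rext_False)
qed simp

section \<open>Measures on branches that hardly see a family of smaller rank\<close>

definition weight :: "'v set \<Rightarrow> ('v \<Rightarrow> real) \<Rightarrow> real \<Rightarrow> bool" where
  "weight b \<mu> m \<longleftrightarrow> finite b \<and> (\<forall>i. 0 \<le> \<mu> i) \<and> (\<forall>i. i \<notin> b \<longrightarrow> \<mu> i = 0) \<and> sum \<mu> b = m"

lemma hered_shift: "hered \<Phi> \<Longrightarrow> hered (\<lambda>C. \<Phi> (B \<union> C))"
  unfolding hered_def by (metis Un_mono order_refl)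

lemma hered_conj: "hered \<Phi> \<Longrightarrow> hered (\<lambda>C. P \<and> \<Phi> C)"
  unfolding hered_def by metis

lemma weight_le: "weight b \<mu> m \<Longrightarrow> finite A \<Longrightarrow> sum \<mu> A \<le> m"
proof -
  assume w: "weight b \<mu> m" and A: "finite A"
  have "sum \<mu> A = sum \<mu> (A \<inter> b)"
    using w A unfolding weight_def by (intro sum.mono_neutral_right) auto
  also have "\<dots> \<le> sum \<mu> b" using w unfolding weight_def by (intro sum_mono2) auto
  finally show ?thesis using w unfolding weight_def by simp
qed

lemma weight_Int: "weight b \<mu> m \<Longrightarrow> finite A \<Longrightarrow> sum \<mu> A = sum \<mu> (A \<inter> b)"
  unfolding weight_def by (intro sum.mono_neutral_right) auto

lemma weight_add:
  assumes "weight b \<mu> m" "weight c \<nu> n" "0 \<le> p" "0 \<le> q"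
  shows "weight (b \<union> c) (\<lambda>i. p * \<mu> i + q * \<nu> i) (p * m + q * n)"
proof -
  have "sum \<mu> (b \<union> c) = m" "sum \<nu> (b \<union> c) = n"
    using weight_Int[OF assms(1), of "b \<union> c"] weight_Int[OF assms(2), of "b \<union> c"] assms
    by (auto simp: weight_def Int_absorb1)
  then show ?thesis
    using assms by (auto simp: weight_def sum.distrib sum_distrib_left[symmetric])
qed

text \<open>The counterpart of repeated averages on Schreier families: a branch of full rank carries
  a probability measure that is negligible on every set of a family without that rank. The root
  \<open>s\<close> is arbitrary for \<Phi> but \<open>{}\<close> for \<Psi>, because later blocks
  are chosen above earlier ones while being tested by themselves.\<close>

definition small_weights :: "(('v set \<Rightarrow> bool) \<Rightarrow> 'v set \<Rightarrow> bool) \<Rightarrow> bool" where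
  "small_weights q \<longleftrightarrow> (\<forall>\<eta> \<Phi> \<Psi> s. 0 < \<eta> \<longrightarrow> hered \<Psi> \<longrightarrow> q \<Phi> s \<longrightarrow> \<not> q \<Psi> {} \<longrightarrow>
     (\<exists>b \<mu>. weight b \<mu> 1 \<and> \<Phi> (s \<union> b) \<and> (\<forall>B\<subseteq>b. \<Psi> B \<longrightarrow> sum \<mu> B \<le> \<eta>)))"

lemma small_weightsE:
  assumes "small_weights q" "0 < \<eta>" "hered \<Psi>" "q \<Phi> s" "\<not> q \<Psi> {}"
  obtains b \<mu> where "weight b \<mu> 1" "\<Phi> (s \<union> b)" "\<And>B. B \<subseteq> b \<Longrightarrow> \<Psi> B \<Longrightarrow> sum \<mu> B \<le> \<eta>"
  using assms unfolding small_weights_def by blast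

text \<open>A potential argument. The level of \<open>B\<close> is the number of applications of
  \<open>q\<close> that \<Psi> still allows above it; it stays below \<open>k\<close>. A new block
  of mass one either meets the given set so as to lower its level, which costs at most one unit and
  happens fewer than \<open>k\<close> times, or it adds at most \<eta>.\<close>

lemma small_weights_pow:
  assumes q: "small_weights q" "transfers F q" "distributes q" and qF: "\<And>s. \<not> q (\<lambda>_. False) s"
    and h: "hered \<Psi>" and k: "\<not> (q ^^ k) \<Psi> {}" and \<eta>: "0 < \<eta>" and p: "(q ^^ (m + M)) \<Phi> s"
  shows "\<exists>b \<nu>. weight b \<nu> (real m) \<and> (q ^^ M) \<Phi> (s \<union> b) \<and>
    (\<forall>B\<subseteq>b. \<forall>j\<le>k. (q ^^ j) \<Psi> B \<longrightarrow> j < k \<and> sum \<nu> B \<le> real m * \<eta> + (real k - 1 - real j))"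
  using p
proof (induction m arbitrary: M)
  case 0
  show ?case
    using 0 k by (intro exI[of _ "{}"] exI[of _ "\<lambda>_. 0"]) (auto simp: weight_def le_less)
next
  case (Suc m)
  have hp: "hered ((q ^^ j) \<Psi>)" for j by (rule transfers_hered[OF transfers_pow[OF q(2)] h])
  obtain b \<nu> where b: "weight b \<nu> (real m)" "(q ^^ Suc M) \<Phi> (s \<union> b)"
    and inv: "\<And>B j. B \<subseteq> b \<Longrightarrow> j \<le> k \<Longrightarrow> (q ^^ j) \<Psi> B \<Longrightarrow>
      j < k \<and> sum \<nu> B \<le> real m * \<eta> + (real k - 1 - real j)"
    using Suc.IH[of "Suc M"] Suc.prems by auto
  \<comment> \<open>Adding \<open>C\<close> keeps \<open>B\<close> at level \<open>j\<close>
    although \<open>B\<close> does not reach level \<open>Suc j\<close>. If this condition had rank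
    \<open>q\<close> at the root \<open>{}\<close>, then \<open>B\<close> would have level
    \<open>Suc j\<close> after all.\<close>
  define \<Psi>' where "\<Psi>' = (\<lambda>(B, j) C. \<not> (q ^^ Suc j) \<Psi> B \<and> (q ^^ j) \<Psi> (B \<union> C))"
  have h': "hered (\<Psi>' i)" for i
    unfolding \<Psi>'_def case_prod_unfold by (rule hered_conj[OF hered_shift[OF hp]])
  define I where "I = Pow b \<times> {..<k}"
  have fb: "finite b" using b(1) by (simp add: weight_def)
  have nU: "\<not> q (\<lambda>A. \<exists>i\<in>I. \<Psi>' i A) {}"
  proof (rule distributes_finite[OF q(3,2)])
    show "finite I" using fb by (simp add: I_def)
    show "hered (\<Psi>' i)" for i by (rule h')
    show "\<not> q (\<Psi>' i) {}" if "i \<in> I" for i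
    proof -
      obtain B j where i: "i = (B, j)" by (cases i)
      show ?thesis
      proof (cases "(q ^^ Suc j) \<Psi> B")
        case True
        then have "\<Psi>' i = (\<lambda>_. False)" by (auto simp: \<Psi>'_def i)
        then show ?thesis using qF by simp
      next
        case False
        then have "\<Psi>' i = (\<lambda>C. (q ^^ j) \<Psi> (B \<union> C))" by (auto simp: \<Psi>'_def i)
        then show ?thesis using False transfers_shift[OF q(2), of "(q ^^ j) \<Psi>" B] by simp
      qed
    qed
  qed (rule qF)
  have hU: "hered (\<lambda>A. \<exists>i\<in>I. \<Psi>' i A)" by (rule hered_Union) (rule h')
  have qM: "q ((q ^^ M) \<Phi>) (s \<union> b)" using b(2) by simp
  obtain c \<mu> where c: "weight c \<mu> 1" "(q ^^ M) \<Phi> (s \<union> b \<union> c)"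
    and small: "\<And>C. C \<subseteq> c \<Longrightarrow> \<exists>i\<in>I. \<Psi>' i C \<Longrightarrow> sum \<mu> C \<le> \<eta>"
    by (rule small_weightsE[OF q(1) \<eta> hU qM nU]) blast
  show ?case
  proof (intro exI conjI allI impI)
    show "weight (b \<union> c) (\<lambda>i. \<nu> i + \<mu> i) (real (Suc m))"
      using weight_add[OF b(1) c(1), of 1 1] by (simp add: add.commute)
    show "(q ^^ M) \<Phi> (s \<union> (b \<union> c))" using c(2) by (simp add: Un_assoc)
  next
    fix D j assume D: "D \<subseteq> b \<union> c" and j: "j \<le> k" and jD: "(q ^^ j) \<Psi> D"
    have fD: "finite D" using D fb c(1) finite_subset by (auto simp: weight_def)
    have jb: "(q ^^ j) \<Psi> (D \<inter> b)" using hp[of j] jD unfolding hered_def by blast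
    have i1: "j < k" "sum \<nu> D \<le> real m * \<eta> + (real k - 1 - real j)"
      using inv[of "D \<inter> b" j] j jb weight_Int[OF b(1) fD] by auto
    then show "j < k" by simp
    show "(\<Sum>i\<in>D. \<nu> i + \<mu> i) \<le> real (Suc m) * \<eta> + (real k - 1 - real j)"
    proof (cases "(q ^^ Suc j) \<Psi> (D \<inter> b)")
      \<comment> \<open>The old part has level at least \<open>Suc j\<close>; its sharper bound
        leaves one unit to spare, which pays for the whole mass of \<open>c\<close>.\<close>
      case True
      then have "sum \<nu> D \<le> real m * \<eta> + (real k - 1 - real (Suc j))"
        using inv[of "D \<inter> b" "Suc j"] i1(1) weight_Int[OF b(1) fD] by auto
      moreover have "sum \<mu> D \<le> 1" by (rule weight_le[OF c(1) fD])
      moreover have "real (Suc m) * \<eta> = real m * \<eta> + \<eta>" by (simp add: algebra_simps)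
      ultimately show ?thesis using \<eta> by (simp add: sum.distrib del: of_nat_Suc)
    next
      case False
      have "(D \<inter> b) \<union> (D \<inter> c) = D" using D by blast
      then have "\<Psi>' (D \<inter> b, j) (D \<inter> c)" using False jD by (auto simp: \<Psi>'_def)
      moreover have "(D \<inter> b, j) \<in> I" using i1(1) by (auto simp: I_def)
      ultimately have "sum \<mu> (D \<inter> c) \<le> \<eta>" using small[of "D \<inter> c"] by blast
      then have "sum \<mu> D \<le> \<eta>" using weight_Int[OF c(1) fD] by simp
      then show ?thesis using i1(2) by (simp add: sum.distrib algebra_simps)
    qed
  qed
qed

lemma small_weights_extend: "small_weights (extend F)"
  unfolding small_weights_def
proof (intro allI impI)
  fix \<eta> :: real and \<Phi> \<Psi> :: "'a set \<Rightarrow> bool" and s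
  assume "0 < \<eta>" and q: "extend F \<Phi> s" and n: "\<not> extend F \<Psi> {}"
  have "\<forall>\<^sub>F x in F. \<not> \<Psi> {x}" using n by (simp add: extend_def not_frequently)
  then have "\<exists>\<^sub>F x in F. \<Phi> (insert x s) \<and> \<not> \<Psi> {x}"
    using q unfolding extend_def by (auto elim!: frequently_rev_mp eventually_mono)
  then obtain x where x: "\<Phi> (insert x s)" "\<not> \<Psi> {x}" by (auto dest: frequently_ex)
  show "\<exists>b \<mu>. weight b \<mu> 1 \<and> \<Phi> (s \<union> b) \<and> (\<forall>B\<subseteq>b. \<Psi> B \<longrightarrow> sum \<mu> B \<le> \<eta>)"
    using x \<open>0 < \<eta>\<close>
    by (intro exI[of _ "{x}"] exI[of _ "\<lambda>i. if i = x then 1 else 0"])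
      (auto simp: weight_def subset_singleton_iff)
qed

lemma small_weights_rext: "small_weights (rext F a)"
proof (induction a rule: less_induct)
  case (less a)
  show ?case
    unfolding small_weights_def
  proof (intro allI impI)
    fix \<eta> :: real and \<Phi> \<Psi> :: "'a set \<Rightarrow> bool" and s
    assume \<eta>: "0 < \<eta>" and h: "hered \<Psi>" and q: "rext F a \<Phi> s" and n: "\<not> rext F a \<Psi> {}"
    from n show "\<exists>b \<mu>. weight b \<mu> 1 \<and> \<Phi> (s \<union> b) \<and> (\<forall>B\<subseteq>b. \<Psi> B \<longrightarrow> sum \<mu> B \<le> \<eta>)"
    proof (cases rule: not_rextE)
      case extend
      then show ?thesis
        using small_weights_extend[of F] \<eta> h q n unfolding small_weights_def by metis
    next
      case (power c k)
      \<comment> \<open>\<open>m\<close> blocks of mass one are averaged. A bad set gets at most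
        \<eta>/2 per block plus \<open>k\<close> extra units, and \<open>k / m < \<eta> / 2\<close>.
        Rank \<omega>^a supplies \<open>m\<close> copies of the smaller power however large
        \<open>m\<close> is.\<close>
      obtain m :: nat where m: "real k / (\<eta> / 2) < real m" "0 < m"
        by (metis reals_Archimedean2 gr0I of_nat_0_less_iff less_trans linorder_not_less
            of_nat_0 divide_nonneg_pos of_nat_0_le_iff \<eta> half_gt_zero)
      have "(rext F c ^^ (m + 0)) \<Phi> s" using rext_less[OF q power(1), of m] by simp
      from small_weights_pow[OF less[OF power(1)] transfers_rext distributes_rext rext_False h
          power(2) half_gt_zero[OF \<eta>] this]
      obtain b \<nu> where b: "weight b \<nu> (real m)" "(rext F c ^^ 0) \<Phi> (s \<union> b)"
        and *: "\<forall>B\<subseteq>b. \<forall>j\<le>k. (rext F c ^^ j) \<Psi> B \<longrightarrow>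
          j < k \<and> sum \<nu> B \<le> real m * (\<eta> / 2) + (real k - 1 - real j)"
        by (elim exE conjE)
      have B: "sum \<nu> B \<le> real m * (\<eta> / 2) + real k" if "B \<subseteq> b" "\<Psi> B" for B
        using *[rule_format, of B 0] that by simp
      have "weight b (\<lambda>i. \<nu> i / real m) 1"
        using b(1) m(2) by (auto simp: weight_def sum_divide_distrib[symmetric])
      moreover have "(\<Sum>i\<in>B. \<nu> i / real m) \<le> \<eta>" if "B \<subseteq> b" "\<Psi> B" for B
        using B[OF that] m \<eta> by (simp add: sum_divide_distrib[symmetric] field_simps)
      ultimately show ?thesis using b(2) by auto
    qed
  qed
qed

text \<open>For a sum of powers no small \<eta> can be expected, since \<Psi> may have full rank in
  one summand. Half of the mass goes to the outermost block and half to the rest, and a set in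
  \<Psi> misses a fixed share of one of them. The order of quantifiers matters: \<theta> depends on
  the list alone, so tolerances can be chosen after it.\<close>

lemma weights_foldr:
  fixes F :: "'v filter"
  assumes "l \<noteq> []"
  shows "\<exists>\<theta>>0. \<forall>\<Phi> \<Psi> s. hered \<Psi> \<longrightarrow> foldr (rext F) l \<Phi> s \<longrightarrow> \<not> foldr (rext F) l \<Psi> {} \<longrightarrow>
     (\<exists>b \<mu>. weight b \<mu> 1 \<and> \<Phi> (s \<union> b) \<and> (\<forall>B\<subseteq>b. \<Psi> B \<longrightarrow> sum \<mu> B \<le> 1 - \<theta>))"
  using assms
proof (induction l rule: list_nonempty_induct)
  case (single a)
  show ?case
    using small_weights_rext[of F a, unfolded small_weights_def, rule_format, of "1/2"]
    by (intro exI[of _ "1/2"]) auto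
next
  case (cons a l)
  let ?q = "foldr (rext F) l"
  obtain \<theta> where \<theta>: "0 < \<theta>" and IH: "\<And>\<Phi> \<Psi> s. hered \<Psi> \<Longrightarrow> ?q \<Phi> s \<Longrightarrow> \<not> ?q \<Psi> {} \<Longrightarrow>
     \<exists>b \<mu>. weight b \<mu> 1 \<and> \<Phi> (s \<union> b) \<and> (\<forall>B\<subseteq>b. \<Psi> B \<longrightarrow> sum \<mu> B \<le> 1 - \<theta>)"
    using cons.IH by blast
  show ?case
  \<comment> \<open>A set whose outer part keeps the rank of \<open>l\<close> has at most half of
    the outer mass, in total at most 3/4. Any other set has at most \<open>1 - \<theta>\<close> of
    the inner mass, in total at most \<open>1 - \<theta> / 2\<close>.\<close>
  proof (intro exI[of _ "min (1/4) (\<theta> / 2)"] conjI allI impI)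
    show "0 < min (1/4) (\<theta> / 2)" using \<theta> by simp
    fix \<Phi> \<Psi> :: "'v set \<Rightarrow> bool" and s
    assume h: "hered \<Psi>" and q: "foldr (rext F) (a # l) \<Phi> s" and n: "\<not> foldr (rext F) (a # l) \<Psi> {}"
    have hl: "hered (?q \<Psi>)" by (rule transfers_hered[OF transfers_foldr h])
    obtain b \<mu> where b: "weight b \<mu> 1" "?q \<Phi> (s \<union> b)" and bB: "\<And>B. B \<subseteq> b \<Longrightarrow> ?q \<Psi> B \<Longrightarrow> sum \<mu> B \<le> 1/2"
      using small_weightsE[OF small_weights_rext _ hl, of "1/2" F a "?q \<Phi>" s] q n by auto
    define I where "I = {B. B \<subseteq> b \<and> \<not> ?q \<Psi> B}"
    have hB: "hered (\<lambda>C. \<Psi> (B \<union> C))" for B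
      by (rule hered_shift[OF h])
    have "\<not> ?q (\<lambda>C. \<exists>B\<in>I. \<Psi> (B \<union> C)) {}"
    proof (rule distributes_finite[OF distributes_foldr transfers_foldr _ hB])
      show "finite I" using b(1) by (auto simp: I_def weight_def)
      show "\<not> ?q (\<lambda>C. \<Psi> (B \<union> C)) {}" if "B \<in> I" for B
        using that transfers_shift[OF transfers_foldr, of F l \<Psi> B] by (simp add: I_def)
    qed (rule foldr_rext_False)
    from IH[OF hered_Union[OF hB] b(2) this]
    obtain c \<nu> where c: "weight c \<nu> 1" "\<Phi> (s \<union> b \<union> c)"
      and cC: "\<And>C. C \<subseteq> c \<Longrightarrow> \<exists>B\<in>I. \<Psi> (B \<union> C) \<Longrightarrow> sum \<nu> C \<le> 1 - \<theta>"
      by auto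
    show "\<exists>b \<mu>. weight b \<mu> 1 \<and> \<Phi> (s \<union> b) \<and> (\<forall>B\<subseteq>b. \<Psi> B \<longrightarrow> sum \<mu> B \<le> 1 - min (1/4) (\<theta> / 2))"
    proof (intro exI conjI allI impI)
      show "weight (b \<union> c) (\<lambda>i. 1/2 * \<mu> i + 1/2 * \<nu> i) 1"
        using weight_add[OF b(1) c(1), of "1/2" "1/2"] by simp
      show "\<Phi> (s \<union> (b \<union> c))" using c(2) by (simp add: Un_assoc)
      fix D assume D: "D \<subseteq> b \<union> c" "\<Psi> D"
      have fD: "finite D" using D b(1) c(1) finite_subset by (auto simp: weight_def)
      have e: "(\<Sum>i\<in>D. 1/2 * \<mu> i + 1/2 * \<nu> i) = sum \<mu> D / 2 + sum \<nu> D / 2"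
        by (simp add: sum.distrib sum_divide_distrib)
      have le: "sum \<mu> D \<le> 1" "sum \<nu> D \<le> 1" using weight_le b(1) c(1) fD by blast+
      have mn: "min (1/4) (\<theta> / 2) \<le> 1/4" "min (1/4) (\<theta> / 2) \<le> \<theta> / 2" by simp_all
      show "(\<Sum>i\<in>D. 1/2 * \<mu> i + 1/2 * \<nu> i) \<le> 1 - min (1/4) (\<theta> / 2)"
      proof (cases "?q \<Psi> (D \<inter> b)")
        case True
        then have "sum \<mu> D \<le> 1/2" using bB[of "D \<inter> b"] weight_Int[OF b(1) fD] by simp
        then show ?thesis unfolding e using le mn by linarith
      next
        case False
        then have "D \<inter> b \<in> I" by (simp add: I_def)
        moreover have "(D \<inter> b) \<union> (D \<inter> c) = D" using D by blast
        then have "\<Psi> ((D \<inter> b) \<union> (D \<inter> c))" using D(2) by simp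
        ultimately have "sum \<nu> (D \<inter> c) \<le> 1 - \<theta>" by (intro cC) auto
        then have "sum \<nu> D \<le> 1 - \<theta>" using weight_Int[OF c(1) fD] by simp
        then show ?thesis unfolding e using le mn by linarith
      qed
    qed
  qed
qed

section \<open>Disjoint incompatible pieces and infinite branches\<close>

lemma pieces_pow:
  assumes q: "transfers F q" and F: "\<And>x. \<forall>\<^sub>F y in F. y \<noteq> x"
    and n: "\<not> (q ^^ k) \<Psi> {}" and p: "(q ^^ (k * N + M)) \<Phi> s"
  shows "\<exists>C. (\<forall>r<N. finite (C r) \<and> \<not> \<Psi> (C r)) \<and> disjoint_family_on C {..<N} \<and>
    (q ^^ M) \<Phi> (s \<union> (\<Union>r<N. C r))"
  using p
proof (induction N arbitrary: M)
  case 0 then show ?case by (auto simp: disjoint_family_on_def)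
next
  case (Suc N)
  have "k * Suc N + M = k * N + (k + M)" by simp
  from Suc.IH[of "k + M"] Suc.prems[unfolded this] obtain C where
    C: "\<And>r. r < N \<Longrightarrow> finite (C r)" "\<And>r. r < N \<Longrightarrow> \<not> \<Psi> (C r)" "disjoint_family_on C {..<N}"
    and p: "(q ^^ (k + M)) \<Phi> (s \<union> (\<Union>r<N. C r))" by blast
  define U where "U = (\<Union>r<N. C r)"
  have fU: "finite U" using C by (auto simp: U_def)
  \<comment> \<open>Deleting the finitely many used nodes is free along \<open>F\<close> and makes
    the next piece disjoint from the earlier ones.\<close>
  have V: "\<forall>\<^sub>F x in F. x \<in> - U"
    using eventually_ball_finite[OF fU, of "\<lambda>y x. y \<noteq> x" F] F
    by (auto elim: eventually_mono)
  \<comment> \<open>If every admissible \<open>D\<close> outside \<open>U\<close> satisfied \<Psi>,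
    the next \<open>k\<close> operators would transfer to \<Psi> at the root \<open>{}\<close>,
    contrary to \<open>n\<close>.\<close>
  have "\<exists>D. finite D \<and> D \<subseteq> - U \<and> (q ^^ M) \<Phi> ((s \<union> U) \<union> D) \<and> \<not> \<Psi> D"
  proof (rule ccontr)
    assume "\<not> ?thesis"
    then have *: "\<And>D. finite D \<Longrightarrow> D \<subseteq> - U \<Longrightarrow> (q ^^ M) \<Phi> ((s \<union> U) \<union> D) \<Longrightarrow> \<Psi> ({} \<union> D)" by auto
    have qk: "(q ^^ k) ((q ^^ M) \<Phi>) (s \<union> U)" using p by (simp add: U_def funpow_add)
    have "(q ^^ k) \<Psi> {}" by (rule transfersD[OF transfers_pow[OF q] V qk]) (rule *)
    with n show False by simp
  qed
  then obtain D where D: "finite D" "D \<subseteq> - U" "(q ^^ M) \<Phi> ((s \<union> U) \<union> D)" "\<not> \<Psi> D" by blast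
  have eq: "(\<Union>r<Suc N. (C(N := D)) r) = U \<union> D" by (auto simp: U_def less_Suc_eq)
  show ?case
  proof (intro exI[of _ "C(N := D)"] conjI)
    show "\<forall>r<Suc N. finite ((C(N := D)) r) \<and> \<not> \<Psi> ((C(N := D)) r)"
      using C D by (auto simp: less_Suc_eq)
    show "disjoint_family_on (C(N := D)) {..<Suc N}"
      using C(3) D(2) unfolding disjoint_family_on_def U_def by (auto simp: less_Suc_eq) blast+
    show "(q ^^ M) \<Phi> (s \<union> (\<Union>r<Suc N. (C(N := D)) r))"
      unfolding eq using D(3) by (simp add: Un_assoc)
  qed
qed

text \<open>A nonminimal exponent contains \<open>k * N\<close> copies of a smaller power whose
  \<open>k\<close>-th iterate fails for the rest of the list, hence \<open>N\<close> successive
  parts. A final piece joins one part per exponent; the inner parts are chosen bad together with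
  each outer part. A minimal exponent supplies a single node only, hence the premise on
  \<open>l\<close>.\<close>

lemma pieces_foldr:
  fixes l :: "'w::wellorder list" and N :: nat
  assumes F: "\<And>x. \<forall>\<^sub>F y in F. y \<noteq> x" and l: "\<And>a. a \<in> set l \<Longrightarrow> \<exists>b. b < a"
    and h: "hered \<Psi>" and p: "foldr (rext F) l \<Phi> s" and n: "\<not> foldr (rext F) l \<Psi> {}"
  shows "\<exists>C. (\<forall>r<N. finite (C r) \<and> \<not> \<Psi> (C r)) \<and> disjoint_family_on C {..<N} \<and> \<Phi> (s \<union> (\<Union>r<N. C r))"
  using l h p n
proof (induction l arbitrary: \<Psi> s)
  case Nil
  then show ?case by (intro exI[of _ "\<lambda>_. {}"]) (auto simp: disjoint_family_on_def)
next
  case (Cons a l)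
  let ?q = "foldr (rext F) l"
  have "\<not> rext F a (?q \<Psi>) {}" using Cons.prems by simp
  then obtain b k where b: "b < a" "\<not> (rext F b ^^ k) (?q \<Psi>) {}"
    using Cons.prems(1)[of a] by (cases rule: not_rextE) auto
  have "(rext F b ^^ (k * N + 0)) (?q \<Phi>) s"
    using rext_less[OF _ b(1), of F "?q \<Phi>" s "k * N"] Cons.prems by simp
  from pieces_pow[OF transfers_rext F b(2) this]
  obtain C where C: "\<And>r. r < N \<Longrightarrow> finite (C r)" "\<And>r. r < N \<Longrightarrow> \<not> ?q \<Psi> (C r)"
      "disjoint_family_on C {..<N}" "?q \<Phi> (s \<union> (\<Union>r<N. C r))"
    by auto
  define U where "U = (\<Union>r<N. C r)"
  have fU: "finite U" using C by (auto simp: U_def)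
  have V: "\<forall>\<^sub>F x in F. x \<in> - U"
    using eventually_ball_finite[OF fU, of "\<lambda>y x. y \<noteq> x" F] F
    by (auto elim: eventually_mono)
  \<comment> \<open>The inner parts come from a separate application and may meet nodes already
    used, so only \<open>D - U\<close> is counted.\<close>
  have hB: "hered (\<lambda>D. \<Psi> (C r \<union> (D - U)))" for r
    using Cons.prems(2) unfolding hered_def by (metis Diff_mono Un_mono order_refl)
  have "\<not> ?q (\<lambda>D. \<exists>r\<in>{..<N}. \<Psi> (C r \<union> (D - U))) {}"
  proof (rule distributes_finite[OF distributes_foldr transfers_foldr _ hB])
    show "\<not> ?q (\<lambda>D. \<Psi> (C r \<union> (D - U))) {}" if r: "r \<in> {..<N}" for r
    proof
      assume *: "?q (\<lambda>D. \<Psi> (C r \<union> (D - U))) {}"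
      have "?q \<Psi> (C r)"
      proof (rule transfersD[OF transfers_foldr V *])
        fix B assume "B \<subseteq> - U" "\<Psi> (C r \<union> ({} \<union> B - U))"
        moreover from this have "{} \<union> B - U = B" by blast
        ultimately show "\<Psi> (C r \<union> B)" by simp
      qed
      then show False using C(2) r by simp
    qed
  qed (auto simp: foldr_rext_False)
  note nU = this
  have sl: "\<And>a. a \<in> set l \<Longrightarrow> \<exists>b. b < a" using Cons.prems(1) by simp
  have "\<exists>D. (\<forall>r<N. finite (D r) \<and> \<not> (\<exists>r'\<in>{..<N}. \<Psi> (C r' \<union> (D r - U)))) \<and>
      disjoint_family_on D {..<N} \<and> \<Phi> (s \<union> (\<Union>r<N. C r) \<union> (\<Union>r<N. D r))"
    by (rule Cons.IH[OF _ hered_Union[OF hB] C(4) nU]) (rule sl)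
  then obtain D where D: "(\<forall>r<N. finite (D r) \<and> \<not> (\<exists>r'\<in>{..<N}. \<Psi> (C r' \<union> (D r - U)))) \<and>
      disjoint_family_on D {..<N} \<and> \<Phi> (s \<union> (\<Union>r<N. C r) \<union> (\<Union>r<N. D r))"
    by (rule exE)
  have D0: "finite (D r) \<and> \<not> (\<exists>r'\<in>{..<N}. \<Psi> (C r' \<union> (D r - U)))" if "r < N" for r
    by (rule D[THEN conjunct1, rule_format, OF that])
  have D1: "finite (D r)" if "r < N" for r by (rule D0[OF that, THEN conjunct1])
  have D1': "\<not> \<Psi> (C r \<union> (D r - U))" if "r < N" for r
  proof
    assume "\<Psi> (C r \<union> (D r - U))"
    then have "\<exists>r'\<in>{..<N}. \<Psi> (C r' \<union> (D r - U))" using that by (rule_tac bexI[where x = r]) simp_all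
    then show False using D0[OF that] by simp
  qed
  note D2 = D[THEN conjunct2, THEN conjunct1] and D3 = D[THEN conjunct2, THEN conjunct2]
  show ?case
  proof (rule exI[of _ "\<lambda>r. C r \<union> (D r - U)"], intro conjI allI impI)
    show "disjoint_family_on (\<lambda>r. C r \<union> (D r - U)) {..<N}"
      unfolding disjoint_family_on_def
    proof (intro ballI impI)
      fix m n assume *: "m \<in> {..<N}" "n \<in> {..<N}" "m \<noteq> n"
      have "C m \<inter> C n = {}" "D m \<inter> D n = {}"
        using C(3) D2 * by (simp_all add: disjoint_family_on_def)
      moreover have "C m \<subseteq> U" "C n \<subseteq> U" using * by (auto simp: U_def)
      ultimately show "(C m \<union> (D m - U)) \<inter> (C n \<union> (D n - U)) = {}" by blast
    qed
    have "s \<union> (\<Union>r<N. C r \<union> (D r - U)) = s \<union> (\<Union>r<N. C r) \<union> (\<Union>r<N. D r)"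
      by (auto simp: U_def)
    then show "\<Phi> (s \<union> (\<Union>r<N. C r \<union> (D r - U)))" using D3 by simp
    fix r assume "r < N"
    then show "finite (C r \<union> (D r - U))" "\<not> \<Psi> (C r \<union> (D r - U))" using C(1) D1 D1' by simp_all
  qed
qed

text \<open>If no \<open>x\<close> in \<open>V\<close> kept all ranks, each would lose some rank
  \<open>m x\<close>, and one \<open>a\<close> bounds all of these. Rank \<omega>^c with
  \<open>a < c\<close> contains two copies of \<omega>^a: the outer one provides a node in
  \<open>V\<close>, the inner one the rank above it.\<close>

lemma rext_step:
  fixes L :: "'v set \<Rightarrow> bool"
  assumes inf: "infinite (UNIV :: 'v set)" and V: "\<forall>\<^sub>F x in F. x \<in> V"
    and L: "\<And>a :: 'v succ_card. rext F a L s"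
  shows "\<exists>x\<in>V. \<forall>a :: 'v succ_card. rext F a L (insert x s)"
proof (rule ccontr)
  assume "\<not> ?thesis"
  then have "\<forall>x\<in>V. \<exists>a :: 'v succ_card. \<not> rext F a L (insert x s)" by blast
  then obtain m :: "'v \<Rightarrow> 'v succ_card" where m: "\<And>x. x \<in> V \<Longrightarrow> \<not> rext F (m x) L (insert x s)" by metis
  obtain a where a: "\<And>x. m x < a" using succ_card_bounded[OF inf, of m] by blast
  obtain c where c: "a < c" using succ_card_bounded[OF inf, of "\<lambda>_. a"] by blast
  have "rext F a (rext F a L) s" using rext_less[OF L c, of 2] by (simp add: numeral_2_eq_2)
  then have "\<exists>\<^sub>F x in F. rext F a L (insert x s)" using rext_extend unfolding extend_def by metis
  then have "\<exists>\<^sub>F x in F. x \<in> V \<and> rext F a L (insert x s)"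
    using V by (auto elim!: frequently_rev_mp eventually_mono)
  then obtain x where "x \<in> V" "rext F a L (insert x s)" by (auto dest: frequently_ex)
  then show False using m rext_mono_index a less_imp_le by blast
qed

subsection \<open>The Nash-Williams dichotomy\<close>

definition beyond :: "nat set \<Rightarrow> nat set \<Rightarrow> nat set" where
  "beyond s L = {m \<in> L. \<forall>x\<in>s. x < m}"

text \<open>Acceptance, rejection and decision in the sense of Galvin and Prikry. Initial segments
  are written as intersections with \<open>{..<n}\<close>, and only the part of \<open>L\<close>
  beyond \<open>s\<close> counts.\<close>

definition accepts :: "nat set set \<Rightarrow> nat set \<Rightarrow> nat set \<Rightarrow> bool" where
  "accepts \<F> s M \<longleftrightarrow> (\<forall>L\<subseteq>M. infinite L \<longrightarrow> (\<exists>n. (s \<union> beyond s L) \<inter> {..<n} \<in> \<F>))"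

definition rejects :: "nat set set \<Rightarrow> nat set \<Rightarrow> nat set \<Rightarrow> bool" where
  "rejects \<F> s M \<longleftrightarrow> (\<forall>L\<subseteq>M. infinite L \<longrightarrow> \<not> accepts \<F> s L)"

definition decides :: "nat set set \<Rightarrow> nat set \<Rightarrow> nat set \<Rightarrow> bool" where
  "decides \<F> s M \<longleftrightarrow> accepts \<F> s M \<or> rejects \<F> s M"

lemma beyond_idem: "beyond s (beyond s L) = beyond s L"
  by (auto simp: beyond_def)

lemma infinite_beyond:
  assumes "finite s" "infinite L" shows "infinite (beyond s L)"
proof -
  have "L \<subseteq> beyond s L \<union> {.. Max (insert 0 s)}"
    using assms(1) by (fastforce simp: beyond_def not_less intro: Max_ge_iff[THEN iffD2])
  then show ?thesis using assms(2) by (metis finite_Un finite_atMost finite_subset)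
qed

lemma accepts_beyond:
  assumes "finite s" "accepts \<F> s M" "beyond s L \<subseteq> M" shows "accepts \<F> s L"
  unfolding accepts_def
proof (intro allI impI)
  fix K assume K: "K \<subseteq> L" "infinite K"
  have "beyond s K \<subseteq> M" using K(1) assms(3) by (auto simp: beyond_def)
  then have "\<exists>n. (s \<union> beyond s (beyond s K)) \<inter> {..<n} \<in> \<F>"
    using assms(2) infinite_beyond[OF assms(1) K(2)] unfolding accepts_def by blast
  then show "\<exists>n. (s \<union> beyond s K) \<inter> {..<n} \<in> \<F>" by (simp add: beyond_idem)
qed

lemma rejects_beyond:
  assumes "finite s" "rejects \<F> s M" "beyond s L \<subseteq> M" shows "rejects \<F> s L"
  unfolding rejects_def
proof (intro allI impI notI)
  fix K assume K: "K \<subseteq> L" "infinite K" "accepts \<F> s K"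
  have "beyond s K \<subseteq> M" using K(1) assms(3) by (auto simp: beyond_def)
  moreover have "accepts \<F> s (beyond s K)"
    by (rule accepts_beyond[OF assms(1) K(3)]) (auto simp: beyond_def)
  ultimately show False
    using assms(2) infinite_beyond[OF assms(1) K(2)] unfolding rejects_def by blast
qed

lemma decides_beyond:
  "finite s \<Longrightarrow> decides \<F> s M \<Longrightarrow> beyond s L \<subseteq> M \<Longrightarrow> decides \<F> s L"
  unfolding decides_def using accepts_beyond rejects_beyond by blast

lemma ex_decides_finite:
  assumes "finite S" "\<And>s. s \<in> S \<Longrightarrow> finite s" "infinite M"
  shows "\<exists>M'\<subseteq>M. infinite M' \<and> (\<forall>s\<in>S. decides \<F> s M')"
  using assms(1,2)
proof (induction S rule: finite_induct)
  case empty then show ?case using assms(3) by blast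
next
  case (insert s S)
  then obtain M' where M': "M' \<subseteq> M" "infinite M'" "\<And>s. s \<in> S \<Longrightarrow> decides \<F> s M'" by auto
  have "\<exists>M''\<subseteq>M'. infinite M'' \<and> decides \<F> s M''"
    using M'(2) unfolding decides_def rejects_def by (metis order_refl)
  then obtain M'' where M'': "M'' \<subseteq> M'" "infinite M''" "decides \<F> s M''" by blast
  have "decides \<F> t M''" if "t \<in> S" for t
    by (rule decides_beyond[OF _ M'(3)[OF that]])
      (use M''(1) insert.prems that in \<open>auto simp: beyond_def\<close>)
  then show ?case using M' M'' by blast
qed

text \<open>Diagonal construction: the \<open>n\<close>-th reservoir decides all subsets of
  \<open>{..g n}\<close> and contains all later points, so a finite nonempty \<open>s\<close> is
  decided by the reservoir at its maximum. The empty set has no maximum and is decided beforehand by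
  \<open>M0\<close>.\<close>

lemma ex_decides_all:
  assumes "infinite M"
  obtains N where "N \<subseteq> M" "infinite N" "\<And>s. finite s \<Longrightarrow> s \<subseteq> N \<Longrightarrow> decides \<F> s N"
proof -
  obtain M0 where M0: "M0 \<subseteq> M" "infinite M0" "decides \<F> {} M0"
    using ex_decides_finite[of "{{}}" M \<F>] assms by auto
  define P where "P = (\<lambda>(n::nat) (m, K). m \<in> M0 \<and> K \<subseteq> M0 \<and> infinite K \<and> K \<subseteq> {m<..} \<and>
      (\<forall>s\<in>Pow {..m}. decides \<F> s K))"
  have ext: "\<exists>K'. K' \<subseteq> K \<and> P n (m, K')" if "m \<in> M0" "K \<subseteq> M0" "infinite K" for m K n
  proof -
    have "beyond {m} K = K \<inter> {m<..}" by (auto simp: beyond_def)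
    then have "infinite (K \<inter> {m<..})" using infinite_beyond[of "{m}" K] that(3) by simp
    then obtain K' where "K' \<subseteq> K \<inter> {m<..}" "infinite K'" "\<forall>s\<in>Pow {..m}. decides \<F> s K'"
      using ex_decides_finite[of "Pow {..m}" "K \<inter> {m<..}" \<F>]
      by (metis PowD finite_Pow_iff finite_atMost finite_subset)
    then show ?thesis using that(1,2) by (intro exI[of _ K']) (auto simp: P_def)
  qed
  obtain m0 where m0: "m0 \<in> M0" using M0(2) by (metis finite.emptyI ex_in_conv)
  have "\<exists>f. \<forall>n. P n (f n) \<and> (fst (f (Suc n)) \<in> snd (f n) \<and> snd (f (Suc n)) \<subseteq> snd (f n))"
  proof (rule dependent_nat_choice)
    show "\<exists>x. P 0 x" using ext[OF m0 order_refl M0(2)] by blast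
    fix x n assume x: "P n x"
    obtain m K where mK: "x = (m, K)" by (cases x)
    have "K \<noteq> {}" using x mK by (auto simp: P_def)
    then obtain m' where "m' \<in> K" by blast
    then obtain K' where "K' \<subseteq> K" "P (Suc n) (m', K')"
      using ext[of m' K "Suc n"] x unfolding mK P_def case_prod_conv by blast
    then show "\<exists>y. P (Suc n) y \<and> fst y \<in> snd x \<and> snd y \<subseteq> snd x"
      using \<open>m' \<in> K\<close> by (intro exI[of _ "(m', K')"]) (simp add: mK)
  qed
  then obtain f where f: "\<And>n. P n (f n)" "\<And>n. fst (f (Suc n)) \<in> snd (f n)"
      "\<And>n. snd (f (Suc n)) \<subseteq> snd (f n)" by blast
  define g where "g = fst \<circ> f"
  have P: "g n \<in> M0" "snd (f n) \<subseteq> {g n<..}" "\<And>s. s \<subseteq> {..g n} \<Longrightarrow> decides \<F> s (snd (f n))" for n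
    using f(1)[of n] by (auto simp: P_def g_def split: prod.splits)
  have "antimono (\<lambda>n. snd (f n))" using f(3) by (simp add: antimono_iff_le_Suc)
  then have mono: "snd (f j) \<subseteq> snd (f i)" if "i \<le> j" for i j using that by (rule antimonoD)
  have gK: "g j \<in> snd (f i)" if "i < j" for i j
  proof -
    have "i \<le> j - 1" using that by simp
    from mono[OF this] f(2)[of "j - 1"] that show ?thesis by (auto simp: g_def)
  qed
  have sm: "strict_mono g" using gK P(2) by (intro strict_monoI) blast
  show thesis
  proof (rule that[of "range g"])
    show "range g \<subseteq> M" using P(1) M0(1) by blast
    show "infinite (range g)" using sm by (simp add: range_inj_infinite strict_mono_imp_inj_on)
    fix s assume s: "finite s" "s \<subseteq> range g"
    show "decides \<F> s (range g)"
    proof (cases "s = {}")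
      case True
      show ?thesis unfolding True by (rule decides_beyond[OF _ M0(3)]) (use P(1) in \<open>auto simp: beyond_def\<close>)
    next
      case False
      then obtain i where i: "Max s = g i" using s Max_in by blast
      have "s \<subseteq> {..g i}" using s(1) i by (metis Max_ge atMost_iff subsetI)
      moreover have "beyond s (range g) \<subseteq> snd (f i)"
      proof
        fix x assume "x \<in> beyond s (range g)"
        then obtain j where j: "x = g j" "g i < g j"
          using i Max_in[OF s(1) False] by (auto simp: beyond_def)
        then show "x \<in> snd (f i)" using gK strict_mono_less[OF sm] by simp
      qed
      ultimately show ?thesis using decides_beyond[OF s(1) P(3)] by blast
    qed
  qed
qed

text \<open>Acceptance of \<open>{}\<close> is the second alternative. Otherwise \<open>{}\<close>
  is rejected, rejection survives almost all one-point extensions, and a set is built all of whose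
  finite subsets are rejected. A member of \<open>\<F>\<close> is never rejected, being an initial
  segment of each of its end-extensions.\<close>

theorem nash_williams_dichotomy:
  fixes \<F> :: "nat set set"
  assumes "infinite M"
  obtains N where "N \<subseteq> M" "infinite N"
    "(\<forall>s\<subseteq>N. finite s \<longrightarrow> s \<notin> \<F>) \<or> (\<forall>L\<subseteq>N. infinite L \<longrightarrow> (\<exists>n. L \<inter> {..<n} \<in> \<F>))"
proof -
  obtain N where N: "N \<subseteq> M" "infinite N" and dec: "\<And>s. finite s \<Longrightarrow> s \<subseteq> N \<Longrightarrow> decides \<F> s N"
    using ex_decides_all[OF assms, of \<F>] by blast
  show thesis
  proof (cases "accepts \<F> {} N")
    case True
    then show ?thesis using that[OF N] by (auto simp: accepts_def beyond_def)
  next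
    case False
    then have r0: "rejects \<F> {} N" using dec[of "{}"] by (simp add: decides_def)
    \<comment> \<open>Infinitely many exceptional points would form a set that accepts
      \<open>s\<close>: the least element \<open>n\<close> of an infinite subset reduces acceptance
      of \<open>s\<close> to acceptance of \<open>insert n s\<close>.\<close>
    have step: "finite {n \<in> beyond s N. \<not> rejects \<F> (insert n s) N}"
      if s: "finite s" "s \<subseteq> N" "rejects \<F> s N" for s
    proof (rule ccontr)
      let ?T = "{n \<in> beyond s N. \<not> rejects \<F> (insert n s) N}"
      assume inf: "infinite ?T"
      have TN: "?T \<subseteq> N" by (auto simp: beyond_def)
      have "accepts \<F> s ?T"
        unfolding accepts_def
      proof (intro allI impI)
        fix L assume L: "L \<subseteq> ?T" "infinite L"
        define n where "n = (LEAST n. n \<in> L)"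
        have "\<exists>n. n \<in> L" using infinite_imp_nonempty[OF L(2)] by blast
        then have n: "n \<in> L" unfolding n_def by (rule LeastI_ex)
        have nle: "n \<le> k" if "k \<in> L" for k unfolding n_def using that by (rule Least_le)
        have "accepts \<F> (insert n s) N"
          using dec[of "insert n s"] s n L(1) TN unfolding decides_def by blast
        then obtain k where "(insert n s \<union> beyond (insert n s) L) \<inter> {..<k} \<in> \<F>"
          using L TN unfolding accepts_def by blast
        moreover have "insert n s \<union> beyond (insert n s) L = s \<union> beyond s L"
          using n L(1) nle by (auto simp: beyond_def le_less)
        ultimately show "\<exists>k. (s \<union> beyond s L) \<inter> {..<k} \<in> \<F>" by auto
      qed
      then show False using s(3) inf TN unfolding rejects_def by blast
    qed
    define P where "P = (\<lambda>(n::nat) t. finite t \<and> t \<subseteq> N \<and> (\<forall>s\<in>Pow t. rejects \<F> s N))"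
    define Q where "Q = (\<lambda>(n::nat) t t' :: nat set. \<exists>k. (\<forall>x\<in>t. x < k) \<and> t' = insert k t)"
    have "\<exists>f. \<forall>n. P n (f n) \<and> Q n (f n) (f (Suc n))"
    proof (rule dependent_nat_choice)
      show "\<exists>x. P 0 x" using r0 by (intro exI[of _ "{}"]) (simp add: P_def)
      fix t n assume t: "P n t"
      \<comment> \<open>The new point is added to every subset of \<open>t\<close>, so the
        exceptions of all these subsets are avoided at once.\<close>
      define U where "U = (\<Union>s\<in>Pow t. {n \<in> beyond s N. \<not> rejects \<F> (insert n s) N})"
      have "finite U"
        unfolding U_def using t by (intro finite_UN_I step) (auto simp: P_def intro: finite_subset)
      moreover have "infinite (beyond t N)" using infinite_beyond t N(2) by (auto simp: P_def)
      ultimately have "infinite (beyond t N - U)" by (rule Diff_infinite_finite)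
      then have "beyond t N - U \<noteq> {}" by (metis finite.emptyI)
      then obtain k where k: "k \<in> beyond t N" "k \<notin> U" by blast
      have "rejects \<F> s N" if "s \<subseteq> insert k t" for s
      proof (cases "k \<in> s")
        case True
        have "s - {k} \<subseteq> t" using that by blast
        then have "rejects \<F> (insert k (s - {k})) N"
          using k unfolding U_def beyond_def by blast
        then show ?thesis using True by (simp add: insert_absorb)
      next
        case False
        then show ?thesis using that t by (auto simp: P_def)
      qed
      then show "\<exists>y. P (Suc n) y \<and> Q n t y"
        using t k(1) by (intro exI[of _ "insert k t"]) (auto simp: P_def Q_def beyond_def)
    qed
    then obtain f where f: "\<And>n. P n (f n)" "\<And>n. Q n (f n) (f (Suc n))" by blast
    have mono: "mono f" using f(2) by (intro mono_iff_le_Suc[THEN iffD2]) (auto simp: Q_def)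
    have card: "card (f n) \<ge> n" for n
    proof (induction n)
      case (Suc n)
      obtain k where "\<forall>x\<in>f n. x < k" "f (Suc n) = insert k (f n)" using f(2)[of n] by (auto simp: Q_def)
      moreover have "finite (f n)" using f(1)[of n] by (simp add: P_def)
      ultimately show ?case using Suc by (auto simp: card_insert_if)
    qed simp
    define N' where "N' = (\<Union>n. f n)"
    have N'N: "N' \<subseteq> N" using f(1) by (auto simp: N'_def P_def)
    have inf: "infinite N'"
    proof
      assume "finite N'"
      then have "card (f (Suc (card N'))) \<le> card N'" by (intro card_mono) (auto simp: N'_def)
      then show False using card[of "Suc (card N')"] by simp
    qed
    have "s \<notin> \<F>" if s: "s \<subseteq> N'" "finite s" for s
    proof
      assume sF: "s \<in> \<F>"
      have "\<exists>n. s \<subseteq> f n"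
        using s(2,1)
      proof (induction s rule: finite_induct)
        case (insert x s)
        then obtain n m where "s \<subseteq> f n" "x \<in> f m" by (auto simp: N'_def)
        then show ?case using monoD[OF mono, of n "max n m"] monoD[OF mono, of m "max n m"]
          by (intro exI[of _ "max n m"]) auto
      qed simp
      then have rej: "rejects \<F> s N" using f(1) by (auto simp: P_def)
      have "accepts \<F> s N"
        unfolding accepts_def
      proof (intro allI impI)
        fix L :: "nat set"
        have "(s \<union> beyond s L) \<inter> {..<Suc (Max s)} = s" if "s \<noteq> {}"
          using s(2) Max_in[OF s(2) that] by (auto simp: beyond_def less_Suc_eq_le)
        then show "\<exists>n. (s \<union> beyond s L) \<inter> {..<n} \<in> \<F>"
          using sF by (cases "s = {}") (metis Int_empty_right lessThan_0, metis)
      qed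
      then show False using rej N(2) unfolding rejects_def by blast
    qed
    then show ?thesis using that[of N'] N'N N(1) inf by blast
  qed
qed

subsection \<open>Bases and block bases\<close>

text \<open>Grunblum's condition, with \<open>K\<close> a bound for the basis constant. As it
  concerns finite sums only, it passes to block bases and to limits of norms with the same
  \<open>K\<close>.\<close>

definition bounded_projections :: "real \<Rightarrow> (nat \<Rightarrow> 'a::real_normed_vector) \<Rightarrow> bool" where
  "bounded_projections K x \<longleftrightarrow> (\<forall>m n a. m \<le> n \<longrightarrow>
     norm (\<Sum>i<m. a i *\<^sub>R x i) \<le> K * norm (\<Sum>i<n. a i *\<^sub>R x i))"

lemma bounded_projectionsD:
  "bounded_projections K x \<Longrightarrow> m \<le> n \<Longrightarrow> norm (\<Sum>i<m. a i *\<^sub>R x i) \<le> K * norm (\<Sum>i<n. a i *\<^sub>R x i)"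
  by (auto simp: bounded_projections_def)

lemma bounded_projections_nonneg:
  assumes "bounded_projections K x" "x 0 \<noteq> 0" shows "1 \<le> K"
proof -
  have "norm (\<Sum>i<1. 1 *\<^sub>R x i) \<le> K * norm (\<Sum>i<1. 1 *\<^sub>R x i)"
    by (rule bounded_projectionsD[OF assms(1)]) simp
  then show ?thesis using assms(2) by simp
qed

lemma bounded_projections_coeff:
  assumes "bounded_projections K x" "0 \<le> K" "j < n"
  shows "\<bar>a j\<bar> * norm (x j) \<le> 2 * K * norm (\<Sum>i<n. a i *\<^sub>R x i)"
proof -
  have "a j *\<^sub>R x j = (\<Sum>i<Suc j. a i *\<^sub>R x i) - (\<Sum>i<j. a i *\<^sub>R x i)" by simp
  then have "norm (a j *\<^sub>R x j) \<le> norm (\<Sum>i<Suc j. a i *\<^sub>R x i) + norm (\<Sum>i<j. a i *\<^sub>R x i)"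
    by (metis norm_triangle_ineq4)
  also have "\<dots> \<le> K * norm (\<Sum>i<n. a i *\<^sub>R x i) + K * norm (\<Sum>i<n. a i *\<^sub>R x i)"
    by (intro add_mono bounded_projectionsD[OF assms(1)]) (use assms(3) in auto)
  finally show ?thesis by simp
qed

lemma span_eq_sums:
  fixes x :: "nat \<Rightarrow> 'a::real_vector"
  assumes "v \<in> span (range x)"
  obtains a n where "v = (\<Sum>i<n. a i *\<^sub>R x i)" "\<And>i. i \<ge> n \<Longrightarrow> a i = 0"
proof -
  let ?S = "{v. \<exists>a n. v = (\<Sum>i<n. a i *\<^sub>R x i) \<and> (\<forall>i\<ge>n. a i = 0)}"
  have "subspace ?S"
  proof (rule subspaceI)
    show "0 \<in> ?S" by (auto intro!: exI[of _ "\<lambda>_. 0"])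
    fix u v assume "u \<in> ?S" "v \<in> ?S"
    then obtain a n b m where u: "u = (\<Sum>i<n. a i *\<^sub>R x i)" "\<forall>i\<ge>n. a i = 0"
      and v: "v = (\<Sum>i<m. b i *\<^sub>R x i)" "\<forall>i\<ge>m. b i = 0" by auto
    have "u = (\<Sum>i<max n m. a i *\<^sub>R x i)" "v = (\<Sum>i<max n m. b i *\<^sub>R x i)"
      unfolding u(1) v(1) by (rule sum.mono_neutral_left; use u(2) v(2) in auto)+
    then have "u + v = (\<Sum>i<max n m. (a i + b i) *\<^sub>R x i)"
      by (simp add: sum.distrib scaleR_add_left)
    then show "u + v \<in> ?S"
      using u(2) v(2) by (auto intro!: exI[of _ "\<lambda>i. a i + b i"] exI[of _ "max n m"])
  next
    fix c u assume "u \<in> ?S"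
    then obtain a n where u: "u = (\<Sum>i<n. a i *\<^sub>R x i)" "\<forall>i\<ge>n. a i = 0" by auto
    then show "c *\<^sub>R u \<in> ?S"
      by (auto intro!: exI[of _ "\<lambda>i. c * a i"] exI[of _ n] simp: scaleR_sum_right)
  qed
  moreover have "x j \<in> ?S" for j
    by (auto intro!: exI[of _ "\<lambda>i. if i = j then 1 else 0"] exI[of _ "Suc j"] simp: if_distrib[of "\<lambda>c. c *\<^sub>R _"] cong: if_cong)
  ultimately have "span (range x) \<subseteq> ?S" by (intro span_minimal) auto
  then show thesis using assms that by blast
qed

text \<open>The sufficient half of Grunblum's criterion. Approximants of \<open>v\<close> from the
  span have coordinatewise Cauchy coefficients, and the bound on partial sums, uniform in their
  length, makes the limiting coefficients expand \<open>v\<close>.\<close>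

lemma basic_sequenceI:
  fixes x :: "nat \<Rightarrow> 'a::real_normed_vector"
  assumes x: "\<And>i. x i \<noteq> 0" and K: "bounded_projections K x"
  shows "basic_sequence x"
proof -
  have K1: "1 \<le> K" using bounded_projections_nonneg[OF K x] .
  have zero: "a = (\<lambda>_. 0)" if "(\<lambda>i. a i *\<^sub>R x i) sums 0" for a
  proof
    fix j
    have "(\<lambda>n. 2 * K * norm (\<Sum>i<n. a i *\<^sub>R x i)) \<longlonglongrightarrow> 2 * K * norm (0 :: 'a)"
      using that unfolding sums_def by (intro tendsto_intros)
    moreover have "\<forall>\<^sub>F n in sequentially. \<bar>a j\<bar> * norm (x j) \<le> 2 * K * norm (\<Sum>i<n. a i *\<^sub>R x i)"
      using eventually_gt_at_top[of j]
      by eventually_elim (use bounded_projections_coeff[OF K] K1 in auto)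
    ultimately have "\<bar>a j\<bar> * norm (x j) \<le> 2 * K * norm (0 :: 'a)"
      by (intro tendsto_lowerbound) auto
    then show "a j = 0" using x[of j] by (simp add: mult_le_0_iff)
  qed
  have ex: "\<exists>a. (\<lambda>i. a i *\<^sub>R x i) sums v" if v: "v \<in> closure (span (range x))" for v
  proof -
    obtain w where w: "\<And>k. w k \<in> span (range x)" "w \<longlonglongrightarrow> v"
      using v unfolding closure_sequential by blast
    have "\<exists>b n. w k = (\<Sum>i<n. b i *\<^sub>R x i) \<and> (\<forall>i\<ge>n. b i = 0)" for k
      using span_eq_sums[OF w(1)[of k]] by metis
    then obtain b n where bn: "\<And>k. w k = (\<Sum>i<n k. b k i *\<^sub>R x i)" "\<And>k i. i \<ge> n k \<Longrightarrow> b k i = 0"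
      by metis
    have wm: "w k = (\<Sum>i<m. b k i *\<^sub>R x i)" if "n k \<le> m" for k m
      unfolding bn(1) by (rule sum.mono_neutral_left) (use that bn(2) in auto)
    have P: "norm ((\<Sum>i<m. b k i *\<^sub>R x i) - (\<Sum>i<m. b l i *\<^sub>R x i)) \<le> K * norm (w k - w l)" for m k l
    proof -
      define N where "N = max m (max (n k) (n l))"
      have "(\<Sum>i<m. b k i *\<^sub>R x i) - (\<Sum>i<m. b l i *\<^sub>R x i) = (\<Sum>i<m. (b k i - b l i) *\<^sub>R x i)"
        by (simp add: scaleR_diff_left sum_subtractf)
      moreover have "w k - w l = (\<Sum>i<N. (b k i - b l i) *\<^sub>R x i)"
        using wm[of k N] wm[of l N] by (simp add: scaleR_diff_left sum_subtractf N_def)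
      ultimately show ?thesis using bounded_projectionsD[OF K, of m N] by (simp add: N_def)
    qed
    have Cw: "Cauchy w" using w(2) LIMSEQ_imp_Cauchy by blast
    have "Cauchy (\<lambda>k. b k j)" for j
    proof (rule metric_CauchyI)
      fix \<epsilon> :: real assume "0 < \<epsilon>"
      define \<delta> where "\<delta> = \<epsilon> * norm (x j) / (2 * K)"
      have "0 < \<delta>" using \<open>0 < \<epsilon>\<close> x K1 by (simp add: \<delta>_def)
      then obtain M where M: "\<And>k l. k \<ge> M \<Longrightarrow> l \<ge> M \<Longrightarrow> dist (w k) (w l) < \<delta>"
        using Cw unfolding Cauchy_def by blast
      have "dist (b k j) (b l j) < \<epsilon>" if "k \<ge> M" "l \<ge> M" for k l
      proof -
        have "(b k j - b l j) *\<^sub>R x j = ((\<Sum>i<Suc j. b k i *\<^sub>R x i) - (\<Sum>i<Suc j. b l i *\<^sub>R x i))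
            - ((\<Sum>i<j. b k i *\<^sub>R x i) - (\<Sum>i<j. b l i *\<^sub>R x i))"
          by (simp add: algebra_simps)
        then have "norm ((b k j - b l j) *\<^sub>R x j) \<le>
            norm ((\<Sum>i<Suc j. b k i *\<^sub>R x i) - (\<Sum>i<Suc j. b l i *\<^sub>R x i)) +
            norm ((\<Sum>i<j. b k i *\<^sub>R x i) - (\<Sum>i<j. b l i *\<^sub>R x i))"
          by (simp only: norm_triangle_ineq4)
        also have "\<dots> \<le> K * norm (w k - w l) + K * norm (w k - w l)" by (intro add_mono P)
        also have "\<dots> < 2 * K * \<delta>" using M[OF that] K1 by (simp add: dist_norm)
        also have "\<dots> = \<epsilon> * norm (x j)" using K1 by (simp add: \<delta>_def)
        finally show ?thesis using x by (simp add: dist_real_def)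
      qed
      then show "\<exists>M. \<forall>m\<ge>M. \<forall>n\<ge>M. dist (b m j) (b n j) < \<epsilon>" by blast
    qed
    then have "\<exists>l. (\<lambda>k. b k j) \<longlonglongrightarrow> l" for j
      using real_Cauchy_convergent convergent_def by blast
    then obtain a where a: "\<And>j. (\<lambda>k. b k j) \<longlonglongrightarrow> a j" by metis
    have lim: "norm ((\<Sum>i<m. b k i *\<^sub>R x i) - (\<Sum>i<m. a i *\<^sub>R x i)) \<le> K * norm (w k - v)" for m k
    proof (rule LIMSEQ_le)
      show "(\<lambda>l. norm ((\<Sum>i<m. b k i *\<^sub>R x i) - (\<Sum>i<m. b l i *\<^sub>R x i))) \<longlonglongrightarrow>
          norm ((\<Sum>i<m. b k i *\<^sub>R x i) - (\<Sum>i<m. a i *\<^sub>R x i))"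
        by (intro tendsto_intros a)
      show "(\<lambda>l. K * norm (w k - w l)) \<longlonglongrightarrow> K * norm (w k - v)"
        by (intro tendsto_intros w)
    qed (use P in blast)
    have "(\<lambda>m. \<Sum>i<m. a i *\<^sub>R x i) \<longlonglongrightarrow> v"
    proof (rule metric_LIMSEQ_I)
      fix \<epsilon> :: real assume "0 < \<epsilon>"
      then have "0 < \<epsilon> / (K + 1)" using K1 by simp
      then obtain k where k: "dist (w k) v < \<epsilon> / (K + 1)" using metric_LIMSEQ_D[OF w(2)] by blast
      have "dist (\<Sum>i<m. a i *\<^sub>R x i) v < \<epsilon>" if "m \<ge> n k" for m
      proof -
        have "dist (\<Sum>i<m. a i *\<^sub>R x i) v \<le> dist (w k) (\<Sum>i<m. a i *\<^sub>R x i) + dist (w k) v"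
          by (rule dist_triangle3)
        also have "\<dots> \<le> K * dist (w k) v + dist (w k) v"
          using lim[where m = m and k = k] wm[OF that] by (simp add: dist_norm)
        also have "\<dots> = (K + 1) * dist (w k) v" by (simp add: algebra_simps)
        also have "\<dots> < \<epsilon>" using k K1 by (simp add: field_simps)
        finally show ?thesis .
      qed
      then show "\<exists>M. \<forall>m\<ge>M. dist (\<Sum>i<m. a i *\<^sub>R x i) v < \<epsilon>" by blast
    qed
    then show ?thesis unfolding sums_def by blast
  qed
  show ?thesis
    unfolding basic_sequence_def schauder_basis_on_def
  proof (intro conjI ballI)
    show "range x \<subseteq> closure (span (range x))" by (rule order_trans[OF span_superset closure_subset])
    fix v assume "v \<in> closure (span (range x))"
    then obtain a where a: "(\<lambda>i. a i *\<^sub>R x i) sums v" using ex by blast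
    show "\<exists>!a. (\<lambda>i. a i *\<^sub>R x i) sums v"
    proof (rule ex1I)
      show "(\<lambda>i. a i *\<^sub>R x i) sums v" by (rule a)
      fix b assume "(\<lambda>i. b i *\<^sub>R x i) sums v"
      from sums_diff[OF this a] have "(\<lambda>i. b i - a i) = (\<lambda>_. 0)"
        by (intro zero) (simp add: scaleR_diff_left)
      then show "b = a" by (simp add: fun_eq_iff)
    qed
  qed
qed

lemma span_image_eq_sum:
  assumes "finite A" "v \<in> span (e ` A)"
  obtains a where "v = (\<Sum>i\<in>A. a i *\<^sub>R e i)"
proof -
  let ?S = "{v. \<exists>a. v = (\<Sum>i\<in>A. a i *\<^sub>R e i)}"
  have "subspace ?S"
  proof (rule subspaceI)
    show "0 \<in> ?S" by (auto intro!: exI[of _ "\<lambda>_. 0"])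
    fix u v assume "u \<in> ?S" "v \<in> ?S"
    then obtain a b where "u = (\<Sum>i\<in>A. a i *\<^sub>R e i)" "v = (\<Sum>i\<in>A. b i *\<^sub>R e i)" by auto
    then have "u + v = (\<Sum>i\<in>A. (a i + b i) *\<^sub>R e i)" by (simp add: sum.distrib scaleR_add_left)
    then show "u + v \<in> ?S" by (auto intro!: exI[of _ "\<lambda>i. a i + b i"])
  next
    fix c u assume "u \<in> ?S"
    then obtain a where "u = (\<Sum>i\<in>A. a i *\<^sub>R e i)" by auto
    then show "c *\<^sub>R u \<in> ?S" by (auto simp: scaleR_sum_right intro!: exI[of _ "\<lambda>i. c * a i"])
  qed
  moreover have "e j \<in> ?S" if "j \<in> A" for j
    using that assms(1)
    by (auto intro!: exI[of _ "\<lambda>i. if i = j then 1 else 0"] simp: if_distrib[of "\<lambda>c. c *\<^sub>R _"] cong: if_cong)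
  ultimately have "span (e ` A) \<subseteq> ?S" by (intro span_minimal) auto
  then show thesis using assms that by blast
qed

text \<open>Coefficients of different blocks live on disjoint intervals and glue to one scalar
  sequence. Strict monotonicity of \<open>p\<close> is automatic, because an empty interval spans
  only 0.\<close>

lemma block_basis_iff_span:
  "block_basis e x \<longleftrightarrow> (\<exists>p. \<forall>k. x k \<in> span (e ` {p k..<p (Suc k)}) \<and> x k \<noteq> 0)"
proof
  assume "block_basis e x"
  then obtain p :: "nat \<Rightarrow> nat" and a where "\<And>k. x k = (\<Sum>i\<in>{p k..<p (Suc k)}. a i *\<^sub>R e i)" "\<And>k. x k \<noteq> 0"
    unfolding block_basis_def by blast
  then show "\<exists>p. \<forall>k. x k \<in> span (e ` {p k..<p (Suc k)}) \<and> x k \<noteq> 0"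
    by (metis (no_types, lifting) imageI span_base span_scale span_sum)
next
  assume "\<exists>p. \<forall>k. x k \<in> span (e ` {p k..<p (Suc k)}) \<and> x k \<noteq> 0"
  then obtain p where p: "\<And>k. x k \<in> span (e ` {p k..<p (Suc k)})" "\<And>k. x k \<noteq> 0" by blast
  have "p k < p (Suc k)" for k using p[of k] by (cases "p k < p (Suc k)") auto
  then have sm: "strict_mono p" by (simp add: strict_mono_Suc_iff)
  have "\<exists>c. x k = (\<Sum>i\<in>{p k..<p (Suc k)}. c i *\<^sub>R e i)" for k
    using span_image_eq_sum[OF _ p(1)[of k]] by (metis finite_atLeastLessThan)
  then obtain c where c: "\<And>k. x k = (\<Sum>i\<in>{p k..<p (Suc k)}. c k i *\<^sub>R e i)" by metis
  define a where "a = (\<lambda>i. c (LEAST k. i < p (Suc k)) i)"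
  have "(LEAST j. i < p (Suc j)) = k" if "p k \<le> i" "i < p (Suc k)" for i k
  proof (rule Least_equality)
    show "k \<le> j" if j: "i < p (Suc j)" for j
    proof (rule ccontr)
      assume "\<not> k \<le> j"
      then have "p (Suc j) \<le> p k" using sm by (simp add: strict_mono_less_eq)
      then show False using j \<open>p k \<le> i\<close> by simp
    qed
  qed (rule that)
  then have "x k = (\<Sum>i\<in>{p k..<p (Suc k)}. a i *\<^sub>R e i)" for k
    unfolding c[of k] a_def by (intro sum.cong) auto
  then show "block_basis e x" unfolding block_basis_def using sm p(2) by blast
qed

lemma block_basisI:
  "(\<And>k. x k \<in> span (e ` {p k..<p (Suc k)})) \<Longrightarrow> (\<And>k. x k \<noteq> 0) \<Longrightarrow> block_basis e x"
  unfolding block_basis_iff_span by blast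

lemma block_basis_nonzero: "block_basis e x \<Longrightarrow> x k \<noteq> 0"
  by (auto simp: block_basis_def)

lemma block_basis_trans:
  assumes "block_basis e x" "block_basis x y" shows "block_basis e y"
proof -
  obtain p where p: "\<And>k. x k \<in> span (e ` {p k..<p (Suc k)})" and x0: "\<And>k. x k \<noteq> 0"
    using assms(1) unfolding block_basis_iff_span by blast
  obtain r where r: "\<And>k. y k \<in> span (x ` {r k..<r (Suc k)})" and y0: "\<And>k. y k \<noteq> 0"
    using assms(2) unfolding block_basis_iff_span by blast
  have "p k < p (Suc k)" for k using p[of k] x0[of k] by (cases "p k < p (Suc k)") auto
  then have sm: "strict_mono p" by (simp add: strict_mono_Suc_iff)
  have "x j \<in> span (e ` {p (r k)..<p (r (Suc k))})" if "r k \<le> j" "j < r (Suc k)" for j k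
  proof -
    have "p (r k) \<le> p j" "p (Suc j) \<le> p (r (Suc k))"
      using that sm by (simp_all add: strict_mono_less_eq)
    then have "span (e ` {p j..<p (Suc j)}) \<subseteq> span (e ` {p (r k)..<p (r (Suc k))})"
      by (intro span_mono image_mono) auto
    then show ?thesis using p[of j] by blast
  qed
  then have "span (x ` {r k..<r (Suc k)}) \<subseteq> span (e ` {p (r k)..<p (r (Suc k))})" for k
    by (intro span_minimal) auto
  then show ?thesis using r y0 by (intro block_basisI[of y e "\<lambda>k. p (r k)"]) auto
qed

lemma block_basis_subseq:
  assumes "block_basis e x" "strict_mono f" shows "block_basis e (x \<circ> f)"
proof (rule block_basis_trans[OF assms(1)], rule block_basisI)
  show "(x \<circ> f) k \<in> span (x ` {f k..<f (Suc k)})" for k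
    using assms(2) by (auto intro!: span_base simp: strict_mono_less)
  show "(x \<circ> f) k \<noteq> 0" for k using block_basis_nonzero[OF assms(1)] by simp
qed

lemma bounded_projections_block:
  assumes K: "bounded_projections K e" and x: "block_basis e x"
  shows "bounded_projections K x"
  unfolding bounded_projections_def
proof (intro allI impI)
  fix m n :: nat and b assume mn: "m \<le> n"
  obtain p a where sm: "strict_mono (p :: nat \<Rightarrow> nat)"
    and xa: "\<And>k. x k = (\<Sum>i\<in>{p k..<p (Suc k)}. a i *\<^sub>R e i)"
    using x unfolding block_basis_def by blast
  \<comment> \<open>\<open>LEAST k. i < p (Suc k)\<close> is the block containing \<open>i\<close>;
    below \<open>p 0\<close> there is no block and the coefficient is 0.\<close>
  define d where "d = (\<lambda>i. if i < p 0 then 0 else b (LEAST k. i < p (Suc k)) * a i)"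
  have least: "(LEAST j. i < p (Suc j)) = k" if "p k \<le> i" "i < p (Suc k)" for i k
  proof (rule Least_equality)
    show "k \<le> j" if j: "i < p (Suc j)" for j
    proof (rule ccontr)
      assume "\<not> k \<le> j"
      then have "p (Suc j) \<le> p k" using sm by (simp add: strict_mono_less_eq)
      then show False using j \<open>p k \<le> i\<close> by simp
    qed
  qed (rule that)
  have eq: "(\<Sum>k<n. b k *\<^sub>R x k) = (\<Sum>i<p n. d i *\<^sub>R e i)" for n
  proof (induction n)
    case 0 then show ?case by (simp add: d_def)
  next
    case (Suc n)
    have pn: "p n \<le> p (Suc n)" "p 0 \<le> p n" using sm by (simp_all add: strict_mono_less_eq)
    have "b n *\<^sub>R x n = (\<Sum>i\<in>{p n..<p (Suc n)}. d i *\<^sub>R e i)"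
      unfolding xa[of n] scaleR_sum_right
      by (intro sum.cong) (use least pn in \<open>auto simp: d_def\<close>)
    moreover have "{..<p (Suc n)} = {..<p n} \<union> {p n..<p (Suc n)}" using pn by auto
    ultimately show ?case using Suc.IH by (simp add: sum.union_disjoint ivl_disj_int)
  qed
  show "norm (\<Sum>i<m. b i *\<^sub>R x i) \<le> K * norm (\<Sum>i<n. b i *\<^sub>R x i)"
    unfolding eq by (rule bounded_projectionsD[OF K]) (use mn sm in \<open>simp add: strict_mono_less_eq\<close>)
qed

text \<open>Banach's theorem that the partial sum projections are uniformly bounded. Their
  continuity is not known in advance, so the sets \<open>E N\<close> need not be closed. Baire's
  theorem is applied to their closures, and the successive approximation from the proof of the open
  mapping theorem leads back to all \<open>x\<close>.\<close>

lemma schauder_basis_bounded_projections: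
  fixes e :: "nat \<Rightarrow> 'a::banach"
  assumes basis: "schauder_basis e"
  obtains K where "bounded_projections K e" "\<And>i. e i \<noteq> 0"
proof -
  have ex1: "\<exists>!a. (\<lambda>i. a i *\<^sub>R e i) sums x" for x
    using basis unfolding schauder_basis_on_def by blast
  define c where "c = (\<lambda>x. THE a. (\<lambda>i. a i *\<^sub>R e i) sums x)"
  have c: "(\<lambda>i. c x i *\<^sub>R e i) sums x" for x unfolding c_def by (rule theI'[OF ex1])
  have c_eq: "c x = a" if "(\<lambda>i. a i *\<^sub>R e i) sums x" for x a
    using ex1[of x] that c[of x] by blast
  define P where "P = (\<lambda>n x. \<Sum>i<n. c x i *\<^sub>R e i)"
  have c_diff: "c (x - y) = (\<lambda>i. c x i - c y i)" for x y
    by (rule c_eq) (use sums_diff[OF c c] in \<open>simp add: scaleR_diff_left\<close>)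
  have c_scale: "c (s *\<^sub>R x) = (\<lambda>i. s * c x i)" for s x
    by (rule c_eq) (use sums_scaleR_right[OF c, of s] in simp)
  have P_diff: "P n (x - y) = P n x - P n y" for n x y
    by (simp add: P_def c_diff scaleR_diff_left sum_subtractf)
  have P_scale: "P n (s *\<^sub>R x) = s *\<^sub>R P n x" for n s x
    by (simp add: P_def c_scale scaleR_sum_right)
  have P_lim: "(\<lambda>n. P n x) \<longlonglongrightarrow> x" for x using c[of x] by (simp add: P_def sums_def)
  have e0: "e i \<noteq> 0" for i
  proof
    assume "e i = 0"
    then have "(\<lambda>j. (if j = i then 1 else 0) *\<^sub>R e j) = (\<lambda>j. 0 *\<^sub>R e j)" by auto
    then have "c 0 = (\<lambda>j. if j = i then 1 else 0)" "c 0 = (\<lambda>j. 0)"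
      by (auto intro!: c_eq)
    then have "(\<lambda>j. if j = i then 1 else 0 :: real) = (\<lambda>j. 0)" by simp
    from fun_cong[OF this, of i] show False by simp
  qed
  define E where "E = (\<lambda>N::nat. {x. \<forall>n. norm (P n x) \<le> real N})"
  have "\<exists>N. x \<in> E N" for x
  proof -
    have "Bseq (\<lambda>n. P n x)" using P_lim convergentI convergent_imp_Bseq by blast
    then obtain B where "\<And>n. norm (P n x) \<le> B" unfolding Bseq_def by blast
    moreover obtain N where "B \<le> real N" using real_arch_simple by blast
    ultimately show ?thesis unfolding E_def by (auto intro!: exI[of _ N] intro: order_trans)
  qed
  then have U: "\<Union>(range (\<lambda>N. closure (E N))) = UNIV"
    using closure_subset by blast
  have "\<exists>N. interior (closure (E N)) \<noteq> {}"
  proof (rule ccontr)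
    assume "\<not> ?thesis"
    then have "Met_TC.mtopology interior_of \<Union>(range (\<lambda>N. closure (E N))) = {}"
      by (intro Met_TC.metric_Baire_category_alt)
        (auto simp: complete_UNIV)
    then show False unfolding U by simp
  qed
  then obtain N x0 where "x0 \<in> interior (closure (E N))" by blast
  then obtain r where r: "0 < r" "ball x0 r \<subseteq> closure (E N)"
    unfolding mem_interior by blast
  have near: "\<exists>y\<in>E N. norm (x0 + u - y) < r / 2" if "norm u < r" for u
  proof -
    have "x0 + u \<in> closure (E N)" using r(2) that by (auto simp: dist_norm)
    then show ?thesis
      using half_gt_zero[OF r(1)] unfolding closure_approachable
      by (fastforce simp: dist_norm norm_minus_commute)
  qed
  \<comment> \<open>Half the difference of approximants to \<open>x0 + u\<close> and
    \<open>x0 - u\<close> approximates \<open>u\<close>, and its projections are still bounded by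
    \<open>N\<close>; then everything is scaled by \<open>s\<close>.\<close>
  have app: "\<exists>y. norm (x - y) < r * s / 2 \<and> (\<forall>n. norm (P n y) \<le> real N * s)"
    if s: "0 < s" and x: "norm x < r * s" for x s
  proof -
    define u where "u = (1 / s) *\<^sub>R x"
    have u: "norm u < r" "norm (- u) < r" "x = s *\<^sub>R u"
      using s x by (simp_all add: u_def field_simps)
    obtain y1 y2 where y: "y1 \<in> E N" "y2 \<in> E N" "norm (x0 + u - y1) < r / 2" "norm (x0 - u - y2) < r / 2"
      using near[OF u(1)] near[OF u(2)] by auto
    define y where "y = (s / 2) *\<^sub>R (y1 - y2)"
    have "x - y = (s / 2) *\<^sub>R ((x0 + u - y1) - (x0 - u - y2))"
      unfolding u(3) y_def by (simp add: algebra_simps flip: scaleR_add_left)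
    then have "norm (x - y) \<le> (s / 2) * (norm (x0 + u - y1) + norm (x0 - u - y2))"
      using s norm_triangle_ineq4[of "x0 + u - y1" "x0 - u - y2"] by simp
    also have "\<dots> < (s / 2) * r" using y s by (intro mult_strict_left_mono) auto
    finally have 1: "norm (x - y) < r * s / 2" by (simp add: mult.commute)
    have "norm (P n y) \<le> real N * s" for n
    proof -
      have "norm (P n y) \<le> (s / 2) * (norm (P n y1) + norm (P n y2))"
        using s norm_triangle_ineq4[of "P n y1" "P n y2"] by (simp add: y_def P_scale P_diff)
      also have "\<dots> \<le> (s / 2) * (real N + real N)"
        using y(1,2) s unfolding E_def by (intro mult_left_mono add_mono) auto
      finally show ?thesis by (simp add: mult.commute)
    qed
    with 1 show ?thesis by blast
  qed
  define Y where "Y = (\<lambda>x s. SOME y. norm (x - y) < r * s / 2 \<and> (\<forall>n. norm (P n y) \<le> real N * s))"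
  have Y: "norm (x - Y x s) < r * s / 2" "norm (P n (Y x s)) \<le> real N * s"
    if "0 < s" "norm x < r * s" for x s n
    using someI_ex[OF app[OF that]] unfolding Y_def by blast+
  have main: "norm (P n x) \<le> 2 * real N" if x: "norm x < r" for x n
  proof -
    \<comment> \<open>Remainders of the successive approximation. Their bound halves at every step,
      so the projections of the corrections add up to at most \<open>2 * N\<close>.\<close>
    define z where "z = rec_nat x (\<lambda>k z. z - Y z ((1/2)^k))"
    have z0: "z 0 = x" and zS: "z (Suc k) = z k - Y (z k) ((1/2)^k)" for k by (simp_all add: z_def)
    have z: "norm (z k) < r * (1/2)^k" for k
    proof (induction k)
      case (Suc k)
      then show ?case using Y(1)[of "(1/2)^k" "z k"] by (simp add: zS)
    qed (simp add: z0 x)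
    define y where "y = (\<lambda>k. Y (z k) ((1/2)^k))"
    have Py: "norm (P n (y k)) \<le> real N * (1/2)^k" for n k
      using Y(2)[of "(1/2)^k" "z k" n] z by (simp add: y_def)
    have sumy: "(\<Sum>k<m. y k) = x - z m" for m
      by (induction m) (auto simp: z0 zS y_def)
    have geo: "(\<lambda>k. real N * (1/2)^k) sums (2 * real N)"
      using sums_mult[OF geometric_sums[of "1/2 :: real"], of "real N"] by (simp add: mult.commute)
    have "summable (\<lambda>k. c (y k) i)" for i
    proof (rule summable_comparison_test')
      show "summable (\<lambda>k. (2 / norm (e i)) * (real N * (1/2)^k))"
        using geo by (intro summable_mult) (auto simp: sums_iff)
      show "norm (c (y k) i) \<le> (2 / norm (e i)) * (real N * (1/2)^k)" for k
      proof -
        have "c (y k) i *\<^sub>R e i = P (Suc i) (y k) - P i (y k)" by (simp add: P_def)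
        then have "norm (c (y k) i *\<^sub>R e i) \<le> norm (P (Suc i) (y k)) + norm (P i (y k))"
          by (simp only: norm_triangle_ineq4)
        also have "\<dots> \<le> real N * (1/2)^k + real N * (1/2)^k" by (intro add_mono Py)
        finally show ?thesis using e0[of i] by (simp add: field_simps)
      qed
    qed
    then have ci: "(\<lambda>k. c (y k) i) sums (\<Sum>k. c (y k) i)" for i by (rule summable_sums)
    define a where "a = (\<lambda>i. \<Sum>k. c (y k) i)"
    define A where "A = (\<lambda>n. \<Sum>i<n. a i *\<^sub>R e i)"
    have PA: "(\<lambda>k. P n (y k)) sums A n" for n
      unfolding P_def A_def a_def by (intro sums_sum sums_scaleR_left ci)
    have tail: "norm (A n - (\<Sum>k<m. P n (y k))) \<le> 2 * real N * (1/2)^m" for n m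
    proof -
      have s: "(\<lambda>k. P n (y (k + m))) sums (A n - (\<Sum>k<m. P n (y k)))"
        using sums_split_initial_segment[OF PA] by simp
      have g: "(\<lambda>k. real N * (1/2)^(k + m)) sums (2 * real N * (1/2)^m)"
        using sums_mult2[OF geo, of "(1/2)^m"] by (simp add: power_add mult.assoc)
      show ?thesis
        using norm_suminf_le[of "\<lambda>k. P n (y (k + m))" "\<lambda>k. real N * (1/2)^(k + m)"] Py s g
        by (simp add: sums_iff)
    qed
    have "A \<longlonglongrightarrow> x"
    proof (rule metric_LIMSEQ_I)
      fix \<epsilon> :: real assume \<epsilon>: "0 < \<epsilon>"
      have "(\<lambda>m. (2 * real N + r) * (1/2)^m) \<longlonglongrightarrow> (2 * real N + r) * 0"
        by (intro tendsto_intros LIMSEQ_power_zero) auto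
      from order_tendstoD(2)[OF this, of "\<epsilon> / 2"] \<epsilon>
      obtain m where m: "(2 * real N + r) * (1/2)^m < \<epsilon> / 2"
        by (auto simp: eventually_sequentially)
      have "(\<lambda>n. \<Sum>k<m. P n (y k)) \<longlonglongrightarrow> (\<Sum>k<m. y k)" by (intro tendsto_sum P_lim)
      from metric_LIMSEQ_D[OF this, of "\<epsilon> / 2"] \<epsilon>
      obtain n0 where n0: "\<And>n. n \<ge> n0 \<Longrightarrow> norm ((\<Sum>k<m. P n (y k)) - (\<Sum>k<m. y k)) < \<epsilon> / 2"
        by (auto simp: dist_norm)
      have "dist (A n) x < \<epsilon>" if "n \<ge> n0" for n
      proof -
        have eq: "A n - x = (A n - (\<Sum>k<m. P n (y k))) + ((\<Sum>k<m. P n (y k)) - (\<Sum>k<m. y k)) - z m"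
          by (simp add: sumy)
        have "norm (A n - x) \<le> norm (A n - (\<Sum>k<m. P n (y k))) +
            norm ((\<Sum>k<m. P n (y k)) - (\<Sum>k<m. y k)) + norm (z m)"
          unfolding eq
          by (intro order_trans[OF norm_triangle_ineq4] add_mono norm_triangle_ineq order_refl)
        also have "\<dots> < 2 * real N * (1/2)^m + \<epsilon> / 2 + r * (1/2)^m"
          using tail[of n m] n0[OF that] z[of m] by linarith
        also have "\<dots> < \<epsilon>" using m by (simp add: algebra_simps)
        finally show ?thesis by (simp add: dist_norm)
      qed
      then show "\<exists>n0. \<forall>n\<ge>n0. dist (A n) x < \<epsilon>" by blast
    qed
    \<comment> \<open>Uniqueness of the expansion identifies the summed coefficients with those of
      \<open>x\<close>; this takes the place of continuity of the projections.\<close>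
    then have "c x = a" by (intro c_eq) (simp add: sums_def A_def)
    then have "P n x = A n" by (simp add: P_def A_def)
    then show ?thesis using tail[of n 0] by simp
  qed
  have PK: "norm (P n v) \<le> 4 * real N / r * norm v" for n v
  proof (cases "v = 0")
    case True
    show ?thesis using P_scale[of n 0 v] True by simp
  next
    case False
    have "norm ((r / (2 * norm v)) *\<^sub>R v) < r" using False r(1) by simp
    from main[OF this, of n] have "(r / (2 * norm v)) * norm (P n v) \<le> 2 * real N"
      using r(1) by (simp add: P_scale)
    then show ?thesis using False r(1) by (simp add: field_simps)
  qed
  have "bounded_projections (4 * real N / r) e"
    unfolding bounded_projections_def
  proof (intro allI impI)
    fix m n :: nat and a assume mn: "m \<le> n"
    have "(\<lambda>i. (if i < n then a i else 0) *\<^sub>R e i) sums (\<Sum>i<n. (if i < n then a i else 0) *\<^sub>R e i)"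
      by (intro sums_finite) auto
    from c_eq[OF this] have "c (\<Sum>i<n. a i *\<^sub>R e i) = (\<lambda>i. if i < n then a i else 0)" by simp
    then have "P m (\<Sum>i<n. a i *\<^sub>R e i) = (\<Sum>i<m. a i *\<^sub>R e i)"
      using mn unfolding P_def by (intro sum.cong) auto
    then show "norm (\<Sum>i<m. a i *\<^sub>R e i) \<le> 4 * real N / r * norm (\<Sum>i<n. a i *\<^sub>R e i)"
      using PK[of m "\<Sum>i<n. a i *\<^sub>R e i"] by simp
  qed
  then show thesis using that e0 by blast
qed

subsection \<open>Existence of spreading models\<close>

lemma sorted_list_of_strict_mono_image:
  fixes k :: "nat \<Rightarrow> nat"
  assumes "strict_mono_on {..<n} k"
  shows "sorted_list_of_set (k ` {..<n}) = map k [0..<n]"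
proof -
  have "sorted_wrt (<) (map k [0..<n])"
    using assms by (auto simp: sorted_wrt_iff_nth_less strict_mono_on_def)
  then have "sorted (map k [0..<n])" "distinct (map k [0..<n])"
    by (simp_all add: strict_sorted_iff)
  then have "sorted_list_of_set (set (map k [0..<n])) = map k [0..<n]"
    by (rule sorted_list_of_set.idem_if_sorted_distinct)
  then show ?thesis by (simp add: atLeast0LessThan)
qed

definition stable_norms :: "(nat \<Rightarrow> 'a::real_normed_vector) \<Rightarrow> nat \<Rightarrow> (nat \<Rightarrow> real) \<Rightarrow> real \<Rightarrow> nat set \<Rightarrow> bool" where
  "stable_norms y n a \<eta> M \<longleftrightarrow> (\<forall>k k'. strict_mono_on {..<n} k \<longrightarrow> strict_mono_on {..<n} k' \<longrightarrow>
     k ` {..<n} \<subseteq> M \<longrightarrow> k' ` {..<n} \<subseteq> M \<longrightarrow>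
     \<bar>norm (\<Sum>i<n. a i *\<^sub>R y (k i)) - norm (\<Sum>i<n. a i *\<^sub>R y (k' i))\<bar> \<le> \<eta>)"

lemma stable_norms_subset: "stable_norms y n a \<eta> M \<Longrightarrow> M' \<subseteq> M \<Longrightarrow> stable_norms y n a \<eta> M'"
  unfolding stable_norms_def by (meson order_trans)

text \<open>Ramsey's theorem for \<open>n\<close>-subsets, coloured by the norm of the combination
  along their increasing enumeration, rounded down to a multiple of \<eta>.\<close>

lemma stabilize_coeffs:
  fixes y :: "nat \<Rightarrow> 'a::real_normed_vector" and a :: "nat \<Rightarrow> real"
  assumes y: "normalized y" and a: "\<And>i. i < n \<Longrightarrow> \<bar>a i\<bar> \<le> 1" and \<eta>: "0 < \<eta>" and M: "infinite M"
  obtains M' where "M' \<subseteq> M" "infinite M'" "stable_norms y n a \<eta> M'"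
proof -
  define g where "g = (\<lambda>X. norm (\<Sum>i<n. a i *\<^sub>R y (sorted_list_of_set X ! i)))"
  have gle: "g X \<le> real n" for X
  proof -
    have "g X \<le> (\<Sum>i<n. norm (a i *\<^sub>R y (sorted_list_of_set X ! i)))"
      unfolding g_def by (rule norm_sum)
    also have "\<dots> \<le> (\<Sum>i<n. 1)"
      using a y by (intro sum_mono) (auto simp: normalized_def)
    finally show ?thesis by simp
  qed
  have g0: "0 \<le> g X" for X by (simp add: g_def)
  define h where "h = (\<lambda>X. nat \<lfloor>g X / \<eta>\<rfloor>)"
  have "h X < Suc (nat \<lfloor>real n / \<eta>\<rfloor>)" for X
    using gle[of X] \<eta> unfolding h_def less_Suc_eq_le by (intro nat_mono floor_mono divide_right_mono) auto
  then obtain M' t where M': "M' \<subseteq> M" "infinite M'"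
    and t: "\<And>X. X \<subseteq> M' \<Longrightarrow> finite X \<Longrightarrow> card X = n \<Longrightarrow> h X = t"
    using Ramsey[OF M, of n h "Suc (nat \<lfloor>real n / \<eta>\<rfloor>)"] by auto
  show thesis
  proof (rule that[OF M'], unfold stable_norms_def, intro allI impI)
    fix k k' :: "nat \<Rightarrow> nat"
    assume k: "strict_mono_on {..<n} k" "strict_mono_on {..<n} k'" "k ` {..<n} \<subseteq> M'" "k' ` {..<n} \<subseteq> M'"
    have gk: "g (l ` {..<n}) = norm (\<Sum>i<n. a i *\<^sub>R y (l i))" if "strict_mono_on {..<n} l" for l
      unfolding g_def sorted_list_of_strict_mono_image[OF that] by (intro arg_cong[of _ _ norm] sum.cong) auto
    have ck: "card (l ` {..<n}) = n" if "strict_mono_on {..<n} l" for l :: "nat \<Rightarrow> nat"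
      using card_image[OF strict_mono_on_imp_inj_on[OF that]] by simp
    have "h (k ` {..<n}) = h (k' ` {..<n})"
      using t[of "k ` {..<n}"] t[of "k' ` {..<n}"] k ck by simp
    then have "\<lfloor>g (k ` {..<n}) / \<eta>\<rfloor> = \<lfloor>g (k' ` {..<n}) / \<eta>\<rfloor>"
      unfolding h_def using g0 \<eta> by (simp add: eq_nat_nat_iff)
    then have "\<bar>g (k ` {..<n}) / \<eta> - g (k' ` {..<n}) / \<eta>\<bar> < 1" by linarith
    then have "\<bar>g (k ` {..<n}) - g (k' ` {..<n})\<bar> < \<eta>"
      using \<eta> by (simp flip: diff_divide_distrib add: abs_divide)
    then show "\<bar>norm (\<Sum>i<n. a i *\<^sub>R y (k i)) - norm (\<Sum>i<n. a i *\<^sub>R y (k' i))\<bar> \<le> \<eta>"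
      using gk k by simp
  qed
qed

lemma norm_sum_diff_coeffs:
  fixes y :: "nat \<Rightarrow> 'a::real_normed_vector" and a b :: "nat \<Rightarrow> real"
  assumes "\<And>i. i < n \<Longrightarrow> norm (y i) \<le> 1" "\<And>i. i < n \<Longrightarrow> \<bar>a i - b i\<bar> \<le> \<delta>"
  shows "\<bar>norm (\<Sum>i<n. a i *\<^sub>R y i) - norm (\<Sum>i<n. b i *\<^sub>R y i)\<bar> \<le> real n * \<delta>"
proof -
  have "\<bar>norm (\<Sum>i<n. a i *\<^sub>R y i) - norm (\<Sum>i<n. b i *\<^sub>R y i)\<bar> \<le>
      norm ((\<Sum>i<n. a i *\<^sub>R y i) - (\<Sum>i<n. b i *\<^sub>R y i))"
    by (rule norm_triangle_ineq3)
  also have "\<dots> = norm (\<Sum>i<n. (a i - b i) *\<^sub>R y i)" by (simp add: sum_subtractf scaleR_diff_left)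
  also have "\<dots> \<le> (\<Sum>i<n. norm ((a i - b i) *\<^sub>R y i))" by (rule norm_sum)
  also have "\<dots> \<le> (\<Sum>i<n. \<delta>)"
  proof (rule sum_mono)
    fix i assume "i \<in> {..<n}"
    then show "norm ((a i - b i) *\<^sub>R y i) \<le> \<delta>"
      using assms mult_mono[of "\<bar>a i - b i\<bar>" \<delta> "norm (y i)" 1] by fastforce
  qed
  finally show ?thesis by simp
qed

lemma stabilize:
  fixes y :: "nat \<Rightarrow> 'a::real_normed_vector"
  assumes y: "normalized y" and \<eta>: "0 < \<eta>" and M: "infinite M"
  obtains M' where "M' \<subseteq> M" "infinite M'" "\<And>a. (\<And>i. i < n \<Longrightarrow> \<bar>a i\<bar> \<le> 1) \<Longrightarrow> stable_norms y n a \<eta> M'"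
proof -
  \<comment> \<open>Rounding coefficients to a grid of mesh \<open>1 / q\<close> changes a norm by
    at most \<open>n / q\<close>, below \<open>\<eta> / 3\<close>. Two roundings and the tolerance
    \<open>\<eta> / 3\<close> on the finite grid add up to \<eta>.\<close>
  obtain q :: nat where q: "3 * real n / \<eta> < real q" "0 < q"
    by (metis reals_Archimedean2 gr0I of_nat_0_less_iff le_less_trans order_less_le_trans
        divide_nonneg_pos \<eta> mult_nonneg_nonneg of_nat_0_le_iff zero_le_numeral of_nat_0 less_irrefl not_less)
  define G where "G = (\<lambda>j. real_of_int j / real q) ` {- int q..int q}"
  define C where "C = PiE {..<n} (\<lambda>_. G)"
  have "finite C" unfolding C_def G_def by (intro finite_PiE) auto
  then have "\<exists>M'\<subseteq>M. infinite M' \<and> (\<forall>a\<in>C. stable_norms y n a (\<eta> / 3) M')"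
  proof -
    have C1: "\<bar>a i\<bar> \<le> 1" if "a \<in> C" "i < n" for a i
      using PiE_mem[OF that(1)[unfolded C_def], of i] that(2) q(2) by (auto simp: G_def abs_divide)
    have "D \<subseteq> C \<Longrightarrow> \<exists>M'\<subseteq>M. infinite M' \<and> (\<forall>a\<in>D. stable_norms y n a (\<eta> / 3) M')" if "finite D" for D
      using that
    proof (induction D rule: finite_induct)
      case empty then show ?case using M by blast
    next
      case (insert a D)
      then obtain M1 where M1: "M1 \<subseteq> M" "infinite M1" "\<forall>a\<in>D. stable_norms y n a (\<eta> / 3) M1" by auto
      have a1: "\<And>i. i < n \<Longrightarrow> \<bar>a i\<bar> \<le> 1" using C1 insert.prems by simp
      have e3: "0 < \<eta> / 3" using \<eta> by simp
      obtain M2 where M2: "M2 \<subseteq> M1" "infinite M2" "stable_norms y n a (\<eta> / 3) M2"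
        by (rule stabilize_coeffs[OF y a1 e3 M1(2)])
      then show ?case using M1 stable_norms_subset by (intro exI[of _ M2]) blast
    qed
    then show ?thesis using \<open>finite C\<close> by blast
  qed
  then obtain M' where M': "M' \<subseteq> M" "infinite M'" and P: "\<And>a. a \<in> C \<Longrightarrow> stable_norms y n a (\<eta> / 3) M'" by blast
  show thesis
  proof (rule that[OF M'], unfold stable_norms_def, intro allI impI)
    fix a :: "nat \<Rightarrow> real" and k k' :: "nat \<Rightarrow> nat"
    assume a: "\<And>i. i < n \<Longrightarrow> \<bar>a i\<bar> \<le> 1"
      and k: "strict_mono_on {..<n} k" "strict_mono_on {..<n} k'" "k ` {..<n} \<subseteq> M'" "k' ` {..<n} \<subseteq> M'"
    define b where "b = (\<lambda>i\<in>{..<n}. real_of_int \<lfloor>a i * real q\<rfloor> / real q)"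
    have bG: "b i \<in> G" "\<bar>a i - b i\<bar> \<le> 1 / real q" if i: "i < n" for i
    proof -
      have "\<bar>a i * real q\<bar> \<le> real q" using a[OF i] q(2) by (simp add: abs_mult mult_left_le_one_le)
      then have "\<lfloor>a i * real q\<rfloor> \<in> {- int q..int q}" by (auto simp: le_floor_iff floor_le_iff)
      then show "b i \<in> G" using i by (auto simp: b_def G_def)
      have "a i - b i = (a i * real q - real_of_int \<lfloor>a i * real q\<rfloor>) / real q"
        using q(2) i by (simp add: b_def diff_divide_distrib)
      moreover have "\<bar>a i * real q - real_of_int \<lfloor>a i * real q\<rfloor>\<bar> \<le> 1" by linarith
      ultimately show "\<bar>a i - b i\<bar> \<le> 1 / real q" using q(2) by (simp add: abs_divide divide_right_mono)
    qed
    have "b \<in> C"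
      unfolding C_def
    proof (rule PiE_I)
      show "b i \<in> G" if "i \<in> {..<n}" for i using bG(1) that by simp
      show "b i = undefined" if "i \<notin> {..<n}" for i using that by (simp add: b_def)
    qed
    then have 1: "\<bar>norm (\<Sum>i<n. b i *\<^sub>R y (k i)) - norm (\<Sum>i<n. b i *\<^sub>R y (k' i))\<bar> \<le> \<eta> / 3"
      using P k unfolding stable_norms_def by blast
    have 2: "\<bar>norm (\<Sum>i<n. a i *\<^sub>R y (l i)) - norm (\<Sum>i<n. b i *\<^sub>R y (l i))\<bar> \<le> real n * (1 / real q)" for l
      using y bG by (intro norm_sum_diff_coeffs) (auto simp: normalized_def)
    have "real n * (1 / real q) \<le> \<eta> / 3" using q \<eta> by (simp add: field_simps)
    then show "\<bar>norm (\<Sum>i<n. a i *\<^sub>R y (k i)) - norm (\<Sum>i<n. a i *\<^sub>R y (k' i))\<bar> \<le> \<eta>"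
      using 1 2[of k] 2[of k'] by linarith
  qed
qed

text \<open>Brunel and Sucheston's diagonal argument. Stage \<open>n\<close> stabilizes combinations
  of \<open>Suc n\<close> vectors, which matches the condition \<open>n \<le> Suc (k 0)\<close> for
  indices starting at 0.\<close>

lemma asymptotically_spreading_subseq:
  fixes y :: "nat \<Rightarrow> 'a::real_normed_vector"
  assumes y: "normalized y"
  obtains \<phi> where "strict_mono \<phi>"
    "\<And>n (a :: nat \<Rightarrow> real) k k'. (\<And>i. i < n \<Longrightarrow> \<bar>a i\<bar> \<le> 1) \<Longrightarrow> strict_mono_on {..<n} k \<Longrightarrow> strict_mono_on {..<n} k' \<Longrightarrow>
      n \<le> Suc (k 0) \<Longrightarrow> n \<le> Suc (k' 0) \<Longrightarrow>
      \<bar>norm (\<Sum>i<n. a i *\<^sub>R y (\<phi> (k i))) - norm (\<Sum>i<n. a i *\<^sub>R y (\<phi> (k' i)))\<bar> \<le> 1 / real n"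
proof -
  define S where "S = (\<lambda>n M. \<forall>a. (\<forall>i<n. \<bar>a i\<bar> \<le> 1) \<longrightarrow> stable_norms y n a (1 / real n) M)"
  define P where "P = (\<lambda>n (m, M). infinite M \<and> m \<in> M \<and> S (Suc n) M)"
  have ext: "\<exists>m M'. l < m \<and> M' \<subseteq> M \<and> P n (m, M')" if M: "infinite M" for M l n
  proof -
    have "0 < 1 / real (Suc n)" by simp
    from stabilize[OF y this M, of "Suc n"] obtain M' where M': "M' \<subseteq> M" "infinite M'" and S: "S (Suc n) M'"
      unfolding S_def by metis
    obtain m where "m \<in> M'" "l < m" using M'(2) by (meson infinite_nat_iff_unbounded)
    then show ?thesis using M' S by (intro exI[of _ m] exI[of _ M']) (simp add: P_def)
  qed
  have "\<exists>f. \<forall>n. P n (f n) \<and> (fst (f n) < fst (f (Suc n)) \<and> snd (f (Suc n)) \<subseteq> snd (f n))"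
  proof (rule dependent_nat_choice)
    show "\<exists>x. P 0 x" using ext[OF infinite_UNIV_nat, of 0 0] by blast
    fix x n assume x: "P n x"
    then have "infinite (snd x)" by (auto simp: P_def)
    from ext[OF this, of "fst x" "Suc n"] obtain m M' where
      "fst x < m" "M' \<subseteq> snd x" "P (Suc n) (m, M')" by blast
    then show "\<exists>y. P (Suc n) y \<and> fst x < fst y \<and> snd y \<subseteq> snd x" by (intro exI[of _ "(m, M')"]) simp
  qed
  then obtain f where f: "\<And>n. P n (f n)" "\<And>n. fst (f n) < fst (f (Suc n))" "\<And>n. snd (f (Suc n)) \<subseteq> snd (f n)"
    by blast
  define \<phi> where "\<phi> = (\<lambda>n. fst (f n))"
  have sm: "strict_mono \<phi>" using f(2) by (simp add: \<phi>_def strict_mono_Suc_iff)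
  have "antimono (\<lambda>n. snd (f n))" using f(3) by (simp add: antimono_iff_le_Suc)
  then have dec: "snd (f j) \<subseteq> snd (f i)" if "i \<le> j" for i j using that by (rule antimonoD)
  have mem: "\<phi> n \<in> snd (f n)" for n using f(1)[of n] by (auto simp: P_def \<phi>_def split: prod.splits)
  have Sn: "S (Suc n) (snd (f n))" for n using f(1)[of n] by (auto simp: P_def split: prod.splits)
  show thesis
  proof (rule that[OF sm])
    fix n and a :: "nat \<Rightarrow> real" and k k' :: "nat \<Rightarrow> nat"
    assume a: "\<And>i. i < n \<Longrightarrow> \<bar>a i\<bar> \<le> 1"
      and k: "strict_mono_on {..<n} k" "strict_mono_on {..<n} k'" "n \<le> Suc (k 0)" "n \<le> Suc (k' 0)"
    show "\<bar>norm (\<Sum>i<n. a i *\<^sub>R y (\<phi> (k i))) - norm (\<Sum>i<n. a i *\<^sub>R y (\<phi> (k' i)))\<bar> \<le> 1 / real n"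
    \<comment> \<open>For \<open>n = 0\<close> both sums are empty and \<open>1 / real 0\<close> is
      0.\<close>
    proof (cases n)
      case (Suc m)
      have im: "(\<lambda>i. \<phi> (l i)) ` {..<n} \<subseteq> snd (f m)" if l: "strict_mono_on {..<n} l" "n \<le> Suc (l 0)" for l
      proof
        fix x assume "x \<in> (\<lambda>i. \<phi> (l i)) ` {..<n}"
        then obtain i where i: "x = \<phi> (l i)" "i < n" by blast
        have "l 0 \<le> l i" using l(1) i(2) unfolding strict_mono_on_def by (cases i) (auto simp: le_less)
        then have "m \<le> l i" using l(2) Suc by simp
        then show "x \<in> snd (f m)" using mem[of "l i"] dec i(1) by blast
      qed
      have sm': "strict_mono_on {..<n} (\<lambda>i. \<phi> (l i))" if "strict_mono_on {..<n} l" for l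
        using that sm unfolding strict_mono_on_def by (auto simp: strict_mono_less)
      show ?thesis
        using Sn[of m, folded Suc] a sm'[OF k(1)] sm'[OF k(2)] im[OF k(1,3)] im[OF k(2,4)]
        unfolding S_def stable_norms_def by blast
    qed simp
  qed
qed

lemma apply_bcontfun_lincomb:
  fixes s :: "nat \<Rightarrow> linf"
  shows "apply_bcontfun (\<Sum>i<n. b i *\<^sub>R s i) j = (\<Sum>i<n. b i * apply_bcontfun (s i) j)"
  by (induction n) simp_all

text \<open>The limit norm \<open>L\<close> is realized directly in \<open>linf\<close>. Coordinate
  \<open>j\<close> belongs to the \<open>j\<close>-th list of rationals and records limits of the
  values of functionals norming that combination of \<open>x m, x (m + 1), ...\<close> as
  \<open>m\<close> grows. Every coordinate is dominated by \<open>L\<close>, with equality on its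
  own list, and density of the rationals turns the supremum into \<open>L\<close>.\<close>

lemma spreading_model_subseq:
  fixes e y :: "nat \<Rightarrow> 'a::banach"
  assumes K: "bounded_projections K e" and blk: "block_basis e y" and ny: "normalized y"
  obtains \<phi> and s :: "nat \<Rightarrow> linf" where "strict_mono \<phi>" "spreading_model (y \<circ> \<phi>) s"
proof -
  obtain \<phi> where sm: "strict_mono \<phi>" and
    osc: "\<And>n (a :: nat \<Rightarrow> real) k k'. (\<And>i. i < n \<Longrightarrow> \<bar>a i\<bar> \<le> 1) \<Longrightarrow> strict_mono_on {..<n} k \<Longrightarrow> strict_mono_on {..<n} k' \<Longrightarrow>
      n \<le> Suc (k 0) \<Longrightarrow> n \<le> Suc (k' 0) \<Longrightarrow>
      \<bar>norm (\<Sum>i<n. a i *\<^sub>R y (\<phi> (k i))) - norm (\<Sum>i<n. a i *\<^sub>R y (\<phi> (k' i)))\<bar> \<le> 1 / real n"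
    using asymptotically_spreading_subseq[OF ny] by blast
  define x where "x = y \<circ> \<phi>"
  have xy: "y (\<phi> i) = x i" for i by (simp add: x_def)
  note osc = osc[unfolded xy]
  have bx: "block_basis e x" unfolding x_def by (rule block_basis_subseq[OF blk sm])
  have x1: "norm (x i) = 1" for i using ny by (simp add: x_def normalized_def)
  have Kx: "bounded_projections K x" by (rule bounded_projections_block[OF K bx])
  have x0: "x i \<noteq> 0" for i by (rule block_basis_nonzero[OF bx])
  have K1: "1 \<le> K" by (rule bounded_projections_nonneg[OF Kx x0])
  define T where "T = (\<lambda>n (a :: nat \<Rightarrow> real) m. norm (\<Sum>i<n. a i *\<^sub>R x (m + i)))"
  have smk: "strict_mono_on A ((+) m)" for m :: nat and A by (simp add: strict_mono_on_def)
  have pad: "(\<Sum>i<n. a i *\<^sub>R x (k i)) = (\<Sum>i<N. (if i < n then a i else 0) *\<^sub>R x (k i))"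
    if "n \<le> N" for n N :: nat and a k
  proof -
    have "(\<Sum>i<n. a i *\<^sub>R x (k i)) = (\<Sum>i<n. (if i < n then a i else 0) *\<^sub>R x (k i))" by simp
    also have "\<dots> = (\<Sum>i<N. (if i < n then a i else 0) *\<^sub>R x (k i))"
      by (rule sum.mono_neutral_left) (use that in auto)
    finally show ?thesis .
  qed
  have conv1: "convergent (T n a)" if a: "\<And>i. i < n \<Longrightarrow> \<bar>a i\<bar> \<le> 1" for n a
  proof -
    have "Cauchy (T n a)"
    proof (rule metric_CauchyI)
      fix \<epsilon> :: real assume \<epsilon>: "0 < \<epsilon>"
      obtain N0 :: nat where N0: "1 / \<epsilon> < real N0" using reals_Archimedean2 by blast
      define N where "N = max n (max 1 N0)"
      have N: "n \<le> N" "1 / real N < \<epsilon>"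
      proof -
        have "1 / \<epsilon> < real N" using N0 by (simp add: N_def)
        moreover have "0 < real N" by (simp add: N_def)
        ultimately show "1 / real N < \<epsilon>" using \<epsilon> by (simp add: field_simps)
      qed (simp add: N_def)
      have "dist (T n a m) (T n a m') < \<epsilon>" if "N \<le> m" "N \<le> m'" for m m'
      proof -
        have "\<bar>T n a m - T n a m'\<bar> \<le> 1 / real N"
          unfolding T_def pad[OF N(1), of a]
          by (rule osc[of N "\<lambda>i. if i < n then a i else 0" "(+) m" "(+) m'", OF _ smk smk])
            (use a that in auto)
        then show ?thesis using N(2) by (simp add: dist_real_def)
      qed
      then show "\<exists>M. \<forall>m\<ge>M. \<forall>n'\<ge>M. dist (T n a m) (T n a n') < \<epsilon>" by blast
    qed
    then show ?thesis by (rule real_Cauchy_convergent)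
  qed
  \<comment> \<open>Arbitrary coefficients are scaled into the unit cube, where the oscillation
    estimate is available.\<close>
  have conv: "convergent (T n a)" for n a
  proof -
    define c where "c = 1 + (\<Sum>i<n. \<bar>a i\<bar>)"
    have c: "0 < c" unfolding c_def by (intro add_pos_nonneg sum_nonneg) auto
    have "\<bar>a i / c\<bar> \<le> 1" if "i < n" for i
    proof -
      have "\<bar>a i\<bar> \<le> (\<Sum>i<n. \<bar>a i\<bar>)" by (rule member_le_sum) (use that in auto)
      then show ?thesis using c by (simp add: abs_divide c_def)
    qed
    then have "convergent (T n (\<lambda>i. a i / c))" by (rule conv1)
    then have "convergent (\<lambda>m. c * T n (\<lambda>i. a i / c) m)" using c by (simp add: convergent_mult_const_iff)
    moreover have "c * T n (\<lambda>i. a i / c) m = T n a m" for m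
    proof -
      have "c * T n (\<lambda>i. a i / c) m = norm (c *\<^sub>R (\<Sum>i<n. (a i / c) *\<^sub>R x (m + i)))"
        using c by (simp add: T_def)
      also have "\<dots> = T n a m" using c by (simp add: T_def scaleR_sum_right)
      finally show ?thesis .
    qed
    ultimately show ?thesis by simp
  qed
  define L where "L = (\<lambda>n a. lim (T n a))"
  have L: "T n a \<longlonglongrightarrow> L n a" for n a
    using conv unfolding L_def by (simp add: convergent_LIMSEQ_iff)
  have approx: "\<bar>norm (\<Sum>i<n. a i *\<^sub>R x (k i)) - L n a\<bar> \<le> 1 / real n"
    if "\<And>i. i < n \<Longrightarrow> \<bar>a i\<bar> \<le> 1" "strict_mono_on {..<n} k" "n \<le> Suc (k 0)" for n a k
  proof (rule tendsto_upperbound)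
    show "(\<lambda>m. \<bar>norm (\<Sum>i<n. a i *\<^sub>R x (k i)) - T n a m\<bar>) \<longlonglongrightarrow> \<bar>norm (\<Sum>i<n. a i *\<^sub>R x (k i)) - L n a\<bar>"
      by (intro tendsto_intros L)
    show "\<forall>\<^sub>F m in sequentially. \<bar>norm (\<Sum>i<n. a i *\<^sub>R x (k i)) - T n a m\<bar> \<le> 1 / real n"
      using eventually_ge_at_top[of n]
      by eventually_elim (unfold T_def, rule osc[OF that(1,2) smk that(3)], auto)
  qed simp
  define len where "len = (\<lambda>j. length (from_nat j :: rat list))"
  define A where "A = (\<lambda>j i. real_of_rat ((from_nat j :: rat list) ! i))"
  have "\<exists>f. linear f \<and> (\<forall>v. \<bar>f v\<bar> \<le> norm v) \<and>
      f (\<Sum>i<len j. A j i *\<^sub>R x (m + i)) = norm (\<Sum>i<len j. A j i *\<^sub>R x (m + i))" for j m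
    using norming_functional[of "\<Sum>i<len j. A j i *\<^sub>R x (m + i)"] by metis
  then obtain f where f: "\<And>j m. linear (f j m)" "\<And>j m v. \<bar>f j m v\<bar> \<le> norm v"
      "\<And>j m. f j m (\<Sum>i<len j. A j i *\<^sub>R x (m + i)) = norm (\<Sum>i<len j. A j i *\<^sub>R x (m + i))"
    by metis
  \<comment> \<open>A subsequence of the starting points \<open>t\<close>; the vector tested for
    coordinate \<open>i\<close> moves along with the start.\<close>
  have "\<exists>r l. strict_mono r \<and> (\<forall>i. (\<lambda>t. f j (r t) (x (r t + i))) \<longlonglongrightarrow> l i)" for j
  proof -
    have f1: "norm (f j t (x (t + i))) \<le> 1" for t i using f(2)[of j t "x (t + i)"] x1 by simp
    obtain r where r: "strict_mono (r :: nat \<Rightarrow> nat)" "\<And>i. i \<in> UNIV \<Longrightarrow> \<exists>l. (\<lambda>t. f j (r t) (x (r t + i))) \<longlonglongrightarrow> l"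
      using function_convergent_subsequence[of "UNIV :: nat set" "\<lambda>t i. f j t (x (t + i))" 1] f1 by auto
    then have "\<forall>i. \<exists>l. (\<lambda>t. f j (r t) (x (r t + i))) \<longlonglongrightarrow> l" by simp
    then have "\<exists>l. \<forall>i. (\<lambda>t. f j (r t) (x (r t + i))) \<longlonglongrightarrow> l i" by (rule choice)
    with r(1) show ?thesis by blast
  qed
  then obtain r G where r: "\<And>j. strict_mono (r j)"
    and G: "\<And>j i. (\<lambda>t. f j (r j t) (x (r j t + i))) \<longlonglongrightarrow> G j i" by metis
  have G1: "\<bar>G j i\<bar> \<le> 1" for j i
  proof (rule tendsto_upperbound)
    show "(\<lambda>t. \<bar>f j (r j t) (x (r j t + i))\<bar>) \<longlonglongrightarrow> \<bar>G j i\<bar>" by (intro tendsto_intros G)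
    show "\<forall>\<^sub>F t in sequentially. \<bar>f j (r j t) (x (r j t + i))\<bar> \<le> 1"
      using f(2)[of j _ "x _"] x1 by (intro always_eventually) (metis (no_types))
  qed simp
  have fsum: "f j m (\<Sum>i<n. b i *\<^sub>R x (m + i)) = (\<Sum>i<n. b i * f j m (x (m + i)))" for j m n b
    by (simp add: linear_sum[OF f(1)] linear_scale[OF f(1)])
  have Glim: "(\<lambda>t. f j (r j t) (\<Sum>i<n. b i *\<^sub>R x (r j t + i))) \<longlonglongrightarrow> (\<Sum>i<n. b i * G j i)" for j n b
    unfolding fsum by (intro tendsto_intros G)
  have Lr: "(\<lambda>t. T n b (r j t)) \<longlonglongrightarrow> L n b" for j n b
    using LIMSEQ_subseq_LIMSEQ[OF L r] by (simp add: comp_def)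
  have Gle: "\<bar>\<Sum>i<n. b i * G j i\<bar> \<le> L n b" for j n b
  proof (rule LIMSEQ_le[OF tendsto_rabs[OF Glim] Lr])
    show "\<exists>N. \<forall>t\<ge>N. \<bar>f j (r j t) (\<Sum>i<n. b i *\<^sub>R x (r j t + i))\<bar> \<le> T n b (r j t)"
      unfolding T_def using f(2) by blast
  qed
  have Geq: "(\<Sum>i<len j. A j i * G j i) = L (len j) (A j)" for j
    using Glim[of j "A j" "len j"] Lr[where j = j and n = "len j" and b = "A j"]
    unfolding f(3) T_def by (rule LIMSEQ_unique)
  define s :: "nat \<Rightarrow> linf" where "s = (\<lambda>i. Bcontfun (\<lambda>j. G j i))"
  have s: "apply_bcontfun (s i) j = G j i" for i j
    unfolding s_def by (subst Bcontfun_inverse) (auto intro!: bcontfun_normI[where b = 1] simp: G1)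
  have norm_le: "norm (\<Sum>i<n. b i *\<^sub>R s i) \<le> L n b" for n b
    by (rule norm_bound) (simp add: apply_bcontfun_lincomb s Gle)
  have norm_ge: "L n b \<le> norm (\<Sum>i<n. b i *\<^sub>R s i)" for n b
  proof (rule field_le_epsilon)
    fix \<epsilon> :: real assume \<epsilon>: "0 < \<epsilon>"
    \<comment> \<open>Two rounding errors of size \<open>n * \<delta>\<close> occur, one in
      \<open>L\<close> and one in the coordinate \<open>j\<close>.\<close>
    define \<delta> where "\<delta> = \<epsilon> / (2 * real n + 1)"
    have \<delta>: "0 < \<delta>" using \<epsilon> by (simp add: \<delta>_def)
    have "\<exists>q. \<bar>b i - real_of_rat q\<bar> < \<delta>" for i
    proof -
      obtain q where "b i < real_of_rat q" "real_of_rat q < b i + \<delta>"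
        using of_rat_dense[of "b i" "b i + \<delta>"] \<delta> by auto
      then show ?thesis by (intro exI[of _ q]) auto
    qed
    then obtain q where q: "\<And>i. \<bar>b i - real_of_rat (q i)\<bar> < \<delta>" by metis
    define j where "j = to_nat (map q [0..<n])"
    have j: "len j = n" "\<And>i. i < n \<Longrightarrow> A j i = real_of_rat (q i)" by (simp_all add: j_def len_def A_def)
    have d: "\<bar>b i - A j i\<bar> \<le> \<delta>" if "i < n" for i using q[of i] j(2)[OF that] by simp
    have "\<bar>L n b - L n (A j)\<bar> \<le> real n * \<delta>"
    proof (rule tendsto_upperbound)
      show "(\<lambda>m. \<bar>T n b m - T n (A j) m\<bar>) \<longlonglongrightarrow> \<bar>L n b - L n (A j)\<bar>" by (intro tendsto_intros L)
      show "\<forall>\<^sub>F m in sequentially. \<bar>T n b m - T n (A j) m\<bar> \<le> real n * \<delta>"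
        unfolding T_def by (intro always_eventually allI norm_sum_diff_coeffs) (use d x1 in auto)
    qed simp
    moreover have "\<bar>(\<Sum>i<n. b i * G j i) - (\<Sum>i<n. A j i * G j i)\<bar> \<le> real n * \<delta>"
    proof -
      have "(\<Sum>i<n. b i * G j i) - (\<Sum>i<n. A j i * G j i) = (\<Sum>i<n. (b i - A j i) * G j i)"
        by (simp add: sum_subtractf left_diff_distrib)
      also have "\<bar>\<dots>\<bar> \<le> (\<Sum>i<n. \<bar>(b i - A j i) * G j i\<bar>)" by (rule sum_abs)
      also have "\<dots> \<le> (\<Sum>i<n. \<delta>)"
      proof (rule sum_mono)
        fix i assume "i \<in> {..<n}"
        then show "\<bar>(b i - A j i) * G j i\<bar> \<le> \<delta>"
          using mult_mono[of "\<bar>b i - A j i\<bar>" \<delta> "\<bar>G j i\<bar>" 1] d[of i] G1[of j i] \<delta> by (simp add: abs_mult)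
      qed
      finally show ?thesis by simp
    qed
    moreover have "\<bar>\<Sum>i<n. b i * G j i\<bar> \<le> norm (\<Sum>i<n. b i *\<^sub>R s i)"
      using norm_bounded[of "\<Sum>i<n. b i *\<^sub>R s i" j] by (simp add: apply_bcontfun_lincomb s)
    moreover have "(\<Sum>i<n. A j i * G j i) = L n (A j)" using Geq[of j] j(1) by simp
    moreover have "2 * (real n * \<delta>) \<le> \<epsilon>" using \<epsilon> by (simp add: \<delta>_def field_simps)
    ultimately show "L n b \<le> norm (\<Sum>i<n. b i *\<^sub>R s i) + \<epsilon>" by linarith
  qed
  have norm_s: "norm (\<Sum>i<n. b i *\<^sub>R s i) = L n b" for n b using norm_le norm_ge antisym by blast
  have Ks: "bounded_projections K s"
    unfolding bounded_projections_def
  proof (intro allI impI)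
    fix m n :: nat and a assume mn: "m \<le> n"
    show "norm (\<Sum>i<m. a i *\<^sub>R s i) \<le> K * norm (\<Sum>i<n. a i *\<^sub>R s i)"
      unfolding norm_s
    proof (rule LIMSEQ_le[OF L tendsto_mult_left[OF L]])
      have "T m a t \<le> K * T n a t" for t
      proof -
        have "block_basis x (x \<circ> (+) t)"
          by (rule block_basisI[where p = "(+) t"]) (auto simp: x0 intro!: span_base)
        from bounded_projectionsD[OF bounded_projections_block[OF Kx this] mn, of a]
        show ?thesis by (simp add: T_def)
      qed
      then show "\<exists>N. \<forall>t\<ge>N. T m a t \<le> K * T n a t" by blast
    qed
  qed
  have s0: "s j \<noteq> 0" for j
  proof -
    define a where "a = (\<lambda>i. if i = j then 1 else 0 :: real)"
    have 1: "(\<Sum>i<Suc j. a i *\<^sub>R x (m + i)) = x (m + j)" for m by (simp add: a_def)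
    have 2: "(\<Sum>i<Suc j. a i *\<^sub>R s i) = s j" by (simp add: a_def)
    have "T (Suc j) a = (\<lambda>_. 1)" unfolding T_def 1 x1 ..
    then have "L (Suc j) a = 1" using L[of "Suc j" a] LIMSEQ_unique[OF _ tendsto_const] by metis
    then have "norm (s j) = 1" using norm_s[of a "Suc j"] unfolding 2 by simp
    then show ?thesis by auto
  qed
  have "basic_sequence s" by (rule basic_sequenceI[OF s0 Ks])
  moreover have "basic_sequence x" by (rule basic_sequenceI[OF x0 Kx])
  moreover have "normalized x" using x1 by (simp add: normalized_def)
  \<comment> \<open>\<open>3 / (n + 1)\<close> strictly exceeds \<open>1 / n\<close> for positive
    \<open>n\<close> and is positive at 0, as the strict inequality in
    \<open>spreading_model\<close> requires.\<close>
  moreover have "decseq (\<lambda>n. 3 / (real n + 1))"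
    by (intro decseq_SucI) (simp add: field_simps)
  moreover have "(\<lambda>n. 3 / (real n + 1)) \<longlonglongrightarrow> 0"
    using LIMSEQ_Suc[OF tendsto_divide_0[OF tendsto_const filterlim_at_top_imp_at_infinity[OF filterlim_real_sequentially], of 3]]
    by (simp add: add.commute)
  moreover have "\<bar>norm (\<Sum>i<n. a i *\<^sub>R x (k i)) - norm (\<Sum>i<n. a i *\<^sub>R s i)\<bar> < 3 / (real n + 1)"
    if "\<forall>i<n. a i \<in> {-1..1}" "strict_mono_on {..<n} k" "n \<le> Suc (k 0)" for n a k
  proof -
    have "\<bar>norm (\<Sum>i<n. a i *\<^sub>R x (k i)) - L n a\<bar> \<le> 1 / real n"
      by (rule approx) (use that in \<open>auto simp: abs_le_iff\<close>)
    also have "\<dots> < 3 / (real n + 1)" by (cases "n = 0") (simp_all add: field_simps)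
    finally show ?thesis by (simp add: norm_s)
  qed
  ultimately have "spreading_model x s" unfolding spreading_model_def by blast
  then show thesis using that sm by (simp add: x_def)
qed

section \<open>Spreading models with the number of vectors decoupled from the first index\<close>

definition approximates :: "(nat \<Rightarrow> 'a::real_normed_vector) \<Rightarrow> (nat \<Rightarrow> 'b::real_normed_vector) \<Rightarrow> nat \<Rightarrow> real \<Rightarrow> nat \<Rightarrow> bool" where
  "approximates x s n \<delta> N \<longleftrightarrow> (\<forall>a k. (\<forall>i<n. \<bar>a i\<bar> \<le> 1) \<longrightarrow> strict_mono k \<longrightarrow> N \<le> k 0 \<longrightarrow>
     \<bar>norm (\<Sum>i<n. a i *\<^sub>R x (k i)) - norm (\<Sum>i<n. a i *\<^sub>R s i)\<bar> < \<delta>)"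

lemma approximatesD:
  "approximates x s n \<delta> N \<Longrightarrow> (\<And>i. i < n \<Longrightarrow> \<bar>a i\<bar> \<le> 1) \<Longrightarrow> strict_mono k \<Longrightarrow> N \<le> k 0 \<Longrightarrow>
     \<bar>norm (\<Sum>i<n. a i *\<^sub>R x (k i)) - norm (\<Sum>i<n. a i *\<^sub>R s i)\<bar> < \<delta>"
  unfolding approximates_def by blast

text \<open>The definition ties the error to the number of vectors. Padding \<open>n\<close>
  coefficients with zeros up to a large \<open>N\<close> makes the small error
  \<open>\<epsilon> N\<close> available for few vectors, provided their indices start at
  \<open>N\<close>.\<close>

lemma spreading_model_approx:
  assumes sp: "spreading_model x s" and \<delta>: "0 < \<delta>"
  obtains N where "approximates x s n \<delta> N"
proof -
  obtain \<epsilon> :: "nat \<Rightarrow> real" where \<epsilon>: "\<epsilon> \<longlonglongrightarrow> 0" and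
    ap: "\<And>n (a::nat \<Rightarrow> real) (k::nat \<Rightarrow> nat). \<forall>i<n. a i \<in> {-1..1} \<Longrightarrow> strict_mono_on {..<n} k \<Longrightarrow> n \<le> Suc (k 0) \<Longrightarrow>
      \<bar>norm (\<Sum>i<n. a i *\<^sub>R x (k i)) - norm (\<Sum>i<n. a i *\<^sub>R s i)\<bar> < \<epsilon> n"
    using sp unfolding spreading_model_def by blast
  have "\<forall>\<^sub>F N in sequentially. \<epsilon> N < \<delta> \<and> n \<le> N"
    using order_tendstoD(2)[OF \<epsilon> \<delta>] eventually_ge_at_top[of n] by eventually_elim simp
  then obtain N where N: "\<epsilon> N < \<delta>" "n \<le> N" by (auto simp: eventually_sequentially)
  show thesis
  proof (rule that[of N], unfold approximates_def, intro allI impI)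
    fix a :: "nat \<Rightarrow> real" and k :: "nat \<Rightarrow> nat"
    assume a: "\<forall>i<n. \<bar>a i\<bar> \<le> 1" and k: "strict_mono k" "N \<le> k 0"
    define b where "b = (\<lambda>i. if i < n then a i else 0)"
    have pad1: "(\<Sum>i<n. a i *\<^sub>R x (k i)) = (\<Sum>i<N. b i *\<^sub>R x (k i))"
      by (rule sum.mono_neutral_cong_left) (use N(2) in \<open>auto simp: b_def\<close>)
    have pad2: "(\<Sum>i<n. a i *\<^sub>R s i) = (\<Sum>i<N. b i *\<^sub>R s i)"
      by (rule sum.mono_neutral_cong_left) (use N(2) in \<open>auto simp: b_def\<close>)
    have "\<forall>i<N. b i \<in> {-1..1}" using a by (auto simp: b_def abs_le_iff minus_le_iff)
    from ap[OF this, of k] k N(1)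
    show "\<bar>norm (\<Sum>i<n. a i *\<^sub>R x (k i)) - norm (\<Sum>i<n. a i *\<^sub>R s i)\<bar> < \<delta>"
      unfolding pad1 pad2 by (simp add: strict_mono_on_def strict_mono_def)
  qed
qed

lemma real_eq_if_close: "(\<And>\<delta>. 0 < \<delta> \<Longrightarrow> \<bar>a - b\<bar> < \<delta>) \<Longrightarrow> a = (b :: real)"
  by (metis abs_le_zero_iff eq_iff_diff_eq_0 field_lbound_gt_zero less_irrefl linorder_not_le zero_less_abs_iff)

lemma sum_reindexed_coeffs:
  fixes v :: "nat \<Rightarrow> 'c::real_vector" and l :: "nat \<Rightarrow> nat"
  assumes "strict_mono l"
  shows "(\<Sum>j<l n. (\<Sum>i<n. if l i = j then a i else 0) *\<^sub>R v j) = (\<Sum>i<n. a i *\<^sub>R v (l i))"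
proof -
  have "(\<Sum>j<l n. (\<Sum>i<n. if l i = j then a i else 0) *\<^sub>R v j) =
      (\<Sum>j<l n. \<Sum>i<n. (if l i = j then a i else 0) *\<^sub>R v j)"
    by (simp add: scaleR_sum_left)
  also have "\<dots> = (\<Sum>i<n. \<Sum>j<l n. (if l i = j then a i else 0) *\<^sub>R v j)" by (rule sum.swap)
  also have "\<dots> = (\<Sum>i<n. a i *\<^sub>R v (l i))"
  proof (rule sum.cong[OF refl])
    fix i assume "i \<in> {..<n}"
    then have "l i < l n" using assms by (simp add: strict_mono_less)
    have "(\<Sum>j<l n. (if l i = j then a i else 0) *\<^sub>R v j) = (\<Sum>j<l n. if l i = j then a i *\<^sub>R v j else 0)"
      by (intro sum.cong) auto
    then show "(\<Sum>j<l n. (if l i = j then a i else 0) *\<^sub>R v j) = a i *\<^sub>R v (l i)"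
      using \<open>l i < l n\<close> by simp
  qed
  finally show ?thesis .
qed

text \<open>The combination of \<open>x\<close> on the indices \<open>N + l i\<close> has two
  readings: as \<open>n\<close> vectors, or as \<open>l n\<close> consecutive vectors with
  coefficients \<open>b\<close> vanishing off the range of \<open>l\<close>. They approximate the
  two norms in \<open>s\<close>.\<close>

lemma spreading_model_spread:
  assumes sp: "spreading_model x s" and l: "strict_mono l" and a: "\<And>i. i < n \<Longrightarrow> \<bar>a i\<bar> \<le> 1"
  shows "norm (\<Sum>i<n. a i *\<^sub>R s (l i)) = norm (\<Sum>i<n. a i *\<^sub>R s i)"
proof (rule real_eq_if_close)
  fix \<delta> :: real assume "0 < \<delta>"
  then have \<delta>: "0 < \<delta> / 2" by simp
  define n' where "n' = l n"
  define b where "b = (\<lambda>j. \<Sum>i<n. if l i = j then a i else 0)"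
  have inj: "l i = l j \<longleftrightarrow> i = j" for i j using l by (simp add: strict_mono_eq)
  have b1: "\<bar>b j\<bar> \<le> 1" for j
  proof (cases "\<exists>i<n. l i = j")
    case True
    then obtain i where i: "i < n" "l i = j" by blast
    have "b j = (\<Sum>i'<n. if i' = i then a i' else 0)"
      unfolding b_def i(2)[symmetric] inj ..
    then show ?thesis using a i(1) by simp
  next
    case False
    then have "b j = 0" unfolding b_def by (intro sum.neutral) auto
    then show ?thesis by simp
  qed
  have eq: "(\<Sum>i<n. a i *\<^sub>R s (l i)) = (\<Sum>j<n'. b j *\<^sub>R s j)"
    unfolding b_def n'_def by (rule sum_reindexed_coeffs[OF l, symmetric])
  obtain N1 where N1: "approximates x s n (\<delta> / 2) N1"
      using spreading_model_approx[OF sp \<delta>] by blast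
  obtain N2 where N2: "approximates x s n' (\<delta> / 2) N2"
      using spreading_model_approx[OF sp \<delta>] by blast
  define N where "N = max N1 N2"
  have "(\<Sum>i<n. a i *\<^sub>R x (N + l i)) = (\<Sum>j<n'. b j *\<^sub>R x (N + j))"
    unfolding b_def n'_def by (rule sum_reindexed_coeffs[OF l, symmetric])
  moreover have "\<bar>norm (\<Sum>j<n'. b j *\<^sub>R x (N + j)) - norm (\<Sum>j<n'. b j *\<^sub>R s j)\<bar> < \<delta> / 2"
    by (rule approximatesD[OF N2]) (use b1 in \<open>auto simp: N_def strict_mono_def\<close>)
  moreover have "\<bar>norm (\<Sum>i<n. a i *\<^sub>R x (N + l i)) - norm (\<Sum>i<n. a i *\<^sub>R s i)\<bar> < \<delta> / 2"
    by (rule approximatesD[OF N1]) (use a l in \<open>auto simp: N_def strict_mono_def\<close>)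
  ultimately show "\<bar>norm (\<Sum>i<n. a i *\<^sub>R s (l i)) - norm (\<Sum>i<n. a i *\<^sub>R s i)\<bar> < \<delta>"
    unfolding eq by (simp add: abs_if split: if_splits)
qed

lemma spreading_model_norm:
  assumes "spreading_model x s" shows "norm (s i) = 1"
proof -
  have "norm (s 0) = 1"
  proof (rule real_eq_if_close)
    fix \<delta> :: real assume "0 < \<delta>"
    from spreading_model_approx[OF assms this] obtain N where N: "approximates x s 1 \<delta> N" by blast
    have "norm (x N) = 1" using assms by (simp add: spreading_model_def normalized_def)
    then show "\<bar>norm (s 0) - 1\<bar> < \<delta>"
      using approximatesD[OF N, of "\<lambda>_. 1" "\<lambda>i. N + i"] by (simp add: strict_mono_def abs_minus_commute)
  qed
  moreover have "norm (s i) = norm (s 0)"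
    using spreading_model_spread[OF assms, of "\<lambda>j. i + j" 1 "\<lambda>_. 1"] by (simp add: strict_mono_def)
  ultimately show ?thesis by simp
qed

section \<open>The hypothesis on pairs, with \<open>c = 2\<close> for (a) and \<open>c = 1\<close>
  for (b)\<close>

locale pair_norm =
  fixes e :: "nat \<Rightarrow> 'a::banach" and c :: real and K :: real
  assumes K: "bounded_projections K e"
    and pair: "\<And>(x :: nat \<Rightarrow> 'a) (s :: nat \<Rightarrow> linf). block_basis e x \<Longrightarrow> normalized x \<Longrightarrow> spreading_model x s \<Longrightarrow>
      norm (s 0 + s 1) = c"
begin

text \<open>The only access to the hypothesis. A subsequence has a spreading model, whose first two
  vectors describe the pairs of that subsequence far out.\<close>

lemma near_pair:
  assumes y: "block_basis e y" "normalized y" and \<delta>: "0 < \<delta>"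
  obtains j k where "j < k" "\<bar>norm (y j + y k) - c\<bar> < \<delta>"
proof -
  obtain \<phi> and s :: "nat \<Rightarrow> linf" where sm: "strict_mono \<phi>" and sp: "spreading_model (y \<circ> \<phi>) s"
    using spreading_model_subseq[OF K y] by blast
  have "normalized (y \<circ> \<phi>)" using y(2) by (simp add: normalized_def)
  from pair[OF block_basis_subseq[OF y(1) sm] this sp] have c: "norm (s 0 + s 1) = c" .
  from spreading_model_approx[OF sp \<delta>] obtain N where N: "approximates (y \<circ> \<phi>) s 2 \<delta> N" by blast
  have "\<bar>norm (y (\<phi> N) + y (\<phi> (Suc N))) - c\<bar> < \<delta>"
    using approximatesD[OF N, of "\<lambda>_. 1" "\<lambda>i. N + i"] c by (simp add: strict_mono_def numeral_2_eq_2)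
  moreover have "\<phi> N < \<phi> (Suc N)" using sm by (simp add: strict_mono_less)
  ultimately show thesis using that by blast
qed

end

section \<open>Long sums when pairs have norm one\<close>

locale pair_norm_one = pair_norm e 1 K for e :: "nat \<Rightarrow> 'a::banach" and K
begin

text \<open>Normalized sums of \<open>2 ^ n\<close> consecutive terms form another block basis of
  \<open>e\<close>. Some pair of them has norm close to 1, and up to normalization this pair is a
  sum of \<open>2 ^ Suc n\<close> terms of \<open>x\<close>.\<close>

lemma norm_sum_power_two:
  fixes x :: "nat \<Rightarrow> 'a" and s :: "nat \<Rightarrow> linf"
  assumes x: "block_basis e x" "normalized x" and sp: "spreading_model x s"
  shows "norm (\<Sum>i<2^n. s i) = 1"
proof (induction n)
  case 0 then show ?case using spreading_model_norm[OF sp] by simp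
next
  case (Suc n)
  define M where "M = (2::nat)^n"
  have M: "0 < M" "2 ^ Suc n = 2 * M" by (simp_all add: M_def)
  show ?case
  proof (rule real_eq_if_close)
    fix \<delta> :: real assume "0 < \<delta>"
    \<comment> \<open>Four errors: one from the pair, two from the normalizations, one from the
      spreading model. The bound 1/2 keeps the block sums nonzero.\<close>
    define \<eta> where "\<eta> = min (\<delta> / 4) (1 / 2)"
    have \<eta>: "0 < \<eta>" "4 * \<eta> \<le> \<delta>" "\<eta> \<le> 1 / 2" using \<open>0 < \<delta>\<close> by (auto simp: \<eta>_def)
    obtain N1 where N1: "approximates x s M \<eta> N1"
      using spreading_model_approx[OF sp \<eta>(1)] by blast
    obtain N2 where N2: "approximates x s (2 * M) \<eta> N2"
      using spreading_model_approx[OF sp \<eta>(1)] by blast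
    define i0 where "i0 = max N1 N2"
    define v where "v = (\<lambda>i. \<Sum>l<M. x (i * M + l))"
    have le: "i \<le> i * M" for i using M(1) by simp
    have v: "\<bar>norm (v i) - 1\<bar> < \<eta>" if "i \<ge> i0" for i
    proof -
      have "N1 \<le> i" using that by (simp add: i0_def)
      then have "N1 \<le> i * M" using le[of i] by (rule order_trans)
      then show ?thesis
        using approximatesD[OF N1, of "\<lambda>_. 1" "\<lambda>l. i * M + l"] Suc.IH by (simp add: v_def strict_mono_def M_def)
    qed
    define w where "w = (\<lambda>i. (1 / norm (v (i0 + i))) *\<^sub>R v (i0 + i))"
    have v0: "v i \<noteq> 0" if "i \<ge> i0" for i using v[OF that] \<eta>(3) by auto
    have "block_basis x w"
    proof (rule block_basisI[where p = "\<lambda>i. (i0 + i) * M"])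
      show "w k \<in> span (x ` {(i0 + k) * M..<(i0 + Suc k) * M})" for k
        unfolding w_def v_def by (intro span_scale span_sum span_base imageI) auto
      show "w k \<noteq> 0" for k using v0[of "i0 + k"] by (simp add: w_def)
    qed
    then have bw: "block_basis e w" by (rule block_basis_trans[OF x(1)])
    have nw: "normalized w" using v0 by (simp add: normalized_def w_def)
    obtain j k where jk: "j < k" "\<bar>norm (w j + w k) - 1\<bar> < \<eta>" by (rule near_pair[OF bw nw \<eta>(1)])
    have wv: "norm (w j - v (i0 + j)) < \<eta>" for j
    proof -
      have "w j - v (i0 + j) = (1 / norm (v (i0 + j)) - 1) *\<^sub>R v (i0 + j)"
        by (simp add: w_def scaleR_diff_left)
      also have "norm \<dots> = \<bar>(1 / norm (v (i0 + j)) - 1) * norm (v (i0 + j))\<bar>" by (simp add: abs_mult)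
      also have "\<dots> = \<bar>1 - norm (v (i0 + j))\<bar>" using v0[of "i0 + j"] by (simp add: left_diff_distrib)
      finally show ?thesis using v[of "i0 + j"] by simp
    qed
    have "\<bar>norm (v (i0 + j) + v (i0 + k)) - norm (w j + w k)\<bar> \<le>
        norm ((v (i0 + j) + v (i0 + k)) - (w j + w k))" by (rule norm_triangle_ineq3)
    also have "(v (i0 + j) + v (i0 + k)) - (w j + w k) = - ((w j - v (i0 + j)) + (w k - v (i0 + k)))"
      by simp
    also have "norm \<dots> \<le> norm (w j - v (i0 + j)) + norm (w k - v (i0 + k))"
      unfolding norm_minus_cancel by (rule norm_triangle_ineq)
    finally have 1: "\<bar>norm (v (i0 + j) + v (i0 + k)) - 1\<bar> < 3 * \<eta>"
      using wv[of j] wv[of k] jk(2) by linarith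
    \<comment> \<open>Enumerates the \<open>2 * M\<close> indices of the two blocks in increasing
      order and continues beyond them.\<close>
    define \<kappa> where "\<kappa> = (\<lambda>l. if l < M then (i0 + j) * M + l else (i0 + k) * M + (l - M))"
    have "strict_mono \<kappa>"
      unfolding strict_mono_Suc_iff
    proof
      fix l
      have "(i0 + j) * M + M \<le> (i0 + k) * M"
        using jk(1) mult_le_mono1[of "Suc (i0 + j)" "i0 + k" M] by simp
      then show "\<kappa> l < \<kappa> (Suc l)" by (auto simp: \<kappa>_def)
    qed
    moreover have "N2 \<le> \<kappa> 0"
    proof -
      have "N2 \<le> i0 + j" by (simp add: i0_def)
      then have "N2 \<le> (i0 + j) * M" using le[of "i0 + j"] by (rule order_trans)
      then show ?thesis using M(1) by (simp add: \<kappa>_def)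
    qed
    ultimately have "\<bar>norm (\<Sum>l<2 * M. x (\<kappa> l)) - norm (\<Sum>l<2 * M. s l)\<bar> < \<eta>"
      using approximatesD[OF N2, of "\<lambda>_. 1" \<kappa>] by simp
    moreover have "(\<Sum>l<2 * M. x (\<kappa> l)) = v (i0 + j) + v (i0 + k)"
    proof -
      have "(\<Sum>l<2 * M. x (\<kappa> l)) = (\<Sum>l<M. x (\<kappa> l)) + (\<Sum>l<M. x (\<kappa> (l + M)))"
        using sum.atLeastLessThan_concat[of 0 M "2 * M" "\<lambda>l. x (\<kappa> l)"]
          sum.shift_bounds_nat_ivl[of "\<lambda>l. x (\<kappa> l)" 0 M M]
        by (simp add: atLeast0LessThan mult_2)
      then show ?thesis by (simp add: v_def \<kappa>_def)
    qed
    ultimately show "\<bar>norm (\<Sum>i<2 ^ Suc n. s i) - 1\<bar> < \<delta>"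
      unfolding M(2) using 1 \<eta>(2) by simp
  qed
qed

text \<open>Norm 1 is known for powers of two, so \<open>g\<close> has to be monotone; the basis
  constant alone would give this only up to a factor. Averaging \<open>u + s (m + l)\<close> over
  \<open>M\<close> values of \<open>l\<close> yields \<open>u\<close> plus a vector of norm
  \<open>1 / M\<close>, while each term has norm \<open>g (Suc m)\<close> by spreading.\<close>

lemma norm_sum_le_one:
  fixes x :: "nat \<Rightarrow> 'a" and s :: "nat \<Rightarrow> linf"
  assumes x: "block_basis e x" "normalized x" and sp: "spreading_model x s"
  shows "norm (\<Sum>i<m. s i) \<le> 1"
proof -
  define g where "g = (\<lambda>m. norm (\<Sum>i<m. s i))"
  have spread: "norm (\<Sum>i<n. s (l i)) = g n" if "strict_mono l" for n l
    using spreading_model_spread[OF sp that, of n "\<lambda>_. 1"] by (simp add: g_def)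
  have step: "g m \<le> g (Suc m)" for m
  proof -
    have p: "g m \<le> g (Suc m) + (1/2)^p" for p
    proof -
      define M where "M = (2::nat)^p"
      define u where "u = (\<Sum>i<m. s i)"
      have "norm (u + s (m + l)) = g (Suc m)" for l
      proof -
        have "strict_mono (\<lambda>i. if i < m then i else i + l)" by (simp add: strict_mono_Suc_iff)
        from spread[OF this, of "Suc m"] show ?thesis by (simp add: u_def)
      qed
      then have "norm (\<Sum>l<M. u + s (m + l)) \<le> real M * g (Suc m)"
        using sum_norm_le[of "{..<M}" "\<lambda>l. u + s (m + l)" "\<lambda>_. g (Suc m)"] by simp
      moreover have "(\<Sum>l<M. u + s (m + l)) = real M *\<^sub>R u + (\<Sum>l<M. s (m + l))"
        by (simp add: sum.distrib sum_constant_scaleR)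
      moreover have "norm (\<Sum>l<M. s (m + l)) = 1"
        using spread[of "\<lambda>l. m + l" M] norm_sum_power_two[OF x sp, of p]
        by (simp add: strict_mono_def g_def M_def)
      ultimately have "norm (real M *\<^sub>R u) \<le> real M * g (Suc m) + 1"
        using norm_diff_triangle_ineq norm_triangle_ineq4[of "(\<Sum>l<M. u + s (m + l))" "\<Sum>l<M. s (m + l)"] by simp
      then have "real M * g m \<le> real M * (g (Suc m) + 1 / real M)"
        by (simp add: u_def g_def M_def distrib_left)
      then have "g m \<le> g (Suc m) + 1 / real M"
        by (rule mult_left_le_imp_le) (simp add: M_def)
      then show ?thesis by (simp add: M_def power_one_over)
    qed
    have "(\<lambda>p. g (Suc m) + (1/2)^p) \<longlonglongrightarrow> g (Suc m) + 0"
      by (intro tendsto_intros LIMSEQ_power_zero) auto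
    then show ?thesis using p by (intro LIMSEQ_le_const[of _ "g (Suc m)" "g m"]) auto
  qed
  have "g m \<le> g (2 ^ m)" by (rule lift_Suc_mono_le[of g, OF step]) (simp add: less_imp_le)
  then show ?thesis using norm_sum_power_two[OF x sp, of m] by (simp add: g_def)
qed

text \<open>A window of \<open>m\<close> indices beyond the thresholds for all sizes up to
  \<open>m\<close> serves every subset at once.\<close>

lemma small_subset_sums:
  assumes y: "block_basis e y" "normalized y" and \<delta>: "0 < \<delta>"
  obtains A where "finite A" "card A = m" "\<And>B. B \<subseteq> A \<Longrightarrow> norm (\<Sum>i\<in>B. y i) \<le> 1 + \<delta>"
proof -
  obtain \<phi> and s :: "nat \<Rightarrow> linf" where sm: "strict_mono \<phi>" and sp: "spreading_model (y \<circ> \<phi>) s"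
    using spreading_model_subseq[OF K y] by blast
  have ny: "normalized (y \<circ> \<phi>)" using y(2) by (simp add: normalized_def)
  have blk': "block_basis e (y \<circ> \<phi>)" by (rule block_basis_subseq[OF y(1) sm])
  have "\<exists>N :: nat. \<forall>k :: nat \<Rightarrow> nat. strict_mono k \<longrightarrow> N \<le> k 0 \<longrightarrow> norm (\<Sum>i<n. y (\<phi> (k i))) \<le> 1 + \<delta>" for n :: nat
  proof -
    obtain N where N: "approximates (y \<circ> \<phi>) s n \<delta> N"
      using spreading_model_approx[OF sp \<delta>] by blast
    have "norm (\<Sum>i<n. y (\<phi> (k i))) \<le> 1 + \<delta>" if "strict_mono k" "N \<le> k 0" for k
      using approximatesD[OF N, of "\<lambda>_. 1" k] that norm_sum_le_one[OF blk' ny sp, of n] by simp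
    then show ?thesis by blast
  qed
  then have "\<forall>n. \<exists>N :: nat. \<forall>k :: nat \<Rightarrow> nat. strict_mono k \<longrightarrow> N \<le> k 0 \<longrightarrow> norm (\<Sum>i<n. y (\<phi> (k i))) \<le> 1 + \<delta>" by (rule allI)
  from choice[OF this] obtain N :: "nat \<Rightarrow> nat" where
    N: "\<forall>n k. strict_mono k \<longrightarrow> N n \<le> k 0 \<longrightarrow> norm (\<Sum>i<n. y (\<phi> (k i))) \<le> 1 + \<delta>" by blast
  define N0 where "N0 = Max (N ` {..m})"
  have N0: "N n \<le> N0" if "n \<le> m" for n unfolding N0_def by (rule Max_ge) (use that in auto)
  show thesis
  proof (rule that[of "\<phi> ` {N0..<N0 + m}"])
    show "card (\<phi> ` {N0..<N0 + m}) = m"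
      using sm by (subst card_image) (auto intro: strict_mono_imp_inj_on inj_on_subset)
    fix B assume "B \<subseteq> \<phi> ` {N0..<N0 + m}"
    then obtain B' where B': "B' \<subseteq> {N0..<N0 + m}" "B = \<phi> ` B'" by (meson subset_imageE)
    have fB: "finite B'" using B'(1) finite_subset by blast
    define n where "n = card B'"
    have n: "n \<le> m" using card_mono[OF _ B'(1)] by (simp add: n_def)
    define xs where "xs = sorted_list_of_set B'"
    have xs: "sorted_wrt (<) xs" "set xs = B'" "length xs = n"
      using fB by (simp_all add: xs_def n_def)
    \<comment> \<open>Beyond \<open>n\<close> the values only keep \<open>k\<close> strictly
      monotone on all naturals, as \<open>approximates\<close> demands.\<close>
    define k where "k = (\<lambda>i. if i < n then xs ! i else N0 + m + i)"
    have xsB: "xs ! i \<in> B'" if "i < n" for i using xs that nth_mem by metis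
    have km: "strict_mono k"
      unfolding strict_mono_Suc_iff
    proof
      fix i
      show "k i < k (Suc i)"
        using sorted_wrt_nth_less[OF xs(1), of i "Suc i"] xsB[of i] B'(1) xs(3) by (auto simp: k_def)
    qed
    have "N0 \<le> k 0" using xsB[of 0] B'(1) by (auto simp: k_def)
    then have "N n \<le> k 0" using N0[OF n] by simp
    from N[rule_format, OF km this] have "norm (\<Sum>i<n. y (\<phi> (k i))) \<le> 1 + \<delta>" .
    moreover have "(\<Sum>i<n. y (\<phi> (k i))) = (\<Sum>i\<in>B. y i)"
    proof -
      have "k ` {..<n} = B'" using xs(2,3) by (auto simp: k_def in_set_conv_nth image_iff)
      moreover have "inj_on k {..<n}" using strict_mono_imp_inj_on[OF km] inj_on_subset by blast
      ultimately have "bij_betw k {..<n} B'" by (simp add: bij_betw_def)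
      then have "(\<Sum>i<n. y (\<phi> (k i))) = (\<Sum>i\<in>B'. y (\<phi> i))"
        by (rule sum.reindex_bij_betw[of k _ _ "\<lambda>i. y (\<phi> i)"])
      also have "\<dots> = (\<Sum>i\<in>B. y i)"
        unfolding B'(2) using sm by (subst sum.reindex) (auto intro: strict_mono_imp_inj_on inj_on_subset)
      finally show ?thesis .
    qed
    ultimately show "norm (\<Sum>i\<in>B. y i) \<le> 1 + \<delta>" by simp
  qed simp
qed

end

subsection \<open>Copies of \<open>\<ell>\<^sub>1\<close> and \<open>c\<^sub>0\<close>\<close>

text \<open>\<open>T\<close> is bounded below, so preimages of a convergent sequence are Cauchy for
  \<open>N\<close>, and completeness of \<open>E\<close> puts the limit into the image. This
  isolates what the cases \<open>\<ell>\<^sub>1\<close> and \<open>c\<^sub>0\<close> share.\<close>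

lemma isomorphic_toI:
  fixes T :: "(nat \<Rightarrow> real) \<Rightarrow> 'a::banach" and N :: "(nat \<Rightarrow> real) \<Rightarrow> real"
  assumes zero: "(\<lambda>_. 0) \<in> E" and add: "\<And>a b. a \<in> E \<Longrightarrow> b \<in> E \<Longrightarrow> (\<lambda>i. a i + b i) \<in> E"
    and scale: "\<And>a c. a \<in> E \<Longrightarrow> (\<lambda>i. c * a i) \<in> E"
    and T_add: "\<And>a b. a \<in> E \<Longrightarrow> b \<in> E \<Longrightarrow> T (\<lambda>i. a i + b i) = T a + T b"
    and T_scale: "\<And>a c. a \<in> E \<Longrightarrow> T (\<lambda>i. c * a i) = c *\<^sub>R T a"
    and c: "0 < c" and lower: "\<And>a. a \<in> E \<Longrightarrow> c * N a \<le> norm (T a)"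
    and upper: "\<And>a. a \<in> E \<Longrightarrow> norm (T a) \<le> C * N a"
    and pos: "\<And>a. a \<in> E \<Longrightarrow> N a \<le> 0 \<Longrightarrow> a = (\<lambda>_. 0)"
    and complete: "\<And>A. (\<And>k. A k \<in> E) \<Longrightarrow>
      (\<And>\<eta>. 0 < \<eta> \<Longrightarrow> \<exists>k0. \<forall>k\<ge>k0. \<forall>l\<ge>k0. N (\<lambda>i. A k i - A l i) \<le> \<eta>) \<Longrightarrow>
      \<exists>a\<in>E. (\<lambda>k. N (\<lambda>i. A k i - a i)) \<longlonglongrightarrow> 0"
  shows "subspace (T ` E) \<and> closed (T ` E) \<and> isomorphic_to E N (T ` E)"
proof -
  have diff: "(\<lambda>i. a i - b i) \<in> E" "T (\<lambda>i. a i - b i) = T a - T b" if "a \<in> E" "b \<in> E" for a b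
    using add[OF that(1) scale[OF that(2), of "-1"]] T_add[OF that(1) scale[OF that(2), of "-1"]]
      T_scale[OF that(2), of "-1"] by simp_all
  have T0: "T (\<lambda>_. 0) = 0" using T_scale[OF zero, of 0] by simp
  have "subspace (T ` E)"
  proof (rule subspaceI)
    show "0 \<in> T ` E" using T0 zero by (metis imageI)
    show "x + y \<in> T ` E" if "x \<in> T ` E" "y \<in> T ` E" for x y
      using that add T_add by (auto simp: image_iff) metis
    show "s *\<^sub>R x \<in> T ` E" if "x \<in> T ` E" for s x
      using that scale T_scale by (auto simp: image_iff) metis
  qed
  moreover have "closed (T ` E)"
    unfolding closed_sequential_limits
  proof (intro allI impI, elim conjE)
    fix y l assume y: "\<forall>k. y k \<in> T ` E" and lim: "y \<longlonglongrightarrow> l"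
    have "\<forall>k. \<exists>a. a \<in> E \<and> y k = T a" using y by blast
    from choice[OF this] obtain A where A: "\<And>k. A k \<in> E" "\<And>k. y k = T (A k)" by blast
    have "\<exists>k0. \<forall>k\<ge>k0. \<forall>l\<ge>k0. N (\<lambda>i. A k i - A l i) \<le> \<eta>" if \<eta>: "0 < \<eta>" for \<eta>
    proof -
      have "Cauchy y" using lim LIMSEQ_imp_Cauchy by blast
      moreover have "0 < c * \<eta>" using c \<eta> by simp
      ultimately obtain k0 where k0: "\<And>k l. k \<ge> k0 \<Longrightarrow> l \<ge> k0 \<Longrightarrow> dist (y k) (y l) < c * \<eta>"
        unfolding Cauchy_def by blast
      have "N (\<lambda>i. A k i - A l i) \<le> \<eta>" if "k \<ge> k0" "l \<ge> k0" for k l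
      proof -
        have "c * N (\<lambda>i. A k i - A l i) \<le> norm (y k - y l)"
          using lower[OF diff(1)[OF A(1) A(1)], of k l] by (simp add: diff(2) A)
        also have "\<dots> \<le> c * \<eta>" using k0[OF that] by (simp add: dist_norm)
        finally show ?thesis using c by simp
      qed
      then show ?thesis by blast
    qed
    from complete[OF A(1) this] obtain a where a: "a \<in> E" "(\<lambda>k. N (\<lambda>i. A k i - a i)) \<longlonglongrightarrow> 0" by blast
    have "(\<lambda>k. y k - T a) \<longlonglongrightarrow> 0"
    proof (rule Lim_null_comparison)
      show "\<forall>\<^sub>F k in sequentially. norm (y k - T a) \<le> C * N (\<lambda>i. A k i - a i)"
        using upper[OF diff(1)[OF A(1) a(1)]] by (simp add: diff(2) A a(1))
      show "(\<lambda>k. C * N (\<lambda>i. A k i - a i)) \<longlonglongrightarrow> 0" using tendsto_mult_right_zero[OF a(2)] .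
    qed
    then have "y \<longlonglongrightarrow> T a" by (simp add: LIM_zero_iff)
    then have "l = T a" using lim LIMSEQ_unique by blast
    then show "l \<in> T ` E" using a(1) by blast
  qed
  moreover have "isomorphic_to E N (T ` E)"
    unfolding isomorphic_to_def
  proof (rule exI[of _ T], intro conjI ballI allI)
    have "a = b" if ab: "a \<in> E" "b \<in> E" "T a = T b" for a b
    proof -
      have "c * N (\<lambda>i. a i - b i) \<le> 0" using lower[OF diff(1)[OF ab(1,2)]] ab by (simp add: diff(2))
      then have "N (\<lambda>i. a i - b i) \<le> 0" using c by (simp add: mult_le_0_iff)
      from pos[OF diff(1)[OF ab(1,2)] this] show ?thesis by (simp add: fun_eq_iff)
    qed
    then show "bij_betw T E (T ` E)" by (intro bij_betw_imageI inj_onI) auto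
    show "\<exists>c C. 0 < c \<and> (\<forall>a\<in>E. c * N a \<le> norm (T a) \<and> norm (T a) \<le> C * N a)"
      using c lower upper by blast
  qed (use T_add T_scale in auto)
  ultimately show ?thesis by blast
qed

lemma pointwise_limit:
  fixes A :: "nat \<Rightarrow> nat \<Rightarrow> real"
  assumes "\<And>\<eta>. 0 < \<eta> \<Longrightarrow> \<exists>k0. \<forall>k\<ge>k0. \<forall>l\<ge>k0. \<forall>i. \<bar>A k i - A l i\<bar> \<le> \<eta>"
  obtains a where "\<And>i. (\<lambda>k. A k i) \<longlonglongrightarrow> a i"
proof -
  have "\<exists>l. (\<lambda>k. A k i) \<longlonglongrightarrow> l" for i
  proof -
    have "Cauchy (\<lambda>k. A k i)"
    proof (rule metric_CauchyI)
      fix \<eta> :: real assume "0 < \<eta>"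
      then obtain k0 where k0: "\<forall>k\<ge>k0. \<forall>l\<ge>k0. \<forall>i. \<bar>A k i - A l i\<bar> \<le> \<eta> / 2" using assms[of "\<eta> / 2"] by auto
      have "dist (A k i) (A l i) < \<eta>" if "k \<ge> k0" "l \<ge> k0" for k l
        using k0[rule_format, OF that, of i] \<open>0 < \<eta>\<close> unfolding dist_real_def by linarith
      then show "\<exists>k0. \<forall>k\<ge>k0. \<forall>l\<ge>k0. dist (A k i) (A l i) < \<eta>" by blast
    qed
    then show ?thesis using real_Cauchy_convergent convergent_def by blast
  qed
  then show thesis using that by metis
qed

lemma ell1_subspace:
  fixes u :: "nat \<Rightarrow> 'a::banach"
  assumes u: "\<And>i. norm (u i) \<le> 1" and c: "0 < c"
    and lower: "\<And>a n. c * (\<Sum>i<n. \<bar>a i\<bar>) \<le> norm (\<Sum>i<n. a i *\<^sub>R u i)"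
  shows "\<exists>Y :: 'a set. subspace Y \<and> closed Y \<and> isomorphic_to ell1 ell1_norm Y"
proof -
  define T where "T = (\<lambda>a. \<Sum>i. a i *\<^sub>R u i)"
  have nle: "norm (a i *\<^sub>R u i) \<le> \<bar>a i\<bar>" for a i
    using mult_left_mono[OF u[of i], of "\<bar>a i\<bar>"] by simp
  have sm: "summable (\<lambda>i. a i *\<^sub>R u i)" if "a \<in> ell1" for a
    by (rule summable_comparison_test'[of "\<lambda>i. \<bar>a i\<bar>" 0]) (use that nle in \<open>auto simp: ell1_def\<close>)
  have sms: "(\<lambda>i. a i *\<^sub>R u i) sums T a" if "a \<in> ell1" for a
    using summable_sums[OF sm[OF that]] by (simp add: T_def)
  have ell1_add: "(\<lambda>i. a i + b i) \<in> ell1" if "a \<in> ell1" "b \<in> ell1" for a b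
    unfolding ell1_def mem_Collect_eq
    by (rule summable_comparison_test'[of "\<lambda>i. \<bar>a i\<bar> + \<bar>b i\<bar>" 0])
      (use that in \<open>auto simp: ell1_def intro: summable_add\<close>)
  have ell1_scale: "(\<lambda>i. s * a i) \<in> ell1" if "a \<in> ell1" for a s
    using that by (simp add: ell1_def abs_mult summable_mult)
  have partial: "(\<Sum>i<n. \<bar>a i\<bar>) \<le> ell1_norm a" if "a \<in> ell1" for a n
    unfolding ell1_norm_def by (rule sum_le_suminf) (use that in \<open>auto simp: ell1_def\<close>)
  have "subspace (T ` ell1) \<and> closed (T ` ell1) \<and> isomorphic_to ell1 ell1_norm (T ` ell1)"
  proof (rule isomorphic_toI[where c = c and C = 1])
    show "(\<lambda>_. 0) \<in> ell1" by (simp add: ell1_def)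
    fix a b s assume a: "a \<in> ell1"
    show "(\<lambda>i. s * a i) \<in> ell1" by (rule ell1_scale[OF a])
    have "(\<lambda>i. (s * a i) *\<^sub>R u i) sums (s *\<^sub>R T a)" using sums_scaleR_right[OF sms[OF a], of s] by simp
    from sums_unique2[OF sms[OF ell1_scale[OF a]] this] show "T (\<lambda>i. s * a i) = s *\<^sub>R T a" .
    show "c * ell1_norm a \<le> norm (T a)"
    proof (rule LIMSEQ_le)
      show "(\<lambda>n. c * (\<Sum>i<n. \<bar>a i\<bar>)) \<longlonglongrightarrow> c * ell1_norm a"
        using a unfolding ell1_def ell1_norm_def by (intro tendsto_intros summable_LIMSEQ) auto
      show "(\<lambda>n. norm (\<Sum>i<n. a i *\<^sub>R u i)) \<longlonglongrightarrow> norm (T a)"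
        using sms[OF a] unfolding sums_def by (intro tendsto_intros)
    qed (use lower in blast)
    show "norm (T a) \<le> 1 * ell1_norm a"
      unfolding T_def ell1_norm_def using norm_suminf_le[OF nle[of a]] a by (simp add: ell1_def)
    show "a = (\<lambda>_. 0)" if "ell1_norm a \<le> 0"
    proof
      fix i
      have "\<bar>a i\<bar> \<le> (\<Sum>i<Suc i. \<bar>a i\<bar>)" by (simp add: sum_nonneg)
      then have "\<bar>a i\<bar> \<le> 0" using partial[OF a, of "Suc i"] that by linarith
      then show "a i = 0" by simp
    qed
    assume b: "b \<in> ell1"
    show "(\<lambda>i. a i + b i) \<in> ell1" by (rule ell1_add[OF a b])
    have "(\<lambda>i. (a i + b i) *\<^sub>R u i) sums (T a + T b)"
      using sums_add[OF sms[OF a] sms[OF b]] by (simp add: scaleR_add_left)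
    from sums_unique2[OF sms[OF ell1_add[OF a b]] this] show "T (\<lambda>i. a i + b i) = T a + T b" .
  next
    fix A :: "nat \<Rightarrow> nat \<Rightarrow> real" assume A: "\<And>k. A k \<in> ell1"
      and C: "\<And>\<eta>. 0 < \<eta> \<Longrightarrow> \<exists>k0. \<forall>k\<ge>k0. \<forall>l\<ge>k0. ell1_norm (\<lambda>i. A k i - A l i) \<le> \<eta>"
    have d: "(\<lambda>i. A k i - A l i) \<in> ell1" for k l
      using ell1_add[OF A ell1_scale[OF A, of "-1"], of k l] by simp
    have pd: "(\<Sum>i<n. \<bar>A k i - A l i\<bar>) \<le> ell1_norm (\<lambda>i. A k i - A l i)" for k l n
      by (rule partial[OF d])
    have "\<exists>k0. \<forall>k\<ge>k0. \<forall>l\<ge>k0. \<forall>i. \<bar>A k i - A l i\<bar> \<le> \<eta>" if \<eta>: "0 < \<eta>" for \<eta>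
    proof -
      obtain k0 where k0: "\<forall>k\<ge>k0. \<forall>l\<ge>k0. ell1_norm (\<lambda>i. A k i - A l i) \<le> \<eta>" using C[OF \<eta>] by blast
      have "\<bar>A k i - A l i\<bar> \<le> ell1_norm (\<lambda>i. A k i - A l i)" for k l i
      proof -
        have "\<bar>A k i - A l i\<bar> \<le> (\<Sum>i<Suc i. \<bar>A k i - A l i\<bar>)" by (simp add: sum_nonneg)
        then show ?thesis using pd[of k l "Suc i"] by linarith
      qed
      then show ?thesis using k0 order_trans by blast
    qed
    then obtain a where a: "\<And>i. (\<lambda>k. A k i) \<longlonglongrightarrow> a i" using pointwise_limit[of A] by blast
    have tail: "\<exists>k0. \<forall>k\<ge>k0. (\<lambda>i. A k i - a i) \<in> ell1 \<and> ell1_norm (\<lambda>i. A k i - a i) \<le> \<eta>" if \<eta>: "0 < \<eta>" for \<eta>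
    proof -
      obtain k0 where k0: "\<forall>k\<ge>k0. \<forall>l\<ge>k0. ell1_norm (\<lambda>i. A k i - A l i) \<le> \<eta>" using C[OF \<eta>] by blast
      have "(\<lambda>i. A k i - a i) \<in> ell1 \<and> ell1_norm (\<lambda>i. A k i - a i) \<le> \<eta>" if k: "k \<ge> k0" for k
      proof -
        have s: "(\<Sum>i<n. \<bar>A k i - a i\<bar>) \<le> \<eta>" for n
        proof (rule tendsto_upperbound)
          show "(\<lambda>l. \<Sum>i<n. \<bar>A k i - A l i\<bar>) \<longlonglongrightarrow> (\<Sum>i<n. \<bar>A k i - a i\<bar>)" by (intro tendsto_intros a)
          show "\<forall>\<^sub>F l in sequentially. (\<Sum>i<n. \<bar>A k i - A l i\<bar>) \<le> \<eta>"
            using eventually_ge_at_top[of k0]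
          proof eventually_elim
            case (elim l)
            then show ?case using order_trans[OF pd] k0 k by blast
          qed
        qed simp
        then have "(\<lambda>i. A k i - a i) \<in> ell1"
          unfolding ell1_def mem_Collect_eq by (intro summableI_nonneg_bounded[of _ \<eta>]) auto
        then show ?thesis
          unfolding ell1_norm_def using s by (auto simp: ell1_def intro: suminf_le_const)
      qed
      then show ?thesis by blast
    qed
    obtain k where "(\<lambda>i. A k i - a i) \<in> ell1" using tail[of 1] by auto
    from ell1_add[OF A[of k] ell1_scale[OF this, of "-1"]] have "a \<in> ell1" by simp
    moreover have "(\<lambda>k. ell1_norm (\<lambda>i. A k i - a i)) \<longlonglongrightarrow> 0"
    proof (rule metric_LIMSEQ_I)
      fix \<eta> :: real assume "0 < \<eta>"
      then obtain k0 where k0: "\<forall>k\<ge>k0. (\<lambda>i. A k i - a i) \<in> ell1 \<and> ell1_norm (\<lambda>i. A k i - a i) \<le> \<eta> / 2"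
        using tail[of "\<eta> / 2"] by auto
      have "dist (ell1_norm (\<lambda>i. A k i - a i)) 0 < \<eta>" if "k \<ge> k0" for k
        using k0[rule_format, OF that] partial[of "\<lambda>i. A k i - a i" 0] \<open>0 < \<eta>\<close> by (simp add: dist_real_def)
      then show "\<exists>k0. \<forall>k\<ge>k0. dist (ell1_norm (\<lambda>i. A k i - a i)) 0 < \<eta>" by blast
    qed
    ultimately show "\<exists>a\<in>ell1. (\<lambda>k. ell1_norm (\<lambda>i. A k i - a i)) \<longlonglongrightarrow> 0" by blast
  qed (rule c)
  then show ?thesis by blast
qed

text \<open>The upper estimate over arbitrary finite index sets controls the tails for a null
  sequence, so the defining series of \<open>T\<close> converges.\<close>

lemma c0_subspace:
  fixes u :: "nat \<Rightarrow> 'a::banach"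
  assumes c: "0 < c" and lower: "\<And>a n j. j < n \<Longrightarrow> c * \<bar>a j\<bar> \<le> norm (\<Sum>i<n. a i *\<^sub>R u i)"
    and upper: "\<And>a I m. finite I \<Longrightarrow> (\<And>i. i \<in> I \<Longrightarrow> \<bar>a i\<bar> \<le> m) \<Longrightarrow> 0 \<le> m \<Longrightarrow> norm (\<Sum>i\<in>I. a i *\<^sub>R u i) \<le> C * m"
  shows "\<exists>Y :: 'a set. subspace Y \<and> closed Y \<and> isomorphic_to c0 c0_norm Y"
proof -
  define T where "T = (\<lambda>a. \<Sum>i. a i *\<^sub>R u i)"
  have C0: "0 \<le> C" using upper[of "{}" "\<lambda>_. 0" 1] by simp
  have bdd: "bdd_above (range (\<lambda>i. \<bar>a i\<bar>))" if "a \<in> c0" for a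
  proof -
    have "Bseq a" using that convergentI convergent_imp_Bseq unfolding c0_def by blast
    then obtain B where "\<And>i. norm (a i) \<le> B" unfolding Bseq_def by blast
    then show ?thesis by (intro bdd_aboveI2[of _ _ B]) simp
  qed
  have le: "\<bar>a i\<bar> \<le> c0_norm a" if "a \<in> c0" for a i
    unfolding c0_norm_def by (rule cSUP_upper[OF UNIV_I bdd[OF that]])
  have le': "c0_norm a \<le> m" if "\<And>i. \<bar>a i\<bar> \<le> m" for a m
    unfolding c0_norm_def by (rule cSUP_least) (use that in auto)
  have nn: "0 \<le> c0_norm a" if "a \<in> c0" for a using le[OF that, of 0] by linarith
  have sm: "summable (\<lambda>i. a i *\<^sub>R u i)" if a: "a \<in> c0" for a
    unfolding summable_Cauchy
  proof (intro allI impI)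
    fix \<epsilon> :: real assume \<epsilon>: "0 < \<epsilon>"
    define m where "m = \<epsilon> / (C + 1)"
    have m: "0 < m" "C * m < \<epsilon>" using \<epsilon> C0 by (simp_all add: m_def field_simps)
    obtain N where N: "\<And>i. i \<ge> N \<Longrightarrow> \<bar>a i\<bar> < m"
      using a m(1) unfolding c0_def mem_Collect_eq LIMSEQ_iff by auto
    have "norm (\<Sum>i\<in>{k..<n}. a i *\<^sub>R u i) < \<epsilon>" if "k \<ge> N" for k n
    proof -
      have "norm (\<Sum>i\<in>{k..<n}. a i *\<^sub>R u i) \<le> C * m"
        by (rule upper) (use N that m in \<open>auto intro: less_imp_le\<close>)
      then show ?thesis using m by simp
    qed
    then show "\<exists>N. \<forall>k\<ge>N. \<forall>n. norm (\<Sum>i\<in>{k..<n}. a i *\<^sub>R u i) < \<epsilon>" by blast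
  qed
  have sms: "(\<lambda>i. a i *\<^sub>R u i) sums T a" if "a \<in> c0" for a
    using summable_sums[OF sm[OF that]] by (simp add: T_def)
  have lim: "(\<lambda>n. norm (\<Sum>i<n. a i *\<^sub>R u i)) \<longlonglongrightarrow> norm (T a)" if "a \<in> c0" for a
    using sms[OF that] unfolding sums_def by (intro tendsto_intros)
  have c0_add: "(\<lambda>i. a i + b i) \<in> c0" if "a \<in> c0" "b \<in> c0" for a b
    using that tendsto_add[of a 0 sequentially b 0] by (simp add: c0_def)
  have c0_scale: "(\<lambda>i. s * a i) \<in> c0" if "a \<in> c0" for a s
    using that by (simp add: c0_def tendsto_mult_right_zero)
  have "subspace (T ` c0) \<and> closed (T ` c0) \<and> isomorphic_to c0 c0_norm (T ` c0)"
  proof (rule isomorphic_toI[where c = c and C = C])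
    show "(\<lambda>_. 0) \<in> c0" by (simp add: c0_def)
    fix a b s assume a: "a \<in> c0"
    show "(\<lambda>i. s * a i) \<in> c0" by (rule c0_scale[OF a])
    have "(\<lambda>i. (s * a i) *\<^sub>R u i) sums (s *\<^sub>R T a)" using sums_scaleR_right[OF sms[OF a], of s] by simp
    from sums_unique2[OF sms[OF c0_scale[OF a]] this] show "T (\<lambda>i. s * a i) = s *\<^sub>R T a" .
    have cl: "c * \<bar>a j\<bar> \<le> norm (T a)" for j
    proof (rule tendsto_lowerbound[OF lim[OF a]])
      show "\<forall>\<^sub>F n in sequentially. c * \<bar>a j\<bar> \<le> norm (\<Sum>i<n. a i *\<^sub>R u i)"
        using eventually_gt_at_top[of j] by eventually_elim (rule lower)
    qed simp
    have "c0_norm a \<le> norm (T a) / c" by (rule le') (use cl c in \<open>simp add: field_simps\<close>)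
    then show "c * c0_norm a \<le> norm (T a)" using c by (simp add: field_simps)
    show "norm (T a) \<le> C * c0_norm a"
    proof (rule tendsto_upperbound[OF lim[OF a]])
      show "\<forall>\<^sub>F n in sequentially. norm (\<Sum>i<n. a i *\<^sub>R u i) \<le> C * c0_norm a"
        by (intro always_eventually allI upper) (use le[OF a] nn[OF a] in auto)
    qed simp
    show "a = (\<lambda>_. 0)" if "c0_norm a \<le> 0"
    proof
      fix i show "a i = 0" using le[OF a, of i] that by simp
    qed
    assume b: "b \<in> c0"
    show "(\<lambda>i. a i + b i) \<in> c0" by (rule c0_add[OF a b])
    have "(\<lambda>i. (a i + b i) *\<^sub>R u i) sums (T a + T b)"
      using sums_add[OF sms[OF a] sms[OF b]] by (simp add: scaleR_add_left)
    from sums_unique2[OF sms[OF c0_add[OF a b]] this] show "T (\<lambda>i. a i + b i) = T a + T b" .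
  next
    fix A :: "nat \<Rightarrow> nat \<Rightarrow> real" assume A: "\<And>k. A k \<in> c0"
      and Ca: "\<And>\<eta>. 0 < \<eta> \<Longrightarrow> \<exists>k0. \<forall>k\<ge>k0. \<forall>l\<ge>k0. c0_norm (\<lambda>i. A k i - A l i) \<le> \<eta>"
    have d: "(\<lambda>i. A k i - A l i) \<in> c0" for k l
      using c0_add[OF A c0_scale[OF A, of "-1"], of k l] by simp
    have unif: "\<exists>k0. \<forall>k\<ge>k0. \<forall>l\<ge>k0. \<forall>i. \<bar>A k i - A l i\<bar> \<le> \<eta>" if \<eta>: "0 < \<eta>" for \<eta>
      using Ca[OF \<eta>] order_trans[OF le[OF d]] by blast
    then obtain a where a: "\<And>i. (\<lambda>k. A k i) \<longlonglongrightarrow> a i" using pointwise_limit[of A] by blast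
    have tail: "\<exists>k0. \<forall>k\<ge>k0. \<forall>i. \<bar>A k i - a i\<bar> \<le> \<eta>" if \<eta>: "0 < \<eta>" for \<eta>
    proof -
      obtain k0 where k0: "\<forall>k\<ge>k0. \<forall>l\<ge>k0. \<forall>i. \<bar>A k i - A l i\<bar> \<le> \<eta>" using unif[OF \<eta>] by blast
      have "\<bar>A k i - a i\<bar> \<le> \<eta>" if k: "k \<ge> k0" for k i
      proof (rule tendsto_upperbound)
        show "(\<lambda>l. \<bar>A k i - A l i\<bar>) \<longlonglongrightarrow> \<bar>A k i - a i\<bar>" by (intro tendsto_intros a)
        show "\<forall>\<^sub>F l in sequentially. \<bar>A k i - A l i\<bar> \<le> \<eta>"
          using eventually_ge_at_top[of k0] by eventually_elim (use k0 k in blast)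
      qed simp
      then show ?thesis by blast
    qed
    have "a \<longlonglongrightarrow> 0"
    proof (rule metric_LIMSEQ_I)
      fix \<eta> :: real assume \<eta>: "0 < \<eta>"
      then obtain k where k: "\<And>i. \<bar>A k i - a i\<bar> \<le> \<eta> / 2" using tail[of "\<eta> / 2"] by auto
      have "A k \<longlonglongrightarrow> 0" using A[of k] by (simp add: c0_def)
      from metric_LIMSEQ_D[OF this half_gt_zero[OF \<eta>]] obtain N where
        N: "\<And>i. i \<ge> N \<Longrightarrow> \<bar>A k i\<bar> < \<eta> / 2" by (auto simp: dist_real_def)
      have "dist (a i) 0 < \<eta>" if "i \<ge> N" for i
        using k[of i] N[OF that] unfolding dist_real_def by linarith
      then show "\<exists>N. \<forall>i\<ge>N. dist (a i) 0 < \<eta>" by blast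
    qed
    then have ac: "a \<in> c0" by (simp add: c0_def)
    have da: "(\<lambda>i. A k i - a i) \<in> c0" for k using c0_add[OF A c0_scale[OF ac, of "-1"], of k] by simp
    have "(\<lambda>k. c0_norm (\<lambda>i. A k i - a i)) \<longlonglongrightarrow> 0"
    proof (rule metric_LIMSEQ_I)
      fix \<eta> :: real assume "0 < \<eta>"
      then obtain k0 where k0: "\<forall>k\<ge>k0. \<forall>i. \<bar>A k i - a i\<bar> \<le> \<eta> / 2" using tail[of "\<eta> / 2"] by auto
      have "dist (c0_norm (\<lambda>i. A k i - a i)) 0 < \<eta>" if "k \<ge> k0" for k
        using le'[of "\<lambda>i. A k i - a i" "\<eta> / 2"] k0 that nn[OF da, of k] \<open>0 < \<eta>\<close> by (simp add: dist_real_def)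
      then show "\<exists>k0. \<forall>k\<ge>k0. dist (c0_norm (\<lambda>i. A k i - a i)) 0 < \<eta>" by blast
    qed
    then show "\<exists>a\<in>c0. (\<lambda>k. c0_norm (\<lambda>i. A k i - a i)) \<longlonglongrightarrow> 0" using ac by blast
  qed (rule c)
  then show ?thesis by blast
qed

subsection \<open>Part (a)\<close>

definition contraction :: "('a::real_normed_vector \<Rightarrow> real) \<Rightarrow> bool" where
  "contraction f \<longleftrightarrow> linear f \<and> (\<forall>v. \<bar>f v\<bar> \<le> norm v)"

lemma contraction_le: "contraction f \<Longrightarrow> f v \<le> norm v"
  unfolding contraction_def using abs_le_D1 by blast

lemma contraction_sum: "contraction f \<Longrightarrow> f (\<Sum>i\<in>A. a i *\<^sub>R v i) = (\<Sum>i\<in>A. a i * f (v i))"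
  by (simp add: contraction_def linear_sum linear_scale)

lemma ex_norming: "\<exists>f. contraction f \<and> f v = norm v"
  unfolding contraction_def by (metis norming_functional)

definition plus_set :: "(nat \<Rightarrow> 'a::real_normed_vector) \<Rightarrow> real \<Rightarrow> nat set \<Rightarrow> bool" where
  "plus_set z \<epsilon> A \<longleftrightarrow> (\<exists>f. contraction f \<and> (\<forall>i\<in>A. 1 - \<epsilon> \<le> f (z i)))"

lemma hered_plus_set: "hered (plus_set z \<epsilon>)"
  unfolding hered_def plus_set_def by blast

lemma plus_set_mono: "plus_set z \<epsilon> A \<Longrightarrow> \<epsilon> \<le> \<delta> \<Longrightarrow> plus_set z \<delta> A"
  unfolding plus_set_def by force

definition light :: "(nat \<Rightarrow> 'a::real_normed_vector) \<Rightarrow> real \<Rightarrow> real \<Rightarrow> nat set \<Rightarrow> nat set \<Rightarrow> (nat \<Rightarrow> real) \<Rightarrow> bool" where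
  "light z \<delta> \<theta> E b \<mu> \<longleftrightarrow> (\<forall>B\<subseteq>b. \<forall>n\<in>E. plus_set z \<delta> ({n} \<union> B) \<longrightarrow> sum \<mu> B \<le> 1 - \<theta>)"

lemma light_mono: "light z \<delta> \<theta>' E b \<mu> \<Longrightarrow> \<theta> \<le> \<theta>' \<Longrightarrow> light z \<delta> \<theta> E b \<mu>"
  unfolding light_def by (meson diff_left_mono order_trans)

locale pair_norm_two = pair_norm e 2 K for e :: "nat \<Rightarrow> 'a::banach" and K
begin

text \<open>For each \<open>n\<close> in \<open>E\<close> the sets compatible with \<open>n\<close>
  lack the rank of \<open>l\<close>; by the partition property so does their union. Hence one
  measure is light for all of \<open>E\<close>, and dropping the nodes below \<open>N\<close> costs
  no rank.\<close>

lemma plus_set_far: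
  fixes l :: "'w::wellorder list" and z :: "nat \<Rightarrow> 'a"
  assumes l: "l \<noteq> []" and P: "foldr (rext sequentially) l (plus_set z \<epsilon>) {}"
    and E: "finite E" "\<And>n. n \<in> E \<Longrightarrow> \<not> foldr (rext sequentially) l (plus_set z \<delta>) {n}"
    and \<theta>: "\<And>\<Phi> \<Psi> s. hered \<Psi> \<Longrightarrow> foldr (rext sequentially) l \<Phi> s \<Longrightarrow> \<not> foldr (rext sequentially) l \<Psi> {} \<Longrightarrow>
     \<exists>b \<mu>. weight b \<mu> 1 \<and> \<Phi> (s \<union> b) \<and> (\<forall>B\<subseteq>b. \<Psi> B \<longrightarrow> sum \<mu> B \<le> 1 - \<theta>)"
  shows "\<exists>b \<mu>. weight b \<mu> 1 \<and> plus_set z \<epsilon> b \<and> b \<subseteq> {N..} \<and> light z \<delta> \<theta> E b \<mu>"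
proof -
  let ?q = "foldr (rext sequentially) l"
  have hB: "hered (\<lambda>B. plus_set z \<delta> ({n} \<union> B))" for n by (rule hered_shift[OF hered_plus_set])
  have n: "\<not> ?q (\<lambda>B. \<exists>n\<in>E. plus_set z \<delta> ({n} \<union> B)) {}"
  proof (rule distributes_finite[OF distributes_foldr transfers_foldr E(1) hB])
    show "\<not> ?q (\<lambda>B. plus_set z \<delta> ({n} \<union> B)) {}" if "n \<in> E" for n
      using E(2)[OF that] transfers_shift[OF transfers_foldr, of sequentially l "plus_set z \<delta>" "{n}"] by simp
  qed (rule foldr_rext_False)
  have V: "\<forall>\<^sub>F x in sequentially. x \<in> {N..}" using eventually_ge_at_top[of N] by simp
  have "?q (\<lambda>A. plus_set z \<epsilon> A \<and> A \<subseteq> {N..}) {}"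
    by (rule transfersD[OF transfers_foldr V P]) simp
  from \<theta>[OF hered_Union[OF hB] this n] show ?thesis unfolding light_def by auto
qed

text \<open>If the root step fails, light measures are chosen one after another, with convex
  combinations \<open>y k\<close>. A functional norming \<open>y j + y k\<close> that reaches
  \<open>1 - \<delta>\<close> at a point of \<open>b j\<close> can reach it only on mass
  \<open>1 - \<theta>\<close> of \<open>b k\<close>; otherwise it stays below
  \<open>1 - \<delta>\<close> on all of \<open>b j\<close>. Either way the pair loses
  \<open>\<delta> * \<theta>\<close>.\<close>

lemma plus_set_step:
  fixes l :: "'w::wellorder list" and z :: "nat \<Rightarrow> 'a"
  assumes z: "block_basis e z" "normalized z"
    and P: "\<And>\<epsilon>. 0 < \<epsilon> \<Longrightarrow> foldr (rext sequentially) l (plus_set z \<epsilon>) {}"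
    and \<delta>: "0 < \<delta>" "\<delta> \<le> 1"
  shows "extend sequentially (foldr (rext sequentially) l (plus_set z \<delta>)) {}"
proof (cases "l = []")
  case True
  have "plus_set z \<delta> {n}" for n
    using ex_norming[of "z n"] z(2) \<delta>(1) unfolding plus_set_def normalized_def by force
  then show ?thesis by (simp add: extend_def True)
next
  case False
  let ?q = "foldr (rext sequentially) l"
  show ?thesis
  proof (rule ccontr)
    assume "\<not> ?thesis"
    then have "\<forall>\<^sub>F n in sequentially. \<not> ?q (plus_set z \<delta>) {n}"
      by (simp add: extend_def not_frequently)
    then obtain N0 where N0: "\<And>n. n \<ge> N0 \<Longrightarrow> \<not> ?q (plus_set z \<delta>) {n}"
      by (auto simp: eventually_sequentially)
    obtain \<theta>0 where \<theta>0: "\<theta>0 > 0" "\<And>\<Phi> \<Psi> s. hered \<Psi> \<Longrightarrow> ?q \<Phi> s \<Longrightarrow> \<not> ?q \<Psi> {} \<Longrightarrow>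
       \<exists>b \<mu>. weight b \<mu> 1 \<and> \<Phi> (s \<union> b) \<and> (\<forall>B\<subseteq>b. \<Psi> B \<longrightarrow> sum \<mu> B \<le> 1 - \<theta>0)"
      using weights_foldr[OF False, of sequentially] by blast
    define \<theta> where "\<theta> = min \<theta>0 1"
    have \<theta>: "0 < \<theta>" "\<theta> \<le> 1" "\<theta> \<le> \<theta>0" using \<theta>0(1) by (auto simp: \<theta>_def)
    \<comment> \<open>Chosen after \<theta>: normalizing two vectors of norm at least
      \<open>1 - \<epsilon>\<close> costs \<open>2 * \<epsilon>\<close>, half of the loss
      \<open>\<delta> * \<theta>\<close>.\<close>
    define \<epsilon> where "\<epsilon> = \<delta> * \<theta> / 4"
    have \<delta>\<theta>: "0 < \<delta> * \<theta>" "\<delta> * \<theta> \<le> 1" "\<delta> * \<theta> \<le> \<delta>"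
      using \<delta> \<theta> by (simp_all add: mult_le_one mult_left_le)
    have \<epsilon>: "0 < \<epsilon>" "\<epsilon> \<le> 1 / 4" using \<delta>\<theta> by (simp_all add: \<epsilon>_def)
    have ext: "\<exists>b \<mu>. weight b \<mu> 1 \<and> plus_set z \<epsilon> b \<and> b \<subseteq> {N..} \<and> light z \<delta> \<theta> E b \<mu>"
      if "finite E" "E \<subseteq> {N0..}" for E N
    proof -
      have "\<not> ?q (plus_set z \<delta>) {n}" if "n \<in> E" for n using N0 that \<open>E \<subseteq> {N0..}\<close> by auto
      from plus_set_far[OF False P[OF \<epsilon>(1)] that(1) this \<theta>0(2)]
      have "\<exists>b \<mu>. weight b \<mu> 1 \<and> plus_set z \<epsilon> b \<and> b \<subseteq> {N..} \<and> light z \<delta> \<theta>0 E b \<mu>" .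
      then show ?thesis using light_mono[OF _ \<theta>(3)] by blast
    qed
    \<comment> \<open>\<open>E\<close> accumulates all supports so far, so that each new measure is
      light for every earlier point and lies to the right of it.\<close>
    define S where "S = (\<lambda>(n::nat) (b, \<mu>, E). weight b \<mu> 1 \<and> plus_set z \<epsilon> b \<and> finite E \<and> E \<subseteq> {N0..} \<and> b \<subseteq> E)"
    define R where "R = (\<lambda>(n::nat) (b :: nat set, \<mu> :: nat \<Rightarrow> real, E) (b', \<mu>', E'). E' = E \<union> b' \<and> b' \<subseteq> {Suc (Max E)..} \<and> light z \<delta> \<theta> E b' \<mu>')"
    have "\<exists>f. \<forall>n. S n (f n) \<and> R n (f n) (f (Suc n))"
    proof (rule dependent_nat_choice)
      obtain b \<mu> where "weight b \<mu> 1" "plus_set z \<epsilon> b" "b \<subseteq> {N0..}" using ext[of "{}" N0] by auto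
      then show "\<exists>x. S 0 x" by (intro exI[of _ "(b, \<mu>, b)"]) (simp add: S_def weight_def)
      fix x n assume x: "S n x"
      obtain b \<mu> E where xe: "x = (b, \<mu>, E)" by (cases x)
      have E: "finite E" "E \<subseteq> {N0..}" using x by (simp_all add: S_def xe)
      obtain b' \<mu>' where b': "weight b' \<mu>' 1" "plus_set z \<epsilon> b'" "b' \<subseteq> {max N0 (Suc (Max E))..}" "light z \<delta> \<theta> E b' \<mu>'"
        using ext[OF E, of "max N0 (Suc (Max E))"] by blast
      then show "\<exists>y. S (Suc n) y \<and> R n x y"
        using E by (intro exI[of _ "(b', \<mu>', E \<union> b')"]) (auto simp: S_def R_def xe weight_def)
    qed
    then obtain f where f: "\<And>n. S n (f n)" "\<And>n. R n (f n) (f (Suc n))" by blast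
    define b where "b = (\<lambda>n. fst (f n))"
    define \<mu> where "\<mu> = (\<lambda>n. fst (snd (f n)))"
    define E where "E = (\<lambda>n. snd (snd (f n)))"
    have fe: "f n = (b n, \<mu> n, E n)" for n by (simp add: b_def \<mu>_def E_def)
    have w: "weight (b n) (\<mu> n) 1" and pb: "plus_set z \<epsilon> (b n)" and fE: "finite (E n)" and bE: "b n \<subseteq> E n" for n
      using f(1)[of n] by (simp_all add: S_def fe)
    have ES: "E (Suc n) = E n \<union> b (Suc n)" and bS: "b (Suc n) \<subseteq> {Suc (Max (E n))..}"
      and sm: "light z \<delta> \<theta> (E n) (b (Suc n)) (\<mu> (Suc n))" for n
      using f(2)[of n] by (simp_all add: R_def fe)
    have "mono E" using ES by (intro mono_iff_le_Suc[THEN iffD2]) auto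
    define y where "y = (\<lambda>k. \<Sum>i\<in>b k. \<mu> k i *\<^sub>R z i)"
    have wk: "finite (b k)" "\<And>i. 0 \<le> \<mu> k i" "sum (\<mu> k) (b k) = 1" for k using w[of k] by (auto simp: weight_def)
    have y1: "norm (y k) \<le> 1" for k
    proof -
      have "norm (y k) \<le> (\<Sum>i\<in>b k. norm (\<mu> k i *\<^sub>R z i))" unfolding y_def by (rule norm_sum)
      then show ?thesis using z(2) wk[of k] by (simp add: normalized_def)
    qed
    have y2: "1 - \<epsilon> \<le> norm (y k)" for k
    proof -
      obtain g where g: "contraction g" "\<And>i. i \<in> b k \<Longrightarrow> 1 - \<epsilon> \<le> g (z i)" using pb[of k] by (auto simp: plus_set_def)
      have "1 - \<epsilon> = (\<Sum>i\<in>b k. \<mu> k i * (1 - \<epsilon>))" by (simp add: sum_distrib_right[symmetric] wk)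
      also have "\<dots> \<le> (\<Sum>i\<in>b k. \<mu> k i * g (z i))" by (intro sum_mono mult_left_mono g wk)
      also have "\<dots> = g (y k)" unfolding y_def by (rule contraction_sum[OF g(1), symmetric])
      also have "\<dots> \<le> norm (y k)" by (rule contraction_le[OF g(1)])
      finally show ?thesis .
    qed
    have far: "norm (y j + y k) \<le> 2 - \<delta> * \<theta>" if jk: "j < k" for j k
    proof -
      obtain k' where k': "k = Suc k'" "j \<le> k'" using jk by (cases k) auto
      have bj: "b j \<subseteq> E k'" using bE[of j] monoD[OF \<open>mono E\<close> k'(2)] by blast
      obtain g where g: "contraction g" "g (y j + y k) = norm (y j + y k)" using ex_norming by blast
      have ga: "g (y j + y k) = g (y j) + g (y k)" using g(1) by (simp add: contraction_def linear_add)
      have gy: "g (y i) = (\<Sum>l\<in>b i. \<mu> i l * g (z l))" for i unfolding y_def by (rule contraction_sum[OF g(1)])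
      have gz: "g (z i) \<le> 1" for i using contraction_le[OF g(1), of "z i"] z(2) by (simp add: normalized_def)
      have gy1: "g (y i) \<le> 1" for i using contraction_le[OF g(1), of "y i"] y1[of i] by linarith
      show ?thesis
      proof (cases "\<exists>n\<in>b j. 1 - \<delta> \<le> g (z n)")
        case True
        then obtain n where n: "n \<in> b j" "1 - \<delta> \<le> g (z n)" by blast
        define B where "B = {i \<in> b k. 1 - \<delta> \<le> g (z i)}"
        have "plus_set z \<delta> ({n} \<union> B)" using g(1) n(2) by (auto simp: plus_set_def B_def)
        moreover have "B \<subseteq> b k" by (auto simp: B_def)
        ultimately have B: "sum (\<mu> k) B \<le> 1 - \<theta>"
          using sm[of k'] n(1) bj unfolding light_def k'(1) by blast
        have "g (y k) \<le> (\<Sum>i\<in>b k. \<mu> k i * (1 - \<delta> + (if i \<in> B then \<delta> else 0)))"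
          unfolding gy using gz by (intro sum_mono mult_left_mono wk) (auto simp: B_def)
        also have "\<dots> = (\<Sum>i\<in>b k. \<mu> k i * (1 - \<delta>)) + (\<Sum>i\<in>b k. if i \<in> B then \<mu> k i * \<delta> else 0)"
          unfolding sum.distrib[symmetric] by (intro sum.cong) (auto simp: algebra_simps)
        also have "\<dots> = (1 - \<delta>) + sum (\<mu> k) B * \<delta>"
        proof -
          have "(\<Sum>i\<in>b k. if i \<in> B then \<mu> k i * \<delta> else 0) = (\<Sum>i\<in>b k \<inter> B. \<mu> k i * \<delta>)"
            using sum.inter_restrict[OF wk(1), of "\<lambda>i. \<mu> k i * \<delta>" k B] by simp
          moreover have "b k \<inter> B = B" by (auto simp: B_def)
          ultimately show ?thesis by (simp add: sum_distrib_right[symmetric] wk)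
        qed
        also have "\<dots> \<le> (1 - \<delta>) + (1 - \<theta>) * \<delta>" using B \<delta>(1) by (simp add: mult_right_mono)
        finally have "g (y k) \<le> 1 - \<delta> * \<theta>" by (simp add: algebra_simps)
        then show ?thesis using gy1[of j] ga g(2) by linarith
      next
        case False
        have "g (y j) \<le> (\<Sum>i\<in>b j. \<mu> j i * (1 - \<delta>))"
          unfolding gy using False by (intro sum_mono mult_left_mono wk) auto
        also have "\<dots> = 1 - \<delta>" by (simp add: sum_distrib_right[symmetric] wk)
        finally show ?thesis using gy1[of k] ga g(2) \<delta>\<theta>(3) by linarith
      qed
    qed
    have yn: "0 < norm (y k)" for k using y2[of k] \<epsilon>(2) by linarith
    define v where "v = (\<lambda>k. (1 / norm (y k)) *\<^sub>R y k)"
    define p where "p = (\<lambda>k. case k of 0 \<Rightarrow> 0 | Suc k \<Rightarrow> Suc (Max (E k)))"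
    have bp: "b k \<subseteq> {p k..<p (Suc k)}" for k
    proof
      fix i assume i: "i \<in> b k"
      then have "i \<le> Max (E k)" using bE[of k] fE[of k] by (intro Max_ge) auto
      moreover have "p k \<le> i" using i bS by (cases k) (auto simp: p_def)
      ultimately show "i \<in> {p k..<p (Suc k)}" by (simp add: p_def)
    qed
    have "block_basis z v"
    proof (rule block_basisI[where p = p])
      show "v k \<in> span (z ` {p k..<p (Suc k)})" for k
        unfolding v_def y_def using bp[of k] by (intro span_scale span_sum span_base) auto
      show "v k \<noteq> 0" for k using yn[of k] by (simp add: v_def)
    qed
    then have bv: "block_basis e v" by (rule block_basis_trans[OF z(1)])
    have nv: "normalized v" using yn by (simp add: normalized_def v_def)
    have "0 < \<delta> * \<theta> / 2" using \<delta>\<theta>(1) by simp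
    from near_pair[OF bv nv this] obtain j k where jk: "j < k" "\<bar>norm (v j + v k) - 2\<bar> < \<delta> * \<theta> / 2" by blast
    have vy: "norm (v i - y i) \<le> \<epsilon>" for i
    proof -
      have "v i - y i = (1 / norm (y i) - 1) *\<^sub>R y i" by (simp add: v_def scaleR_diff_left)
      also have "norm \<dots> = \<bar>(1 / norm (y i) - 1) * norm (y i)\<bar>" by (simp add: abs_mult)
      also have "\<dots> = \<bar>1 - norm (y i)\<bar>" using yn[of i] by (simp add: left_diff_distrib)
      finally show ?thesis using y1[of i] y2[of i] by simp
    qed
    have "norm (v j + v k) = norm ((y j + y k) + ((v j - y j) + (v k - y k)))" by simp
    also have "\<dots> \<le> norm (y j + y k) + (norm (v j - y j) + norm (v k - y k))"
      by (intro order_trans[OF norm_triangle_ineq] add_left_mono norm_triangle_ineq)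
    also have "\<dots> \<le> 2 - \<delta> * \<theta> + (\<epsilon> + \<epsilon>)" by (intro add_mono far jk vy)
    also have "\<dots> = 2 - \<delta> * \<theta> / 2" by (simp add: \<epsilon>_def)
    finally show False using jk(2) by linarith
  qed
qed

text \<open>Transfinite induction for all lists at once: a smaller exponent \<open>b\<close> is
  prefixed \<open>k\<close> times, each time enlarging the list for the next application. Validity
  for every \<epsilon> is what survives this iteration.\<close>

lemma plus_set_all_ranks:
  fixes z :: "nat \<Rightarrow> 'a" and a :: "'w::wellorder"
  assumes z: "block_basis e z" "normalized z"
    and P: "\<And>\<epsilon>. 0 < \<epsilon> \<Longrightarrow> foldr (rext sequentially) l (plus_set z \<epsilon>) {}" and \<epsilon>: "0 < \<epsilon>"
  shows "foldr (rext sequentially) (a # l) (plus_set z \<epsilon>) {}"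
  using P \<epsilon>
proof (induction a arbitrary: l \<epsilon> rule: less_induct)
  case (less a)
  have "extend sequentially (foldr (rext sequentially) l (plus_set z \<epsilon>)) {}"
  proof -
    have "extend sequentially (foldr (rext sequentially) l (plus_set z (min \<epsilon> 1))) {}"
      by (rule plus_set_step[OF z less.prems(1)]) (use less.prems(2) in auto)
    then show ?thesis
    proof (rule transfers_mono[OF transfers_extend])
      fix B :: "nat set" assume "foldr (rext sequentially) l (plus_set z (min \<epsilon> 1)) ({} \<union> B)"
      then show "foldr (rext sequentially) l (plus_set z \<epsilon>) ({} \<union> B)"
        by (rule transfers_mono[OF transfers_foldr]) (auto elim: plus_set_mono)
    qed
  qed
  moreover have "(rext sequentially b ^^ k) (foldr (rext sequentially) l (plus_set z \<epsilon>)) {}" if "b < a" for b k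
  proof -
    have "\<And>\<epsilon>. 0 < \<epsilon> \<Longrightarrow> foldr (rext sequentially) (replicate k b @ l) (plus_set z \<epsilon>) {}"
    proof (induction k)
      case 0 then show ?case using less.prems(1) by simp
    next
      case (Suc k)
      have "foldr (rext sequentially) (b # (replicate k b @ l)) (plus_set z \<epsilon>) {}"
        by (rule less.IH[OF that Suc.IH Suc.prems])
      then show ?case by simp
    qed
    from this[OF less.prems(2)] show ?thesis by (simp add: foldr_replicate)
  qed
  ultimately show ?case by (simp add: rext.simps[of sequentially a])
qed

text \<open>Having all ranks in \<open>nat succ_card\<close> is preserved by some node beyond any
  given finite set, so a branch can be picked node by node.\<close>

lemma infinite_plus_set:
  fixes z :: "nat \<Rightarrow> 'a"
  assumes z: "block_basis e z" "normalized z" and \<epsilon>: "0 < \<epsilon>"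
  obtains J where "infinite J" "\<And>A. finite A \<Longrightarrow> A \<subseteq> J \<Longrightarrow> plus_set z \<epsilon> A"
proof -
  let ?L = "plus_set z \<epsilon>"
  have "foldr (rext sequentially) [] (plus_set z \<eta>) {}" for \<eta> 
  proof -
    have "contraction (\<lambda>_ :: 'a. 0 :: real)" by (simp add: contraction_def linear_iff)
    then show ?thesis by (auto simp: plus_set_def)
  qed
  then have all: "rext sequentially a ?L {}" for a :: "nat succ_card"
    using plus_set_all_ranks[OF z _ \<epsilon>, of "[]" a] by simp
  define S where "S = (\<lambda>(n::nat) s. finite s \<and> (\<forall>a :: nat succ_card. rext sequentially a ?L s))"
  define R where "R = (\<lambda>(n::nat) s s'. \<exists>x. s' = insert x s \<and> (\<forall>m\<in>s. m < (x :: nat)))"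
  have "\<exists>f. \<forall>n. S n (f n) \<and> R n (f n) (f (Suc n))"
  proof (rule dependent_nat_choice)
    show "\<exists>s. S 0 s" using all by (intro exI[of _ "{}"]) (simp add: S_def)
    fix s n assume s: "S n s"
    have V: "\<forall>\<^sub>F x in sequentially. x \<in> {x. \<forall>m\<in>s. m < x}"
      using s eventually_ball_finite[of s "\<lambda>x m. m < x" sequentially] by (simp add: S_def eventually_gt_at_top)
    have sa: "\<And>a :: nat succ_card. rext sequentially a ?L s" using s by (simp add: S_def)
    from rext_step[OF infinite_UNIV_nat V sa] obtain x where
      "x \<in> {x. \<forall>m\<in>s. m < x}" "\<forall>a :: nat succ_card. rext sequentially a ?L (insert x s)" by (rule bexE)
    then show "\<exists>y. S (Suc n) y \<and> R n s y" using s by (intro exI[of _ "insert x s"]) (auto simp: S_def R_def)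
  qed
  then obtain f where f: "\<And>n. S n (f n)" "\<And>n. R n (f n) (f (Suc n))" by blast
  have mono: "mono f" using f(2) by (intro mono_iff_le_Suc[THEN iffD2]) (auto simp: R_def)
  have card: "card (f n) \<ge> n" for n
  proof (induction n)
    case (Suc n)
    obtain k where "\<forall>x\<in>f n. x < k" "f (Suc n) = insert k (f n)" using f(2)[of n] by (auto simp: R_def)
    moreover have "finite (f n)" using f(1)[of n] by (simp add: S_def)
    ultimately show ?case using Suc by (auto simp: card_insert_if)
  qed simp
  show thesis
  proof (rule that[of "\<Union>n. f n"])
    show "infinite (\<Union>n. f n)"
    proof
      assume "finite (\<Union>n. f n)"
      then have "card (f (Suc (card (\<Union>n. f n)))) \<le> card (\<Union>n. f n)" by (intro card_mono) auto
      then show False using card[of "Suc (card (\<Union>n. f n))"] by simp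
    qed
    fix A assume A: "finite A" "A \<subseteq> (\<Union>n. f n)"
    then have "\<exists>n. A \<subseteq> f n"
    proof (induction A rule: finite_induct)
      case (insert x A)
      then obtain n m where "A \<subseteq> f n" "x \<in> f m" by auto
      then show ?case using monoD[OF mono, of n "max n m"] monoD[OF mono, of m "max n m"]
        by (intro exI[of _ "max n m"]) auto
    qed simp
    then obtain n where "A \<subseteq> f n" by blast
    moreover have "plus_set z \<epsilon> (f n)" using f(1)[of n] rext_imp[OF hered_plus_set] unfolding S_def by blast
    ultimately show "plus_set z \<epsilon> A" using hered_plus_set unfolding hered_def by blast
  qed
qed

end

section \<open>Oscillating functionals and the lower \<open>\<ell>\<^sub>1\<close> estimate\<close>

definition separates :: "(nat \<Rightarrow> 'a::real_normed_vector) \<Rightarrow> real \<Rightarrow> real \<Rightarrow> nat set \<Rightarrow> bool" where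
  "separates x lo hi F \<longleftrightarrow> (\<exists>f. contraction f \<and>
     (\<forall>i\<in>F. if even (card {j \<in> F. j < i}) then hi \<le> f (x i) else f (x i) \<le> lo))"

text \<open>The interval of oscillation is known only up to finitely many choices. The dichotomy is
  applied to one family after another: a family that can be avoided ends the process, otherwise the
  set is shrunk.\<close>

lemma dichotomy_finite:
  fixes \<F> :: "'i \<Rightarrow> nat set set"
  assumes "finite I"
  shows "\<exists>N. infinite N \<and> ((\<exists>m\<in>I. \<forall>s\<subseteq>N. finite s \<longrightarrow> s \<notin> \<F> m) \<or>
    (\<forall>m\<in>I. \<forall>L\<subseteq>N. infinite L \<longrightarrow> (\<exists>n. L \<inter> {..<n} \<in> \<F> m)))"
  using assms
proof (induction I rule: finite_induct)
  case empty
  show ?case by (rule exI[of _ UNIV]) simp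
next
  case (insert m I)
  then obtain N where N: "infinite N" "(\<exists>m\<in>I. \<forall>s\<subseteq>N. finite s \<longrightarrow> s \<notin> \<F> m) \<or>
    (\<forall>m\<in>I. \<forall>L\<subseteq>N. infinite L \<longrightarrow> (\<exists>n. L \<inter> {..<n} \<in> \<F> m))" by blast
  obtain N' where N': "N' \<subseteq> N" "infinite N'"
    "(\<forall>s\<subseteq>N'. finite s \<longrightarrow> s \<notin> \<F> m) \<or> (\<forall>L\<subseteq>N'. infinite L \<longrightarrow> (\<exists>n. L \<inter> {..<n} \<in> \<F> m))"
    using nash_williams_dichotomy[OF N(1), of "\<F> m"] by blast
  from N(2) show ?case
  proof
    assume "\<exists>m\<in>I. \<forall>s\<subseteq>N. finite s \<longrightarrow> s \<notin> \<F> m"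
    then show ?thesis using N(1) by blast
  next
    assume *: "\<forall>m\<in>I. \<forall>L\<subseteq>N. infinite L \<longrightarrow> (\<exists>n. L \<inter> {..<n} \<in> \<F> m)"
    then have "\<forall>m\<in>I. \<forall>L\<subseteq>N'. infinite L \<longrightarrow> (\<exists>n. L \<inter> {..<n} \<in> \<F> m)" using N'(1) by blast
    note all_I = this
    from N'(3) show ?thesis
    proof
      assume "\<forall>s\<subseteq>N'. finite s \<longrightarrow> s \<notin> \<F> m"
      then show ?thesis using N'(2) by blast
    next
      assume "\<forall>L\<subseteq>N'. infinite L \<longrightarrow> (\<exists>n. L \<inter> {..<n} \<in> \<F> m)"
      with all_I have "\<forall>k\<in>insert m I. \<forall>L\<subseteq>N'. infinite L \<longrightarrow> (\<exists>n. L \<inter> {..<n} \<in> \<F> k)" by simp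
      then show ?thesis using N'(2) by blast
    qed
  qed
qed

text \<open>Every sign pattern on the odd-numbered points of \<open>\<nu>\<close> extends to an alternating one by
  inserting even-numbered points where the parity has to be corrected.\<close>

lemma alternating_filler:
  fixes \<nu> :: "nat \<Rightarrow> nat"
  assumes \<nu>: "strict_mono \<nu>"
  shows "\<exists>F. finite F \<and> F \<subseteq> \<nu> ` {..<2 * n} \<and>
    (\<forall>i<n. \<nu> (Suc (2 * i)) \<in> F \<and> (even (card {j \<in> F. j < \<nu> (Suc (2 * i))}) \<longleftrightarrow> \<sigma> i))"
proof (induction n)
  case 0 then show ?case by (intro exI[of _ "{}"]) simp
next
  case (Suc n)
  then obtain F where F: "finite F" "F \<subseteq> \<nu> ` {..<2 * n}"
    and \<sigma>: "\<And>i. i < n \<Longrightarrow> \<nu> (Suc (2 * i)) \<in> F \<and> (even (card {j \<in> F. j < \<nu> (Suc (2 * i))}) \<longleftrightarrow> \<sigma> i)" by blast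
  \<comment> \<open>One correcting point when the parity is wrong; it lies between the earlier
    points and \<open>\<nu> (Suc (2 * n))\<close>.\<close>
  define G where "G = (if even (card F) = \<sigma> n then {} else {\<nu> (2 * n)})"
  define F' where "F' = insert (\<nu> (Suc (2 * n))) (F \<union> G)"
  have lt: "j < \<nu> (2 * n)" if "j \<in> F" for j using F(2) that \<nu> by (auto simp: strict_mono_less)
  have lt2: "\<nu> (2 * n) < \<nu> (Suc (2 * n))" using \<nu> by (simp add: strict_mono_less)
  have G: "j = \<nu> (2 * n)" if "j \<in> G" for j using that by (auto simp: G_def split: if_splits)
  have old: "{j \<in> F'. j < \<nu> (Suc (2 * i))} = {j \<in> F. j < \<nu> (Suc (2 * i))}" if i: "i < n" for i
  proof -
    have "\<nu> (Suc (2 * i)) < \<nu> (2 * n)" using \<nu> i by (simp add: strict_mono_less)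
    then show ?thesis using G lt2 by (fastforce simp: F'_def)
  qed
  have new: "{j \<in> F'. j < \<nu> (Suc (2 * n))} = F \<union> G"
    using lt lt2 G by (fastforce simp: F'_def)
  have "F \<inter> G = {}" using lt G by fastforce
  then have c: "card (F \<union> G) = card F + card G" using F(1) by (intro card_Un_disjoint) (auto simp: G_def)
  have par: "even (card (F \<union> G)) \<longleftrightarrow> \<sigma> n" unfolding c by (auto simp: G_def)
  show ?case
  proof (rule exI[of _ F'], intro conjI allI impI)
    show "finite F'" using F(1) by (simp add: F'_def G_def)
    have "F \<subseteq> \<nu> ` {..<2 * Suc n}" using F(2) by (rule order_trans) auto
    moreover have "F' \<subseteq> F \<union> {\<nu> (2 * n), \<nu> (Suc (2 * n))}" by (auto simp: F'_def G_def)
    ultimately show "F' \<subseteq> \<nu> ` {..<2 * Suc n}" by fastforce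
    fix i assume i: "i < Suc n"
    show "\<nu> (Suc (2 * i)) \<in> F'" using i \<sigma>[of i] by (auto simp: F'_def less_Suc_eq)
    show "even (card {j \<in> F'. j < \<nu> (Suc (2 * i))}) \<longleftrightarrow> \<sigma> i"
    proof (cases "i = n")
      case True then show ?thesis using new par by simp
    next
      case False then show ?thesis using i old[of i] \<sigma>[of i] by simp
    qed
  qed
qed

text \<open>Rosenthal's computation: two functionals with opposite patterns, read off from the signs
  of \<open>a\<close>, differ by at least \<open>hi - lo\<close> in the favourable direction on
  every vector. In \<open>f v - g v\<close> the position of the interval cancels and only its length
  remains.\<close>

lemma separated_lower_bound:
  fixes x :: "nat \<Rightarrow> 'a::real_normed_vector"
  assumes sep: "\<And>F. finite F \<Longrightarrow> F \<subseteq> range \<nu> \<Longrightarrow> separates x lo hi F" and \<nu>: "strict_mono \<nu>"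
  shows "(hi - lo) / 2 * (\<Sum>i<n. \<bar>a i\<bar>) \<le> norm (\<Sum>i<n. a i *\<^sub>R x (\<nu> (Suc (2 * i))))"
proof -
  have ex: "\<exists>f. contraction f \<and> (\<forall>i<n. if \<sigma> i then hi \<le> f (x (\<nu> (Suc (2 * i)))) else f (x (\<nu> (Suc (2 * i)))) \<le> lo)"
    for \<sigma> :: "nat \<Rightarrow> bool"
  proof -
    obtain F where F: "finite F" "F \<subseteq> \<nu> ` {..<2 * n}"
      and \<sigma>: "\<And>i. i < n \<Longrightarrow> \<nu> (Suc (2 * i)) \<in> F \<and> (even (card {j \<in> F. j < \<nu> (Suc (2 * i))}) \<longleftrightarrow> \<sigma> i)"
      using alternating_filler[OF \<nu>, of n \<sigma>] by blast
    have "F \<subseteq> range \<nu>" using F(2) by blast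
    from sep[OF F(1) this] obtain f where f: "contraction f"
      "\<And>i. i \<in> F \<Longrightarrow> if even (card {j \<in> F. j < i}) then hi \<le> f (x i) else f (x i) \<le> lo"
      unfolding separates_def by blast
    have "if \<sigma> i then hi \<le> f (x (\<nu> (Suc (2 * i)))) else f (x (\<nu> (Suc (2 * i)))) \<le> lo" if "i < n" for i
      using f(2)[of "\<nu> (Suc (2 * i))"] \<sigma>[OF that] by simp
    then show ?thesis using f(1) by blast
  qed
  define u where "u = (\<lambda>i. x (\<nu> (Suc (2 * i))))"
  obtain f where f: "contraction f" "\<And>i. i < n \<Longrightarrow> if 0 \<le> a i then hi \<le> f (u i) else f (u i) \<le> lo"
    using ex[of "\<lambda>i. 0 \<le> a i"] unfolding u_def by blast
  obtain g where g: "contraction g" "\<And>i. i < n \<Longrightarrow> if \<not> 0 \<le> a i then hi \<le> g (u i) else g (u i) \<le> lo"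
    using ex[of "\<lambda>i. \<not> 0 \<le> a i"] unfolding u_def by blast
  define v where "v = (\<Sum>i<n. a i *\<^sub>R u i)"
  have "(hi - lo) * (\<Sum>i<n. \<bar>a i\<bar>) = (\<Sum>i<n. \<bar>a i\<bar> * (hi - lo))"
    by (simp add: sum_distrib_left mult.commute)
  also have "\<dots> \<le> (\<Sum>i<n. a i * f (u i) - a i * g (u i))"
  proof (rule sum_mono)
    fix i assume "i \<in> {..<n}"
    then have i: "i < n" by simp
    show "\<bar>a i\<bar> * (hi - lo) \<le> a i * f (u i) - a i * g (u i)"
    proof (cases "0 \<le> a i")
      case True
      then have "hi - lo \<le> f (u i) - g (u i)" using f(2)[OF i] g(2)[OF i] by simp
      from mult_left_mono[OF this True] show ?thesis using True by (simp add: right_diff_distrib)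
    next
      case False
      then have "hi - lo \<le> g (u i) - f (u i)" using f(2)[OF i] g(2)[OF i] by simp
      then have "(- a i) * (hi - lo) \<le> (- a i) * (g (u i) - f (u i))" using False by (intro mult_left_mono) auto
      then show ?thesis using False by (simp add: right_diff_distrib)
    qed
  qed
  also have "\<dots> = f v - g v" unfolding v_def contraction_sum[OF f(1)] contraction_sum[OF g(1)] by (simp add: sum_subtractf)
  also have "\<dots> \<le> 2 * norm v"
  proof -
    have "\<bar>f v\<bar> \<le> norm v" "\<bar>g v\<bar> \<le> norm v" using f(1) g(1) by (auto simp: contraction_def)
    then show ?thesis by linarith
  qed
  finally show ?thesis by (simp add: v_def u_def)
qed

context pair_norm_two
begin

text \<open>Consecutive points of \<open>L\<close> are paired, and \<open>infinite_plus_set\<close>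
  for the normalized differences gives functionals whose two values on a pair differ by at least
  \<open>d / 2 = 3 * \<gamma>\<close>. Sorting the lower values into cells of length \<gamma> leaves
  the gap from \<open>M * \<gamma>\<close> to \<open>(M + 2) * \<gamma>\<close>; \<gamma>/2 on
  either side absorbs the passage from the limit \<alpha> back to a functional.\<close>

lemma ex_separated_subset:
  fixes x :: "nat \<Rightarrow> 'a"
  assumes x: "block_basis e x" "normalized x" and L: "infinite L" and d: "0 < d"
    and far: "\<And>i j. i < j \<Longrightarrow> d \<le> norm (x i - x j)"
  defines "\<gamma> \<equiv> d / 6"
  shows "\<exists>m::int. m \<in> {- \<lceil>1 / \<gamma>\<rceil>..\<lceil>1 / \<gamma>\<rceil>} \<and> (\<exists>L'\<subseteq>L. infinite L' \<and>
    (\<forall>n. separates x ((real_of_int m + 1/2) * \<gamma>) ((real_of_int m + 3/2) * \<gamma>) (L' \<inter> {..<n})))"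
proof -
  have \<gamma>: "0 < \<gamma>" using d by (simp add: \<gamma>_def)
  define l where "l = enumerate L"
  have sl: "strict_mono l" unfolding l_def by (rule strict_mono_enumerate[OF L])
  have lL: "l i \<in> L" for i unfolding l_def by (rule enumerate_in_set[OF L])
  define v where "v = (\<lambda>i. x (l (2 * i)) - x (l (Suc (2 * i))))"
  have dv: "d \<le> norm (v i)" for i
    unfolding v_def using sl by (intro far) (simp add: strict_mono_less)
  define w where "w = (\<lambda>i. (1 / norm (v i)) *\<^sub>R v i)"
  have v0: "norm (v i) > 0" for i using dv[of i] d by linarith
  have "block_basis x w"
  proof (rule block_basisI[where p = "\<lambda>i. l (2 * i)"])
    have "l (2 * k) < l (Suc (2 * k))" "l (Suc (2 * k)) < l (2 * Suc k)" for k
      using sl by (simp_all add: strict_mono_less)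
    then show "w k \<in> span (x ` {l (2 * k)..<l (2 * Suc k)})" for k
      unfolding w_def v_def by (intro span_scale span_diff span_base imageI) (auto intro: less_trans less_imp_le)
    show "w k \<noteq> 0" for k using v0[of k] by (simp add: w_def)
  qed
  then have bw: "block_basis e w" by (rule block_basis_trans[OF x(1)])
  have nw: "normalized w" using v0 by (simp add: normalized_def w_def)
  have "(0::real) < 1 / 2" by simp
  from infinite_plus_set[OF bw nw this] obtain J where
    J: "infinite J" "\<And>A. finite A \<Longrightarrow> A \<subseteq> J \<Longrightarrow> plus_set w (1 / 2) A" by blast
  have "\<exists>f. contraction f \<and> (\<forall>i\<in>J \<inter> {..<n}. 1 / 2 \<le> f (w i))" for n
    using J(2)[of "J \<inter> {..<n}"] by (simp add: plus_set_def)
  then obtain f where f: "\<And>n. contraction (f n)" "\<And>n i. i \<in> J \<Longrightarrow> i < n \<Longrightarrow> 1 / 2 \<le> f n (w i)"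
    by (metis IntI lessThan_iff)
  have f1: "\<bar>f n (x i)\<bar> \<le> 1" for n i
    using f(1)[of n] x(2) by (metis contraction_def normalized_def)
  \<comment> \<open>The functionals vary with the finite set they serve. A pointwise limit fixes one
    value per index, as the pigeonhole argument needs.\<close>
  obtain r where r: "strict_mono (r :: nat \<Rightarrow> nat)" "\<And>i. i \<in> UNIV \<Longrightarrow> \<exists>l. (\<lambda>t. f (r t) (x i)) \<longlonglongrightarrow> l"
    using function_convergent_subsequence[of "UNIV :: nat set" "\<lambda>t i. f t (x i)" 1] f1 by auto
  then have "\<forall>i. \<exists>l. (\<lambda>t. f (r t) (x i)) \<longlonglongrightarrow> l" by simp
  from choice[OF this] obtain \<alpha> where \<alpha>: "\<And>i. (\<lambda>t. f (r t) (x i)) \<longlonglongrightarrow> \<alpha> i" by blast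
  have \<alpha>1: "\<bar>\<alpha> i\<bar> \<le> 1" for i
  proof (rule tendsto_upperbound)
    show "(\<lambda>t. \<bar>f (r t) (x i)\<bar>) \<longlonglongrightarrow> \<bar>\<alpha> i\<bar>" by (intro tendsto_intros \<alpha>)
  qed (use f1 in auto)
  have gap: "3 * \<gamma> \<le> \<alpha> (l (2 * i)) - \<alpha> (l (Suc (2 * i)))" if i: "i \<in> J" for i
  proof (rule tendsto_lowerbound)
    show "(\<lambda>t. f (r t) (x (l (2 * i))) - f (r t) (x (l (Suc (2 * i))))) \<longlonglongrightarrow>
        \<alpha> (l (2 * i)) - \<alpha> (l (Suc (2 * i)))" by (intro tendsto_intros \<alpha>)
    show "\<forall>\<^sub>F t in sequentially. 3 * \<gamma> \<le> f (r t) (x (l (2 * i))) - f (r t) (x (l (Suc (2 * i))))"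
      using eventually_gt_at_top[of i]
    proof eventually_elim
      case (elim t)
      have "i < r t" using elim seq_suble[OF r(1), of t] by simp
      then have h: "1 / 2 \<le> f (r t) (w i)" by (rule f(2)[OF i])
      have lin: "linear (f (r t))" using f(1) by (simp add: contraction_def)
      have "f (r t) (w i) = (f (r t) (x (l (2 * i))) - f (r t) (x (l (Suc (2 * i))))) / norm (v i)"
        by (simp add: w_def v_def linear_scale[OF lin] linear_diff[OF lin])
      then have "norm (v i) / 2 \<le> f (r t) (x (l (2 * i))) - f (r t) (x (l (Suc (2 * i))))"
        using h v0[of i] by (simp add: field_simps)
      then show ?case using dv[of i] by (simp add: \<gamma>_def)
    qed
  qed simp
  define m where "m = (\<lambda>i. \<lceil>\<alpha> (l (Suc (2 * i))) / \<gamma>\<rceil>)"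
  define I where "I = {- \<lceil>1 / \<gamma>\<rceil>..\<lceil>1 / \<gamma>\<rceil>}"
  have mI: "m i \<in> I" for i
  proof -
    have "- (1 / \<gamma>) \<le> \<alpha> (l (Suc (2 * i))) / \<gamma>" "\<alpha> (l (Suc (2 * i))) / \<gamma> \<le> 1 / \<gamma>"
      using \<alpha>1[of "l (Suc (2 * i))"] \<gamma> by (auto simp: field_simps abs_le_iff)
    then show ?thesis unfolding m_def I_def atLeastAtMost_iff by (intro conjI; linarith)
  qed
  have "finite (m ` J)" using mI by (rule_tac finite_subset[of _ I]) (auto simp: I_def)
  from pigeonhole_infinite[OF J(1) this] obtain i0 where "i0 \<in> J" "infinite {i \<in> J. m i = m i0}" by blast
  define J' where "J' = {i \<in> J. m i = m i0}"
  define M where "M = m i0"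
  have J': "infinite J'" "J' \<subseteq> J" "\<And>i. i \<in> J' \<Longrightarrow> m i = M"
    using \<open>infinite {i \<in> J. m i = m i0}\<close> by (auto simp: J'_def M_def)
  define hi where "hi = (\<lambda>i. l (2 * i))"
  define lo where "lo = (\<lambda>i. l (Suc (2 * i)))"
  define L' where "L' = hi ` J' \<union> lo ` J'"
  have inj: "inj hi" "inj lo" using sl by (auto simp: hi_def lo_def inj_def strict_mono_eq)
  have L'L: "L' \<subseteq> L" using lL by (auto simp: L'_def hi_def lo_def)
  have L'inf: "infinite L'" using J'(1) inj(1) by (auto simp: L'_def finite_image_iff inj_on_subset)
  have ord: "hi i < hi j \<longleftrightarrow> i < j" "lo i < hi j \<longleftrightarrow> i < j" "hi i < lo j \<longleftrightarrow> i \<le> j" "lo i < lo j \<longleftrightarrow> i < j"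
    "hi i \<noteq> lo j" for i j
    using sl by (auto simp: hi_def lo_def strict_mono_less strict_mono_eq) presburger+
  have val: "\<alpha> (lo i) \<le> real_of_int M * \<gamma>" "(real_of_int M + 2) * \<gamma> \<le> \<alpha> (hi i)" if i: "i \<in> J'" for i
  proof -
    have mi: "M = \<lceil>\<alpha> (lo i) / \<gamma>\<rceil>" using J'(3)[OF i] by (simp add: m_def lo_def)
    have "\<alpha> (lo i) / \<gamma> \<le> real_of_int M" "real_of_int M < \<alpha> (lo i) / \<gamma> + 1" unfolding mi by linarith+
    then have a: "\<alpha> (lo i) \<le> real_of_int M * \<gamma>" "real_of_int M * \<gamma> < \<alpha> (lo i) + \<gamma>"
      using \<gamma> by (simp_all add: field_simps)
    then show "\<alpha> (lo i) \<le> real_of_int M * \<gamma>" by simp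
    show "(real_of_int M + 2) * \<gamma> \<le> \<alpha> (hi i)"
      using a gap[of i] i J'(2) unfolding hi_def lo_def by (auto simp: algebra_simps)
  qed
  \<comment> \<open>Only complete pairs lie below \<open>hi i\<close>; below \<open>lo i\<close>
    there is one more point, its partner \<open>hi i\<close>.\<close>
  have card_hi: "even (card {j \<in> L'. j < hi i})" for i
  proof -
    have "{j \<in> L'. j < hi i} = hi ` {k \<in> J'. k < i} \<union> lo ` {k \<in> J'. k < i}"
      using ord by (auto simp: L'_def)
    moreover have "card (hi ` {k \<in> J'. k < i} \<union> lo ` {k \<in> J'. k < i}) = 2 * card {k \<in> J'. k < i}"
      using ord(5) inj by (subst card_Un_disjoint) (auto simp: card_image inj_on_subset)
    ultimately show ?thesis by simp
  qed
  have card_lo: "odd (card {j \<in> L'. j < lo i})" if i: "i \<in> J'" for i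
  proof -
    have "{j \<in> L'. j < lo i} = insert (hi i) {j \<in> L'. j < hi i}"
      using ord i by (auto simp: L'_def le_less)
    moreover have "finite {j \<in> L'. j < hi i}" by simp
    ultimately show ?thesis using card_hi[of i] by simp
  qed
  have "separates x ((real_of_int M + 1/2) * \<gamma>) ((real_of_int M + 3/2) * \<gamma>) (L' \<inter> {..<n})" for n
  proof -
    have "\<forall>\<^sub>F t in sequentially. \<forall>i\<in>{..<n}. \<bar>f (r t) (x i) - \<alpha> i\<bar> < \<gamma> / 2"
    proof (rule eventually_ball_finite)
      show "\<forall>i\<in>{..<n}. \<forall>\<^sub>F t in sequentially. \<bar>f (r t) (x i) - \<alpha> i\<bar> < \<gamma> / 2"
        using tendstoD[OF \<alpha>, of "\<gamma> / 2"] \<gamma> by (simp add: dist_real_def)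
    qed simp
    then obtain t where t: "\<And>i. i < n \<Longrightarrow> \<bar>f (r t) (x i) - \<alpha> i\<bar> < \<gamma> / 2"
      by (auto simp: eventually_sequentially)
    show ?thesis
      unfolding separates_def
    proof (intro exI[of _ "f (r t)"] conjI ballI f(1))
      fix k assume k: "k \<in> L' \<inter> {..<n}"
      then have kn: "k < n" by simp
      \<comment> \<open>A point has the same position in an initial segment as in \<open>L'\<close>;
        this is why \<open>separates\<close> fits the dichotomy.\<close>
      have "{j \<in> L' \<inter> {..<n}. j < k} = {j \<in> L'. j < k}" using k by auto
      moreover from k consider i where "i \<in> J'" "k = hi i" | i where "i \<in> J'" "k = lo i" by (auto simp: L'_def)
      then have "if even (card {j \<in> L'. j < k}) then (real_of_int M + 3/2) * \<gamma> \<le> f (r t) (x k)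
          else f (r t) (x k) \<le> (real_of_int M + 1/2) * \<gamma>"
      proof cases
        case 1
        have "(real_of_int M + 2) * \<gamma> = (real_of_int M + 3/2) * \<gamma> + \<gamma> / 2" by (simp add: algebra_simps)
        then have "(real_of_int M + 3/2) * \<gamma> \<le> f (r t) (x k)"
          using val(2)[OF 1(1)] t[OF kn] unfolding 1(2)[symmetric] by linarith
        then show ?thesis using card_hi[of i] 1(2) by simp
      next
        case 2
        have "(real_of_int M + 1/2) * \<gamma> = real_of_int M * \<gamma> + \<gamma> / 2" by (simp add: algebra_simps)
        then have "f (r t) (x k) \<le> (real_of_int M + 1/2) * \<gamma>"
          using val(1)[OF 2(1)] t[OF kn] unfolding 2(2)[symmetric] by linarith
        then show ?thesis using card_lo[OF 2(1)] 2(2) by simp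
      qed
      ultimately show "if even (card {j \<in> L' \<inter> {..<n}. j < k}) then (real_of_int M + 3/2) * \<gamma> \<le> f (r t) (x k)
          else f (r t) (x k) \<le> (real_of_int M + 1/2) * \<gamma>" by simp
    qed
  qed
  then show ?thesis using mI[of i0] L'L L'inf unfolding I_def M_def by blast
qed

theorem contains_ell1:
  assumes "\<And>i. e i \<noteq> 0"
  shows "\<exists>Y :: 'a set. subspace Y \<and> closed Y \<and> isomorphic_to ell1 ell1_norm Y"
proof -
  define x where "x = (\<lambda>i. (1 / norm (e i)) *\<^sub>R e i)"
  have bx: "block_basis e x"
    by (rule block_basisI[where p = "\<lambda>i. i"]) (use assms in \<open>auto simp: x_def intro: span_scale span_base\<close>)
  have nx: "normalized x" using assms by (simp add: normalized_def x_def)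
  have Kx: "bounded_projections K x" by (rule bounded_projections_block[OF K bx])
  have K1: "1 \<le> K" by (rule bounded_projections_nonneg[OF Kx block_basis_nonzero[OF bx]])
  \<comment> \<open>A normalized basic sequence is separated, since a coefficient is at most
    \<open>2 * K\<close> times the norm.\<close>
  define d where "d = 1 / (2 * K)"
  have d: "0 < d" using K1 by (simp add: d_def)
  have far: "d \<le> norm (x i - x j)" if ij: "i < j" for i j
  proof -
    define a where "a = (\<lambda>k. if k = i then 1 else if k = j then -1 else 0 :: real)"
    have "(\<Sum>k<Suc j. a k *\<^sub>R x k) = (\<Sum>k\<in>{i, j}. a k *\<^sub>R x k)"
      by (rule sum.mono_neutral_right) (use ij in \<open>auto simp: a_def\<close>)
    also have "\<dots> = x i - x j" using ij by (simp add: a_def)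
    finally have s: "(\<Sum>k<Suc j. a k *\<^sub>R x k) = x i - x j" .
    have "\<bar>a i\<bar> * norm (x i) \<le> 2 * K * norm (x i - x j)"
      using bounded_projections_coeff[OF Kx, of i "Suc j" a] ij K1 unfolding s by simp
    then show ?thesis using nx K1 by (simp add: a_def normalized_def d_def field_simps)
  qed
  define \<gamma> where "\<gamma> = d / 6"
  have \<gamma>: "0 < \<gamma>" using d by (simp add: \<gamma>_def)
  define I where "I = {- \<lceil>1 / \<gamma>\<rceil>..\<lceil>1 / \<gamma>\<rceil>}"
  define sep where "sep = (\<lambda>m::int. separates x ((real_of_int m + 1/2) * \<gamma>) ((real_of_int m + 3/2) * \<gamma>))"
  obtain N where N: "infinite N" "(\<exists>m\<in>I. \<forall>s\<subseteq>N. finite s \<longrightarrow> s \<notin> {F. \<not> sep m F}) \<or>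
    (\<forall>m\<in>I. \<forall>L\<subseteq>N. infinite L \<longrightarrow> (\<exists>n. L \<inter> {..<n} \<in> {F. \<not> sep m F}))"
    using dichotomy_finite[of I "\<lambda>m. {F. \<not> sep m F}"] unfolding I_def by blast
  \<comment> \<open>Inside \<open>N\<close> some infinite set has all its initial segments separated
    for one of the intervals, which rules out the second alternative.\<close>
  have "\<not> (\<forall>m\<in>I. \<forall>L\<subseteq>N. infinite L \<longrightarrow> (\<exists>n. L \<inter> {..<n} \<in> {F. \<not> sep m F}))"
    using ex_separated_subset[OF bx nx N(1) d far] unfolding I_def sep_def \<gamma>_def by blast
  then obtain m where m: "\<And>s. s \<subseteq> N \<Longrightarrow> finite s \<Longrightarrow> sep m s" using N(2) by blast
  define \<nu> where "\<nu> = enumerate N"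
  have \<nu>: "strict_mono \<nu>" unfolding \<nu>_def by (rule strict_mono_enumerate[OF N(1)])
  have "range \<nu> \<subseteq> N" unfolding \<nu>_def using enumerate_in_set[OF N(1)] by blast
  then have s: "separates x ((real_of_int m + 1/2) * \<gamma>) ((real_of_int m + 3/2) * \<gamma>) F"
    if "finite F" "F \<subseteq> range \<nu>" for F
    using m[of F] that unfolding sep_def by blast
  show ?thesis
  proof (rule ell1_subspace[where u = "\<lambda>i. x (\<nu> (Suc (2 * i)))" and c = "\<gamma> / 2"])
    fix a :: "nat \<Rightarrow> real" and n
    have "((real_of_int m + 3/2) * \<gamma> - (real_of_int m + 1/2) * \<gamma>) / 2 = \<gamma> / 2" by (simp add: algebra_simps)
    note eq = this
    show "\<gamma> / 2 * (\<Sum>i<n. \<bar>a i\<bar>) \<le> norm (\<Sum>i<n. a i *\<^sub>R x (\<nu> (Suc (2 * i))))"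
      using separated_lower_bound[OF s \<nu>, where n = n and a = a] unfolding eq .
  qed (use nx \<gamma> in \<open>auto simp: normalized_def\<close>)
qed

end

subsection \<open>Part (b)\<close>

text \<open>In a directed graph with out-degrees at most \<open>d\<close>, double counting gives a
  vertex of in-degree at most \<open>d\<close>. It is selected and deleted together with its at most
  \<open>2 * d\<close> neighbours; this is repeated \<open>n\<close> times.\<close>

lemma ex_independent:
  assumes "finite V" "\<And>v. v \<in> V \<Longrightarrow> card {w \<in> V. R v w} \<le> d" "n * (2 * d + 1) \<le> card V"
  shows "\<exists>I\<subseteq>V. card I = n \<and> (\<forall>v\<in>I. \<forall>w\<in>I. v \<noteq> w \<longrightarrow> \<not> R v w)"
  using assms
proof (induction n arbitrary: V)
  case 0 then show ?case by (intro exI[of _ "{}"]) simp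
next
  case (Suc n)
  have "\<exists>v\<in>V. card {w \<in> V. R w v} \<le> d"
  proof (rule ccontr)
    assume "\<not> ?thesis"
    then have big: "\<And>v. v \<in> V \<Longrightarrow> Suc d \<le> card {w \<in> V. R w v}" by force
    have "card V * Suc d \<le> (\<Sum>v\<in>V. card {w \<in> V. R w v})"
      using sum_bounded_below[of V "Suc d" "\<lambda>v. card {w \<in> V. R w v}"] big by simp
    also have "\<dots> = (\<Sum>v\<in>V. card {w \<in> V. R v w})"
      by (rule sum_multicount_gen[OF Suc.prems(1,1), symmetric]) simp
    also have "\<dots> \<le> card V * d"
      using sum_bounded_above[of V "\<lambda>v. card {w \<in> V. R v w}" d] Suc.prems(2) by simp
    finally have "card V = 0" by simp
    then show False using Suc.prems(3) by simp
  qed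
  then obtain v where v: "v \<in> V" "card {w \<in> V. R w v} \<le> d" by blast
  define D where "D = insert v ({w \<in> V. R w v} \<union> {w \<in> V. R v w})"
  have "card D \<le> Suc (card ({w \<in> V. R w v} \<union> {w \<in> V. R v w}))"
    unfolding D_def using Suc.prems(1) by (simp add: card_insert_if)
  also have "\<dots> \<le> Suc (card {w \<in> V. R w v} + card {w \<in> V. R v w})"
    using card_Un_le by simp
  finally have cD: "card D \<le> 2 * d + 1" using v Suc.prems(2)[OF v(1)] by simp
  have DV: "D \<subseteq> V" using v(1) by (auto simp: D_def)
  then have "card (V - D) = card V - card D" using Suc.prems(1) by (simp add: card_Diff_subset finite_subset)
  then have "n * (2 * d + 1) \<le> card (V - D)" using cD Suc.prems(3) by simp
  moreover have "card {w \<in> V - D. R u w} \<le> d" if "u \<in> V - D" for u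
  proof -
    have "card {w \<in> V - D. R u w} \<le> card {w \<in> V. R u w}" using Suc.prems(1) by (intro card_mono) auto
    then show ?thesis using Suc.prems(2)[of u] that by simp
  qed
  ultimately obtain I where I: "I \<subseteq> V - D" "card I = n" "\<forall>v\<in>I. \<forall>w\<in>I. v \<noteq> w \<longrightarrow> \<not> R v w"
    using Suc.IH[of "V - D"] Suc.prems(1) by auto
  have "finite I" using I(1) Suc.prems(1) finite_subset by blast
  then have "card (insert v I) = Suc n" using I(1,2) by (auto simp: D_def card_insert_if)
  moreover have "insert v I \<subseteq> V" using I(1) v(1) by blast
  moreover have "\<forall>x\<in>insert v I. \<forall>y\<in>insert v I. x \<noteq> y \<longrightarrow> \<not> R x y" using I by (auto simp: D_def)
  ultimately show ?case by blast
qed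

lemma span_finite_support:
  fixes e :: "nat \<Rightarrow> 'a::real_vector"
  assumes "x \<in> span (e ` S)"
  shows "\<exists>M. x \<in> span (e ` (S \<inter> {..<M}))"
  using assms
proof (induction rule: span_induct_alt)
  case base then show ?case by (auto intro: span_zero)
next
  case (step c v y)
  then obtain i M where i: "i \<in> S" "v = e i" and M: "y \<in> span (e ` (S \<inter> {..<M}))" by blast
  have "v \<in> span (e ` (S \<inter> {..<max M (Suc i)}))" using i by (intro span_base) auto
  moreover have "y \<in> span (e ` (S \<inter> {..<max M (Suc i)}))"
    using M span_mono[of "e ` (S \<inter> {..<M})" "e ` (S \<inter> {..<max M (Suc i)})"] by fastforce
  ultimately show ?case by (intro exI[of _ "max M (Suc i)"] span_add span_scale)
qed

definition small_sums :: "real \<Rightarrow> 'a::real_normed_vector set \<Rightarrow> bool" where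
  "small_sums \<epsilon> A \<longleftrightarrow> (\<forall>B\<subseteq>A. finite B \<longrightarrow> norm (\<Sum>x\<in>B. x) \<le> 1 + \<epsilon>)"

lemma hered_small_sums: "hered (small_sums \<epsilon>)"
  unfolding hered_def
proof (intro allI impI)
  fix A B :: "'a set" assume "B \<subseteq> A" "small_sums \<epsilon> A"
  then show "small_sums \<epsilon> B" unfolding small_sums_def by blast
qed

lemma small_sums_mono:
  assumes "small_sums \<epsilon> A" "\<epsilon> \<le> \<delta>" shows "small_sums \<delta> A"
  unfolding small_sums_def
proof (intro allI impI)
  fix B assume "B \<subseteq> A" "finite B"
  then have "norm (\<Sum>x\<in>B. x) \<le> 1 + \<epsilon>" using assms(1) unfolding small_sums_def by blast
  then show "norm (\<Sum>x\<in>B. x) \<le> 1 + \<delta>" using assms(2) by linarith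
qed

definition tail_units :: "(nat \<Rightarrow> 'a::real_normed_vector) \<Rightarrow> nat \<Rightarrow> 'a set" where
  "tail_units e N = {x. norm x = 1 \<and> x \<in> span (e ` {N..})}"

definition tail_filter :: "(nat \<Rightarrow> 'a::real_normed_vector) \<Rightarrow> 'a filter" where
  "tail_filter e = (INF N. principal (tail_units e N))"

lemma tail_units_antimono: "M \<le> N \<Longrightarrow> tail_units e N \<subseteq> tail_units e M"
  unfolding tail_units_def using span_mono[of "e ` {N..}" "e ` {M..}"] by fastforce

lemma eventually_tail_filter:
  "eventually P (tail_filter e) \<longleftrightarrow> (\<exists>N. \<forall>x\<in>tail_units e N. P x)"
proof -
  have "eventually P (tail_filter e) \<longleftrightarrow> (\<exists>N\<in>UNIV. eventually P (principal (tail_units e N)))"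
    unfolding tail_filter_def
  proof (rule eventually_INF_base)
    fix M N :: nat
    show "\<exists>x\<in>UNIV. principal (tail_units e x) \<le> inf (principal (tail_units e M)) (principal (tail_units e N))"
      using tail_units_antimono[of M "max M N" e] tail_units_antimono[of N "max M N" e]
      by (intro bexI[of _ "max M N"]) auto
  qed simp
  then show ?thesis by (simp add: eventually_principal)
qed

lemma span_disjoint:
  assumes K: "bounded_projections K e" and e: "\<And>i. e i \<noteq> 0"
    and x: "x \<in> span (e ` {..<N})" "x \<in> span (e ` {N..})"
  shows "x = 0"
proof -
  have K1: "1 \<le> K" by (rule bounded_projections_nonneg[OF K e])
  obtain M where "x \<in> span (e ` ({N..} \<inter> {..<M}))" using span_finite_support[OF x(2)] by blast
  moreover have "span (e ` ({N..} \<inter> {..<M})) \<subseteq> span (e ` {N..<max N M})" by (intro span_mono image_mono) auto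
  ultimately have "x \<in> span (e ` {N..<max N M})" by blast
  then obtain b where b: "x = (\<Sum>i\<in>{N..<max N M}. b i *\<^sub>R e i)" using span_image_eq_sum[of "{N..<max N M}"] by blast
  obtain a where a: "x = (\<Sum>i<N. a i *\<^sub>R e i)" using span_image_eq_sum[OF _ x(1)] by blast
  define d where "d = (\<lambda>i. if i < N then a i else - b i)"
  have "(\<Sum>i<max N M. d i *\<^sub>R e i) = (\<Sum>i<N. d i *\<^sub>R e i) + (\<Sum>i\<in>{N..<max N M}. d i *\<^sub>R e i)"
    by (metis (no_types) atLeast0LessThan max.cobounded1 sum.atLeastLessThan_concat zero_le)
  also have "(\<Sum>i<N. d i *\<^sub>R e i) = x" unfolding a by (intro sum.cong) (auto simp: d_def)
  also have "(\<Sum>i\<in>{N..<max N M}. d i *\<^sub>R e i) = - x" unfolding b sum_negf[symmetric] by (intro sum.cong) (auto simp: d_def)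
  finally have z: "(\<Sum>i<max N M. d i *\<^sub>R e i) = 0" by simp
  have "d j = 0" if "j < N" for j
  proof -
    have "\<bar>d j\<bar> * norm (e j) \<le> 2 * K * norm (\<Sum>i<max N M. d i *\<^sub>R e i)"
      by (rule bounded_projections_coeff[OF K]) (use K1 that in auto)
    then show ?thesis unfolding z using e[of j] by (simp add: mult_le_0_iff)
  qed
  then have "a j = 0" if "j < N" for j using that by (auto simp: d_def dest: spec)
  then show ?thesis unfolding a by simp
qed

context pair_norm_one
begin

context
  assumes e0: "\<And>i. e i \<noteq> 0"
begin

lemma tail_disjoint: "x \<in> span (e ` {..<N}) \<Longrightarrow> x \<notin> tail_units e N"
  using span_disjoint[OF K e0, of x N] by (auto simp: tail_units_def)

lemma tail_filter_avoids: "\<forall>\<^sub>F y in tail_filter e. y \<noteq> x"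
proof (cases "x \<in> span (range e)")
  case True
  then obtain M where "x \<in> span (e ` (UNIV \<inter> {..<M}))" using span_finite_support[of x e UNIV] by blast
  then have "x \<notin> tail_units e M" using tail_disjoint by simp
  then show ?thesis unfolding eventually_tail_filter by blast
next
  case False
  have "y \<in> span (range e)" if "y \<in> tail_units e 0" for y
    using that span_mono[of "e ` {0..}" "range e"] by (auto simp: tail_units_def)
  then show ?thesis unfolding eventually_tail_filter using False by blast
qed

text \<open>Each piece is incompatible with each \<open>J\<close>, as witnessed by a functional.
  Subset sums of norm near 1 bound the total negative part of a functional over all pieces, so a
  witness is disturbed by few pieces. Among sufficiently many, one piece per \<open>J\<close> is
  selected such that no witness is disturbed by the other pieces. The normalized sum of the selected
  parts is then bad for all \<open>J\<close> at once.\<close>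

lemma ex_bad_unit:
  fixes l :: "'w::wellorder list"
  assumes l: "\<And>a. a \<in> set l \<Longrightarrow> \<exists>b. b < a"
    and P: "\<And>\<epsilon>. 0 < \<epsilon> \<Longrightarrow> foldr (rext (tail_filter e)) l (small_sums \<epsilon>) {}"
    and \<delta>: "0 < \<delta>" "\<delta> \<le> 1"
    and JJ: "finite JJ" "\<And>J. J \<in> JJ \<Longrightarrow> finite J" "\<And>J. J \<in> JJ \<Longrightarrow> J \<subseteq> span (e ` {..<N})"
      "\<And>J. J \<in> JJ \<Longrightarrow> \<not> foldr (rext (tail_filter e)) l (small_sums \<delta>) J"
  shows "\<exists>y\<in>tail_units e N. \<forall>J\<in>JJ. \<not> small_sums (\<delta> / 2) (insert y J)"
proof -
  let ?F = "tail_filter e"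
  let ?q = "foldr (rext ?F) l"
  define n where "n = card JJ"
  define \<eta> where "\<eta> = \<delta> / 8"
  have \<eta>: "0 < \<eta>" "\<eta> \<le> 1 / 8" using \<delta> by (simp_all add: \<eta>_def)
  \<comment> \<open>Total negative part at most 2 allows at most \<open>2 * n / \<eta>\<close>
    pieces with more than \<open>\<eta> / n\<close>, for each of the \<open>n\<close> sets
    \<open>J\<close>; \<open>m\<close> is the size that \<open>ex_independent\<close> needs for
    \<open>n\<close> independent pieces.\<close>
  define d where "d = n * nat \<lceil>2 * real n / \<eta>\<rceil>"
  define m where "m = n * (2 * d + 1)"
  have hB: "hered (\<lambda>B. small_sums \<delta> (J \<union> B))" for J :: "'a set" by (rule hered_shift[OF hered_small_sums])
  have n': "\<not> ?q (\<lambda>B. \<exists>J\<in>JJ. small_sums \<delta> (J \<union> B)) {}"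
  proof (rule distributes_finite[OF distributes_foldr transfers_foldr JJ(1) hB])
    show "\<not> ?q (\<lambda>B. small_sums \<delta> (J \<union> B)) {}" if "J \<in> JJ" for J
      using JJ(4)[OF that] transfers_shift[OF transfers_foldr, of ?F l "small_sums \<delta>" J] by simp
  qed (rule foldr_rext_False)
  have V: "\<forall>\<^sub>F x in ?F. x \<in> tail_units e N" unfolding eventually_tail_filter by blast
  have "?q (\<lambda>A. small_sums \<eta> A \<and> A \<subseteq> tail_units e N) {}"
    by (rule transfersD[OF transfers_foldr V P[OF \<eta>(1)]]) simp
  from pieces_foldr[OF tail_filter_avoids l hered_Union[OF hB] this n', of m]
  obtain C where C0: "(\<forall>r<m. finite (C r) \<and> \<not> (\<exists>J\<in>JJ. small_sums \<delta> (J \<union> C r))) \<and>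
      disjoint_family_on C {..<m} \<and> small_sums \<eta> ({} \<union> (\<Union>r<m. C r)) \<and> {} \<union> (\<Union>r<m. C r) \<subseteq> tail_units e N"
    by (rule exE)
  then have C: "\<And>r. r < m \<Longrightarrow> finite (C r)" "disjoint_family_on C {..<m}"
      "small_sums \<eta> (\<Union>r<m. C r)" "(\<Union>r<m. C r) \<subseteq> tail_units e N" by auto
  have Cbad: "\<not> small_sums \<delta> (J \<union> C r)" if "J \<in> JJ" "r < m" for J r using C0 that by blast
  have "\<exists>P B f. contraction f \<and> finite P \<and> P \<subseteq> J \<and> finite B \<and> B \<subseteq> C r \<and> 1 + \<delta> < f (\<Sum>P) + f (\<Sum>B)"
    if Jr: "J \<in> JJ" "r < m" for J r
  proof -
    obtain S where S: "S \<subseteq> J \<union> C r" "finite S" "1 + \<delta> < norm (\<Sum>S)"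
      using Cbad[OF Jr] by (auto simp: small_sums_def not_le)
    obtain f where f: "contraction f" "f (\<Sum>S) = norm (\<Sum>S)" using ex_norming by blast
    have "\<Sum>S = \<Sum>(S \<inter> J) + \<Sum>(S - J)" using sum.Int_Diff[OF S(2), of "\<lambda>x. x" J] .
    then have "1 + \<delta> < f (\<Sum>(S \<inter> J)) + f (\<Sum>(S - J))"
      using S(3) f by (simp add: contraction_def linear_add)
    then show ?thesis using f(1) S(1,2)
      by (intro exI[of _ "S \<inter> J"] exI[of _ "S - J"] exI[of _ f]) auto
  qed
  then obtain P B f where PBf: "\<And>J r. J \<in> JJ \<Longrightarrow> r < m \<Longrightarrow> contraction (f J r) \<and> finite (P J r) \<and> P J r \<subseteq> J \<and>
      finite (B J r) \<and> B J r \<subseteq> C r \<and> 1 + \<delta> < f J r (\<Sum>(P J r)) + f J r (\<Sum>(B J r))" by metis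
  \<comment> \<open>The most by which a subset sum within the piece can lower the value of
    \<open>g\<close>.\<close>
  define neg :: "('a \<Rightarrow> real) \<Rightarrow> nat \<Rightarrow> real" where "neg = (\<lambda>g r. \<Sum>x\<in>C r. max 0 (- g x))"
  have neg0: "0 \<le> neg g r" for g r by (simp add: neg_def sum_nonneg)
  have fU: "finite (\<Union>r<m. C r)" using C(1) by auto
  have neg_sum: "(\<Sum>r<m. neg g r) \<le> 2" if g: "contraction g" for g
  proof -
    \<comment> \<open>Collecting the points where \<open>g\<close> is negative turns the total
      negative part into \<open>- g\<close> of a single subset sum.\<close>
    define Z where "Z = {x \<in> (\<Union>r<m. C r). g x < 0}"
    have "(\<Sum>r<m. neg g r) = (\<Sum>x\<in>(\<Union>r<m. C r). max 0 (- g x))"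
      unfolding neg_def using C(1,2) by (subst sum.UNION_disjoint) (auto simp: disjoint_family_on_def)
    also have "\<dots> = (\<Sum>x\<in>Z. - g x)"
      unfolding Z_def using fU by (intro sum.mono_neutral_cong_right) (auto simp: max_def)
    also have "\<dots> = - g (\<Sum>Z)" using g by (simp add: contraction_def linear_sum sum_negf)
    also have "\<dots> \<le> norm (\<Sum>Z)" using g unfolding contraction_def by (metis abs_ge_minus_self order_trans)
    also have "\<dots> \<le> 1 + \<eta>"
    proof -
      have "Z \<subseteq> (\<Union>r<m. C r)" "finite Z" using fU by (auto simp: Z_def)
      then show ?thesis using C(3) unfolding small_sums_def by blast
    qed
    finally show ?thesis using \<eta>(2) by simp
  qed
  have "\<exists>I\<subseteq>{..<m}. card I = n \<and> (\<forall>r\<in>I. \<forall>r'\<in>I. r \<noteq> r' \<longrightarrow> \<not> (\<exists>J\<in>JJ. \<eta> / real n < neg (f J r) r'))"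
  proof (rule ex_independent[where d = d])
    fix r assume r: "r \<in> {..<m}"
    have one: "card {r' \<in> {..<m}. \<eta> / real n < neg (f J r) r'} \<le> nat \<lceil>2 * real n / \<eta>\<rceil>" if J: "J \<in> JJ" for J
    proof -
      have n0: "0 < real n" using J JJ(1) by (auto simp: n_def card_gt_0_iff)
      define S where "S = {r' \<in> {..<m}. \<eta> / real n < neg (f J r) r'}"
      have "real (card S) * (\<eta> / real n) \<le> (\<Sum>r'\<in>S. neg (f J r) r')"
        using sum_bounded_below[of S "\<eta> / real n" "neg (f J r)"] by (simp add: S_def less_imp_le)
      also have "\<dots> \<le> (\<Sum>r'<m. neg (f J r) r')"
        by (rule sum_mono2) (auto simp: S_def neg0)
      also have "\<dots> \<le> 2" using PBf[OF J, of r] r by (intro neg_sum) simp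
      finally have "real (card S) \<le> 2 * real n / \<eta>" using n0 \<eta>(1) by (simp add: field_simps)
      then show ?thesis unfolding S_def by linarith
    qed
    have "{w \<in> {..<m}. \<exists>J\<in>JJ. \<eta> / real n < neg (f J r) w} = (\<Union>J\<in>JJ. {r' \<in> {..<m}. \<eta> / real n < neg (f J r) r'})" by auto
    also have "card \<dots> \<le> (\<Sum>J\<in>JJ. card {r' \<in> {..<m}. \<eta> / real n < neg (f J r) r'})"
      by (rule card_UN_le[OF JJ(1)])
    also have "\<dots> \<le> d"
      using sum_bounded_above[of JJ "\<lambda>J. card {r' \<in> {..<m}. \<eta> / real n < neg (f J r) r'}" "nat \<lceil>2 * real n / \<eta>\<rceil>"] one
      by (simp add: d_def n_def)
    finally show "card {w \<in> {..<m}. \<exists>J\<in>JJ. \<eta> / real n < neg (f J r) w} \<le> d" .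
  qed (simp_all add: m_def)
  then obtain I where I: "I \<subseteq> {..<m}" "card I = n"
    and ind: "\<And>r r' J. r \<in> I \<Longrightarrow> r' \<in> I \<Longrightarrow> r \<noteq> r' \<Longrightarrow> J \<in> JJ \<Longrightarrow> neg (f J r) r' \<le> \<eta> / real n"
    by (auto simp: not_less)
  have "finite I" using I(1) finite_subset by blast
  then obtain \<rho> where \<rho>: "bij_betw \<rho> JJ I"
    using finite_same_card_bij[OF JJ(1)] I(2) n_def by metis
  have \<rho>I: "\<rho> J \<in> I" "\<rho> J < m" if "J \<in> JJ" for J using bij_betwE[OF \<rho>] that I(1) by auto
  have inj\<rho>: "\<rho> J \<noteq> \<rho> J'" if "J \<in> JJ" "J' \<in> JJ" "J \<noteq> J'" for J J'
    using bij_betw_imp_inj_on[OF \<rho>] that by (auto simp: inj_on_def)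
  define BB where "BB = (\<lambda>J. B J (\<rho> J))"
  have BB: "finite (BB J)" "BB J \<subseteq> C (\<rho> J)" if "J \<in> JJ" for J
    using PBf[OF that \<rho>I(2)[OF that]] by (simp_all add: BB_def)
  have BBdis: "BB J \<inter> BB J' = {}" if "J \<in> JJ" "J' \<in> JJ" "J \<noteq> J'" for J J'
  proof -
    have "C (\<rho> J) \<inter> C (\<rho> J') = {}"
      using C(2) inj\<rho>[OF that] \<rho>I that unfolding disjoint_family_on_def by blast
    then show ?thesis using BB that by blast
  qed
  define W where "W = (\<Union>J\<in>JJ. BB J)"
  define y where "y = \<Sum>W"
  have WC: "W \<subseteq> (\<Union>r<m. C r)" using BB \<rho>I by (fastforce simp: W_def)
  have fW: "finite W" using JJ(1) BB by (auto simp: W_def)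
  have y1: "norm y \<le> 1 + \<eta>" using C(3) WC fW unfolding small_sums_def y_def by blast
  have ysum: "y = (\<Sum>J\<in>JJ. \<Sum>(BB J))"
    unfolding y_def W_def using JJ(1) BB(1) BBdis by (subst sum.UNION_disjoint) auto
  have fy: "f J (\<rho> J) (\<Sum>(BB J)) - \<eta> \<le> f J (\<rho> J) y" if J: "J \<in> JJ" for J
  proof -
    let ?f = "f J (\<rho> J)"
    have cf: "contraction ?f" using PBf[OF J \<rho>I(2)[OF J]] by simp
    have lin: "linear ?f" using cf by (simp add: contraction_def)
    have n0: "0 < real n" using J JJ(1) by (auto simp: n_def card_gt_0_iff)
    have "- (\<eta> / real n) \<le> ?f (\<Sum>(BB J'))" if J': "J' \<in> JJ - {J}" for J'
    proof -
      have "- ?f (\<Sum>(BB J')) = (\<Sum>x\<in>BB J'. - ?f x)" by (simp add: linear_sum[OF lin] sum_negf)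
      also have "\<dots> \<le> (\<Sum>x\<in>BB J'. max 0 (- ?f x))" by (intro sum_mono) simp
      also have "\<dots> \<le> neg ?f (\<rho> J')"
        unfolding neg_def using BB[of J'] J' C(1) \<rho>I by (intro sum_mono2) auto
      also have "\<dots> \<le> \<eta> / real n" using J J' inj\<rho> \<rho>I by (intro ind) auto
      finally show ?thesis by simp
    qed
    then have "real (card (JJ - {J})) * - (\<eta> / real n) \<le> (\<Sum>J'\<in>JJ - {J}. ?f (\<Sum>(BB J')))"
      by (intro sum_bounded_below) auto
    moreover have "- \<eta> \<le> real (card (JJ - {J})) * - (\<eta> / real n)"
    proof -
      have "real (card (JJ - {J})) \<le> real n" using JJ(1) by (simp add: n_def card_Diff1_le)
      from mult_right_mono[OF this, of "\<eta> / real n"] show ?thesis using n0 \<eta>(1) by simp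
    qed
    moreover have "?f y = ?f (\<Sum>(BB J)) + (\<Sum>J'\<in>JJ - {J}. ?f (\<Sum>(BB J')))"
      unfolding ysum linear_sum[OF lin, of _ JJ] by (rule sum.remove[OF JJ(1) J])
    ultimately show ?thesis by linarith
  qed
  \<comment> \<open>Some unit is needed also for \<open>y = 0\<close>, for instance when
    \<open>JJ\<close> is empty. Once a \<open>J\<close> is assumed compatible with \<open>u\<close>,
    \<open>y\<close> turns out to be nonzero.\<close>
  define u where "u = (if y = 0 then (1 / norm (e N)) *\<^sub>R e N else (1 / norm y) *\<^sub>R y)"
  have ysp: "y \<in> span (e ` {N..})"
    unfolding y_def using WC C(4) by (intro span_sum) (auto simp: tail_units_def)
  have u: "u \<in> tail_units e N"
    using ysp e0[of N] by (auto simp: u_def tail_units_def intro: span_scale span_base)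
  have "\<not> small_sums (\<delta> / 2) (insert u J)" if J: "J \<in> JJ" for J
  proof
    assume ss: "small_sums (\<delta> / 2) (insert u J)"
    let ?f = "f J (\<rho> J)" and ?P = "P J (\<rho> J)"
    have p: "contraction ?f" "finite ?P" "?P \<subseteq> J" "1 + \<delta> < ?f (\<Sum>?P) + ?f (\<Sum>(BB J))"
      using PBf[OF J \<rho>I(2)[OF J]] by (simp_all add: BB_def)
    have "u \<notin> J" using u JJ(3)[OF J] tail_disjoint by blast
    then have uP: "u \<notin> ?P" using p(3) by blast
    have "?f (\<Sum>?P) \<le> norm (\<Sum>?P)" by (rule contraction_le[OF p(1)])
    also have "\<dots> \<le> 1 + \<delta> / 2" using ss p(2,3) unfolding small_sums_def by blast
    finally have fP: "?f (\<Sum>?P) \<le> 1 + \<delta> / 2" .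
    then have fypos: "0 < ?f y" using p(4) fy[OF J] \<delta>(1) by (simp add: \<eta>_def)
    have lin: "linear ?f" using p(1) by (simp add: contraction_def)
    have y0: "y \<noteq> 0" using fypos linear_0[OF lin] by auto
    have fu: "?f u = ?f y / norm y" using y0 by (simp add: u_def linear_scale[OF lin])
    \<comment> \<open>Normalizing does not lower the positive value \<open>?f y\<close> if
      \<open>norm y \<le> 1\<close>; otherwise it lowers it by at most \<open>norm y - 1\<close>,
      hence by at most \<eta>.\<close>
    have "?f y - \<eta> \<le> ?f u"
    proof (cases "norm y \<le> 1")
      case True
      then have "?f y \<le> ?f y / norm y" using fypos y0 by (simp add: field_simps)
      then show ?thesis using fu \<eta>(1) by simp
    next
      case False
      have "?f y \<le> norm y" by (rule contraction_le[OF p(1)])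
      then have "?f y / norm y * (norm y - 1) \<le> 1 * (norm y - 1)"
        using False y0 by (intro mult_right_mono) (auto simp: field_simps)
      moreover have "?f y / norm y * (norm y - 1) = ?f y - ?f y / norm y" using y0 by (simp add: field_simps)
      ultimately show ?thesis using fu y1 by simp
    qed
    moreover have "?f (\<Sum>?P) + ?f u \<le> 1 + \<delta> / 2"
    proof -
      have "?f (\<Sum>?P) + ?f u = ?f (\<Sum>(insert u ?P))"
        using uP p(2) by (simp add: linear_add[OF lin])
      also have "\<dots> \<le> norm (\<Sum>(insert u ?P))" by (rule contraction_le[OF p(1)])
      also have "\<dots> \<le> 1 + \<delta> / 2"
        using ss p(2,3) unfolding small_sums_def by (metis finite_insert insert_mono)
      finally show ?thesis .
    qed
    \<comment> \<open>Losing \<eta> to the other parts and \<eta> to the normalization leaves more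
      than \<open>1 + \<delta> - \<delta> / 4\<close>, which exceeds
      \<open>1 + \<delta> / 2\<close>.\<close>
    ultimately show False using p(4) fy[OF J] \<delta>(1) by (simp add: \<eta>_def)
  qed
  then show ?thesis using u by blast
qed

end

end

context pair_norm_one
begin

context
  assumes e0: "\<And>i. e i \<noteq> 0"
begin

lemma tail_units_block:
  fixes y :: "nat \<Rightarrow> 'a" and N :: "nat \<Rightarrow> nat"
  assumes "\<And>k. y k \<in> tail_units e (N k)" "\<And>k. y k \<in> span (e ` {N k..<N (Suc k)})"
  shows "block_basis e y" "normalized y" "inj y"
proof -
  have n: "norm (y k) = 1" for k using assms(1)[of k] by (simp add: tail_units_def)
  show "normalized y" using n by (simp add: normalized_def)
  have "y k \<noteq> 0" for k using n[of k] by auto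
  then show "block_basis e y" using assms(2) by (intro block_basisI[where p = N]) auto
  have "N k < N (Suc k)" for k using assms(2)[of k] n[of k] by (cases "N k < N (Suc k)") auto
  then have sm: "strict_mono N" by (simp add: strict_mono_Suc_iff)
  have "y j \<noteq> y k" if "j < k" for j k
  proof -
    have "N (Suc j) \<le> N k" using that sm by (simp add: strict_mono_less_eq)
    then have "span (e ` {N j..<N (Suc j)}) \<subseteq> span (e ` {..<N k})" by (intro span_mono image_mono) auto
    then have "y j \<notin> tail_units e (N k)" using assms(2)[of j] tail_disjoint[OF e0] by blast
    then show ?thesis using assms(1)[of k] by auto
  qed
  then show "inj y" unfolding inj_def by (metis linorder_neqE_nat)
qed

lemma tail_units_support:
  assumes "y \<in> tail_units e N"
  obtains M where "N < M" "y \<in> span (e ` {N..<M})"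
proof -
  obtain M where "y \<in> span (e ` ({N..} \<inter> {..<M}))"
    using span_finite_support assms unfolding tail_units_def by blast
  moreover have "span (e ` ({N..} \<inter> {..<M})) \<subseteq> span (e ` {N..<max M (Suc N)})" by (intro span_mono image_mono) auto
  ultimately show thesis using that[of "max M (Suc N)"] by auto
qed

text \<open>All \<open>k\<close> root steps are handled together, since \<open>pieces_foldr\<close>
  admits only nonminimal exponents in \<open>l\<close>. If they fail, vectors are chosen
  successively, each incompatible with all \<open>k\<close>-subsets of its predecessors, against
  \<open>small_subset_sums\<close> for \<open>k + 1\<close> vectors.\<close>

lemma small_sums_step:
  fixes l :: "'w::wellorder list"
  assumes l: "\<And>a. a \<in> set l \<Longrightarrow> \<exists>b. b < a"
    and P: "\<And>\<epsilon>. 0 < \<epsilon> \<Longrightarrow> foldr (rext (tail_filter e)) l (small_sums \<epsilon>) {}"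
    and \<delta>: "0 < \<delta>" "\<delta> \<le> 1"
  shows "(extend (tail_filter e) ^^ k) (foldr (rext (tail_filter e)) l (small_sums \<delta>)) {}"
proof (rule ccontr)
  let ?F = "tail_filter e"
  define X where "X = foldr (rext ?F) l (small_sums \<delta>)"
  assume "\<not> ?thesis"
  then have n0: "\<not> (extend ?F ^^ k) X {}" by (simp add: X_def)
  \<comment> \<open>A set \<open>J\<close> has used up \<open>card J\<close> root steps, so the
    remaining ones must fail above it; for \<open>card J = k\<close> this says that \<open>J\<close>
    lacks the rank of \<open>l\<close>, the input of \<open>ex_bad_unit\<close>.\<close>
  define inv where "inv = (\<lambda>Y. \<forall>J\<subseteq>Y. card J \<le> k \<longrightarrow> \<not> (extend ?F ^^ (k - card J)) X J)"
  define S where "S = (\<lambda>(n::nat) (Y, N). finite Y \<and> Y \<subseteq> span (e ` {..<N}) \<and> inv Y)"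
  define R where "R = (\<lambda>(n::nat) (Y, N) (Y', N'). \<exists>y. Y' = insert y Y \<and> y \<in> tail_units e N \<and>
      y \<in> span (e ` {N..<N'}) \<and> (\<forall>J\<subseteq>Y. card J = k \<longrightarrow> \<not> small_sums (\<delta> / 2) (insert y J)))"
  have "\<exists>f. \<forall>n. S n (f n) \<and> R n (f n) (f (Suc n))"
  proof (rule dependent_nat_choice)
    have "inv {}" using n0 by (simp add: inv_def)
    then show "\<exists>x. S 0 x" by (intro exI[of _ "({}, 0)"]) (simp add: S_def)
    fix x n assume x: "S n x"
    obtain Y N where xe: "x = (Y, N)" by (cases x)
    have Y: "finite Y" "Y \<subseteq> span (e ` {..<N})" "inv Y" using x by (simp_all add: S_def xe)
    have "\<forall>\<^sub>F y in ?F. \<forall>J\<in>{J. J \<subseteq> Y \<and> card J < k}. \<not> (extend ?F ^^ (k - Suc (card J))) X (insert y J)"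
    proof (rule eventually_ball_finite)
      show "finite {J. J \<subseteq> Y \<and> card J < k}" using Y(1) by simp
      show "\<forall>J\<in>{J. J \<subseteq> Y \<and> card J < k}. \<forall>\<^sub>F y in ?F. \<not> (extend ?F ^^ (k - Suc (card J))) X (insert y J)"
      proof
        fix J assume J: "J \<in> {J. J \<subseteq> Y \<and> card J < k}"
        then have "\<not> (extend ?F ^^ (k - card J)) X J" using Y(3) by (auto simp: inv_def)
        moreover have "k - card J = Suc (k - Suc (card J))" using J by auto
        ultimately have "\<not> extend ?F ((extend ?F ^^ (k - Suc (card J))) X) J" by simp
        then show "\<forall>\<^sub>F y in ?F. \<not> (extend ?F ^^ (k - Suc (card J))) X (insert y J)"
          by (simp add: extend_def not_frequently)
      qed
    qed
    then obtain N1 where N1: "\<And>y J. y \<in> tail_units e N1 \<Longrightarrow> J \<subseteq> Y \<Longrightarrow> card J < k \<Longrightarrow>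
        \<not> (extend ?F ^^ (k - Suc (card J))) X (insert y J)"
      unfolding eventually_tail_filter by blast
    \<comment> \<open>Beyond \<open>N1\<close> the invariant survives the addition of any unit;
      beyond \<open>N\<close> the new vector is supported to the right of \<open>Y\<close>.\<close>
    define N2 where "N2 = max N N1"
    have "span (e ` {..<N}) \<subseteq> span (e ` {..<N2})" by (intro span_mono image_mono) (auto simp: N2_def)
    then have YN2: "Y \<subseteq> span (e ` {..<N2})" using Y(2) by blast
    have "\<exists>y\<in>tail_units e N2. \<forall>J\<in>{J. J \<subseteq> Y \<and> card J = k}. \<not> small_sums (\<delta> / 2) (insert y J)"
    proof (rule ex_bad_unit[OF e0 l P \<delta>])
      show "finite {J. J \<subseteq> Y \<and> card J = k}" using Y(1) by simp
      fix J assume J: "J \<in> {J. J \<subseteq> Y \<and> card J = k}"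
      show "finite J" using J Y(1) finite_subset by blast
      show "J \<subseteq> span (e ` {..<N2})" using J YN2 by blast
      have "\<not> (extend ?F ^^ (k - card J)) X J" using Y(3)[unfolded inv_def, rule_format, of J] J by simp
      then show "\<not> foldr (rext ?F) l (small_sums \<delta>) J" using J by (simp add: X_def)
    qed
    then obtain y where y: "y \<in> tail_units e N2" "\<And>J. J \<subseteq> Y \<Longrightarrow> card J = k \<Longrightarrow> \<not> small_sums (\<delta> / 2) (insert y J)"
      by blast
    have yN: "y \<in> tail_units e N" "y \<in> tail_units e N1"
      using y(1) tail_units_antimono[of N N2 e] tail_units_antimono[of N1 N2 e] by (auto simp: N2_def)
    obtain M where M: "N < M" "y \<in> span (e ` {N..<M})" by (rule tail_units_support[OF yN(1)])
    have sub: "span (e ` {N..<M}) \<subseteq> span (e ` {..<M})" "span (e ` {..<N}) \<subseteq> span (e ` {..<M})"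
      using M(1) by (intro span_mono image_mono; auto)+
    have "inv (insert y Y)"
      unfolding inv_def
    proof (intro allI impI)
      fix J assume J: "J \<subseteq> insert y Y" "card J \<le> k"
      show "\<not> (extend ?F ^^ (k - card J)) X J"
      proof (cases "y \<in> J")
        case True
        define J' where "J' = J - {y}"
        have fJ: "finite J" using J(1) Y(1) finite_subset by blast
        have J': "J' \<subseteq> Y" "J = insert y J'" using J(1) True by (auto simp: J'_def)
        have c: "card J = Suc (card J')" unfolding J'_def by (rule card.remove[OF fJ True])
        show ?thesis using N1[OF yN(2) J'(1)] c J(2) unfolding J'(2)[symmetric] by simp
      next
        case False
        then show ?thesis using J Y(3) by (auto simp: inv_def)
      qed
    qed
    then have "S (Suc n) (insert y Y, M)" using Y M sub by (auto simp: S_def)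
    moreover have "R n x (insert y Y, M)" using yN(1) M(2) y(2) by (auto simp: R_def xe)
    ultimately show "\<exists>z. S (Suc n) z \<and> R n x z" by blast
  qed
  then obtain f where f: "\<And>n. S n (f n)" "\<And>n. R n (f n) (f (Suc n))" by blast
  define Y where "Y = (\<lambda>n. fst (f n))"
  define N where "N = (\<lambda>n. snd (f n))"
  have fe: "f n = (Y n, N n)" for n by (simp add: Y_def N_def)
  have "\<exists>y. Y (Suc n) = insert y (Y n) \<and> y \<in> tail_units e (N n) \<and>
      y \<in> span (e ` {N n..<N (Suc n)}) \<and> (\<forall>J\<subseteq>Y n. card J = k \<longrightarrow> \<not> small_sums (\<delta> / 2) (insert y J))" for n
    using f(2)[of n] unfolding fe R_def by simp
  then have "\<forall>n. \<exists>y. Y (Suc n) = insert y (Y n) \<and> y \<in> tail_units e (N n) \<and>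
      y \<in> span (e ` {N n..<N (Suc n)}) \<and> (\<forall>J\<subseteq>Y n. card J = k \<longrightarrow> \<not> small_sums (\<delta> / 2) (insert y J))" by (rule allI)
  from choice[OF this] obtain y where y: "\<And>n. Y (Suc n) = insert (y n) (Y n)" "\<And>n. y n \<in> tail_units e (N n)"
      "\<And>n. y n \<in> span (e ` {N n..<N (Suc n)})"
      "\<And>n J. J \<subseteq> Y n \<Longrightarrow> card J = k \<Longrightarrow> \<not> small_sums (\<delta> / 2) (insert (y n) J)" by blast
  have yY: "y ` {..<n} \<subseteq> Y n" for n
  proof (induction n)
    case (Suc n) then show ?case by (auto simp: y(1) lessThan_Suc)
  qed simp
  note yb = tail_units_block[of y N, OF y(2,3)]
  have "0 < \<delta> / 2" using \<delta>(1) by simp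
  from small_subset_sums[OF yb(1,2) this] obtain A where A: "finite A" "card A = Suc k"
    and sums: "\<And>B. B \<subseteq> A \<Longrightarrow> norm (\<Sum>i\<in>B. y i) \<le> 1 + \<delta> / 2" by blast
  \<comment> \<open>The last vector of the good set \<open>A\<close> was chosen incompatible with
    any \<open>k\<close> of its predecessors, in particular with those in \<open>A\<close>.\<close>
  define n where "n = Max A"
  have nA: "n \<in> A" unfolding n_def using A by (intro Max_in) auto
  define J where "J = y ` (A - {n})"
  have "A - {n} \<subseteq> {..<n}"
  proof
    fix i assume "i \<in> A - {n}"
    then show "i \<in> {..<n}" using Max_ge[OF A(1), of i] by (auto simp: n_def)
  qed
  then have "J \<subseteq> Y n" using yY[of n] by (auto simp: J_def)
  moreover have "card J = k"
    unfolding J_def using A nA yb(3) by (subst card_image) (auto intro: inj_on_subset simp: card_Diff_singleton)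
  ultimately have "\<not> small_sums (\<delta> / 2) (insert (y n) J)" by (rule y(4))
  moreover have "small_sums (\<delta> / 2) (insert (y n) J)"
    unfolding small_sums_def
  proof (intro allI impI)
    fix B assume B: "B \<subseteq> insert (y n) J"
    have "insert (y n) J = y ` A" using nA by (auto simp: J_def)
    then obtain B' where B': "B' \<subseteq> A" "B = y ` B'" using B by (metis subset_imageE)
    have "(\<Sum>x\<in>B. x) = (\<Sum>i\<in>B'. y i)"
      unfolding B'(2) using yb(3) by (subst sum.reindex) (auto intro: inj_on_subset)
    then show "norm (\<Sum>x\<in>B. x) \<le> 1 + \<delta> / 2" using sums[OF B'(1)] by simp
  qed
  ultimately show False by blast
qed

lemma small_sums_all_ranks:
  fixes a :: "'w::wellorder"
  assumes a: "\<exists>b. b < a" and l: "\<And>a. a \<in> set l \<Longrightarrow> \<exists>b. b < a"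
    and P: "\<And>\<epsilon>. 0 < \<epsilon> \<Longrightarrow> foldr (rext (tail_filter e)) l (small_sums \<epsilon>) {}" and \<epsilon>: "0 < \<epsilon>"
  shows "foldr (rext (tail_filter e)) (a # l) (small_sums \<epsilon>) {}"
  using a l P \<epsilon>
proof (induction a arbitrary: l \<epsilon> rule: less_induct)
  case (less a)
  let ?F = "tail_filter e"
  have step: "(extend ?F ^^ k) (foldr (rext ?F) l (small_sums \<epsilon>)) {}" for k
  proof (rule transfers_mono[OF transfers_pow[OF transfers_extend]])
    show "(extend ?F ^^ k) (foldr (rext ?F) l (small_sums (min \<epsilon> 1))) {}"
      by (rule small_sums_step[OF less.prems(2,3)]) (use less.prems(4) in auto)
    fix B :: "'a set" assume "foldr (rext ?F) l (small_sums (min \<epsilon> 1)) ({} \<union> B)"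
    then show "foldr (rext ?F) l (small_sums \<epsilon>) ({} \<union> B)"
      by (rule transfers_mono[OF transfers_foldr]) (auto elim: small_sums_mono)
  qed
  have "(rext ?F b ^^ k) (foldr (rext ?F) l (small_sums \<epsilon>)) {}" if b: "b < a" for b k
  proof (cases "\<exists>c. c < b")
    case True
    have "\<And>\<epsilon>. 0 < \<epsilon> \<Longrightarrow> foldr (rext ?F) (replicate k b @ l) (small_sums \<epsilon>) {}"
    proof (induction k)
      case 0 then show ?case using less.prems(3) by simp
    next
      case (Suc k)
      have "\<And>c. c \<in> set (replicate k b @ l) \<Longrightarrow> \<exists>d. d < c" using True less.prems(2) by auto
      from less.IH[OF b True this Suc.IH Suc.prems]
      show ?case by simp
    qed
    from this[OF less.prems(4)] show ?thesis by (simp add: foldr_replicate)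
  next
    \<comment> \<open>For minimal \<open>b\<close> the iterates are plain \<open>extend\<close>
      steps, available for every \<open>k\<close>; such \<open>b\<close> never enters the
      list.\<close>
    case False
    then have "rext ?F b = extend ?F" unfolding rext.simps[of ?F b] by auto
    then show ?thesis using step by simp
  qed
  moreover have "extend ?F (foldr (rext ?F) l (small_sums \<epsilon>)) {}" using step[of 1] by simp
  ultimately show ?case by (simp add: rext.simps[of ?F a])
qed

text \<open>Tolerance 1 is enough: along a branch all subset sums have norm at most 2. Splitting by
  the sign of a norming functional bounds a combination by 4 times its largest coefficient, and the
  basis constant gives the lower estimate.\<close>

theorem contains_c0: "\<exists>Y :: 'a set. subspace Y \<and> closed Y \<and> isomorphic_to c0 c0_norm Y"
proof -
  let ?F = "tail_filter e"
  let ?L = "small_sums 1 :: 'a set \<Rightarrow> bool"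
  have inf: "infinite (UNIV :: 'a set)"
  proof
    assume "finite (UNIV :: 'a set)"
    then have "finite (range (\<lambda>r :: real. r *\<^sub>R e 0))" by (rule finite_subset[OF subset_UNIV])
    moreover have "inj (\<lambda>r :: real. r *\<^sub>R e 0)" using e0[of 0] by (simp add: inj_def)
    ultimately show False using finite_imageD infinite_UNIV_char_0 by blast
  qed
  have all: "rext ?F a ?L {}" for a :: "'a succ_card"
  proof -
    \<comment> \<open>\<open>small_sums_all_ranks\<close> asks for a nonminimal exponent; a larger
      \<open>c\<close> covers a minimal \<open>a\<close> as well.\<close>
    obtain c where c: "a < c" using succ_card_bounded[OF inf, of "\<lambda>_. a"] by blast
    have "foldr (rext ?F) [c] ?L {}"
      by (rule small_sums_all_ranks) (use c in \<open>auto simp: small_sums_def\<close>)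
    then show ?thesis using rext_mono_index[of ?F c ?L "{}" a] c by simp
  qed
  define S where "S = (\<lambda>(n::nat) (s, N :: nat). \<forall>a :: 'a succ_card. rext ?F a ?L s)"
  define R where "R = (\<lambda>(n::nat) (s, N) (s', N'). \<exists>y. s' = insert y s \<and> y \<in> tail_units e N \<and> y \<in> span (e ` {N..<N'}))"
  have "\<exists>f. \<forall>n. S n (f n) \<and> R n (f n) (f (Suc n))"
  proof (rule dependent_nat_choice)
    show "\<exists>x. S 0 x" using all by (intro exI[of _ "({}, 0)"]) (simp add: S_def)
    fix x n assume x: "S n x"
    obtain s N where xe: "x = (s, N)" by (cases x)
    have sa: "\<And>a :: 'a succ_card. rext ?F a ?L s" using x by (simp add: S_def xe)
    have V: "\<forall>\<^sub>F y in ?F. y \<in> tail_units e N" unfolding eventually_tail_filter by blast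
    from rext_step[OF inf V sa] obtain y where y: "y \<in> tail_units e N"
      "\<forall>a :: 'a succ_card. rext ?F a ?L (insert y s)" by (rule bexE)
    obtain M where "N < M" "y \<in> span (e ` {N..<M})" by (rule tail_units_support[OF y(1)])
    then show "\<exists>z. S (Suc n) z \<and> R n x z" using y by (intro exI[of _ "(insert y s, M)"]) (auto simp: S_def R_def xe)
  qed
  then obtain f where f: "\<And>n. S n (f n)" "\<And>n. R n (f n) (f (Suc n))" by blast
  define Y where "Y = (\<lambda>n. fst (f n))"
  define N where "N = (\<lambda>n. snd (f n))"
  have fe: "f n = (Y n, N n)" for n by (simp add: Y_def N_def)
  have "\<exists>y. Y (Suc n) = insert y (Y n) \<and> y \<in> tail_units e (N n) \<and> y \<in> span (e ` {N n..<N (Suc n)})" for n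
    using f(2)[of n] unfolding fe R_def by simp
  then have "\<forall>n. \<exists>y. Y (Suc n) = insert y (Y n) \<and> y \<in> tail_units e (N n) \<and> y \<in> span (e ` {N n..<N (Suc n)})"
    by (rule allI)
  from choice[OF this] obtain u where u: "\<And>n. Y (Suc n) = insert (u n) (Y n)" "\<And>n. u n \<in> tail_units e (N n)"
      "\<And>n. u n \<in> span (e ` {N n..<N (Suc n)})" by blast
  have uY: "u ` {..<n} \<subseteq> Y n" for n
  proof (induction n)
    case (Suc n) then show ?case by (auto simp: u(1) lessThan_Suc)
  qed simp
  note ub = tail_units_block[of u N, OF u(2,3)]
  have LY: "?L (Y n)" for n using f(1)[of n] rext_imp[OF hered_small_sums] unfolding S_def fe by blast
  have sums: "norm (\<Sum>i\<in>I. u i) \<le> 2" if I: "finite I" for I :: "nat set"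
  proof -
    have "u ` I \<subseteq> u ` {..<Suc (Max I)}" using I by (auto simp: less_Suc_eq_le)
    then have "u ` I \<subseteq> Y (Suc (Max I))" using uY by blast
    then have "norm (\<Sum>x\<in>u ` I. x) \<le> 1 + 1" using LY I unfolding small_sums_def by blast
    moreover have "(\<Sum>x\<in>u ` I. x) = (\<Sum>i\<in>I. u i)"
      using ub(3) by (subst sum.reindex) (auto intro: inj_on_subset)
    ultimately show ?thesis by simp
  qed
  have Ku: "bounded_projections K u" by (rule bounded_projections_block[OF K ub(1)])
  have K1: "1 \<le> K" by (rule bounded_projections_nonneg[OF Ku block_basis_nonzero[OF ub(1)]])
  show ?thesis
  proof (rule c0_subspace[where u = u and c = "1 / (2 * K)" and C = 4])
    show "0 < 1 / (2 * K)" using K1 by simp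
    show "1 / (2 * K) * \<bar>a j\<bar> \<le> norm (\<Sum>i<n. a i *\<^sub>R u i)" if "j < n" for a n j
      using bounded_projections_coeff[OF Ku _ that, of a] K1 ub(2) by (simp add: normalized_def field_simps)
    fix a :: "nat \<Rightarrow> real" and I m assume I: "finite I" and a: "\<And>i. i \<in> I \<Longrightarrow> \<bar>a i\<bar> \<le> m" and m: "0 \<le> m"
    obtain g where g: "contraction g" "g (\<Sum>i\<in>I. a i *\<^sub>R u i) = norm (\<Sum>i\<in>I. a i *\<^sub>R u i)" using ex_norming by blast
    define Q where "Q = {i \<in> I. 0 \<le> g (u i)}"
    have lin: "linear g" using g(1) by (simp add: contraction_def)
    have gb: "\<bar>g (\<Sum>i\<in>B. u i)\<bar> \<le> 2" if "B \<subseteq> I" for B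
    proof -
      have "\<bar>g (\<Sum>i\<in>B. u i)\<bar> \<le> norm (\<Sum>i\<in>B. u i)" using g(1) by (simp add: contraction_def)
      also have "\<dots> \<le> 2" using sums finite_subset[OF that I] by blast
      finally show ?thesis .
    qed
    have "norm (\<Sum>i\<in>I. a i *\<^sub>R u i) = (\<Sum>i\<in>I. a i * g (u i))" unfolding g(2)[symmetric] by (rule contraction_sum[OF g(1)])
    also have "\<dots> \<le> (\<Sum>i\<in>I. m * \<bar>g (u i)\<bar>)"
    proof (rule sum_mono)
      fix i assume i: "i \<in> I"
      have "a i * g (u i) \<le> \<bar>a i\<bar> * \<bar>g (u i)\<bar>" by (metis abs_ge_self abs_mult)
      also have "\<dots> \<le> m * \<bar>g (u i)\<bar>" using a[OF i] by (intro mult_right_mono) auto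
      finally show "a i * g (u i) \<le> m * \<bar>g (u i)\<bar>" .
    qed
    also have "\<dots> = m * (\<Sum>i\<in>I. \<bar>g (u i)\<bar>)" by (simp add: sum_distrib_left)
    also have "(\<Sum>i\<in>I. \<bar>g (u i)\<bar>) = g (\<Sum>i\<in>Q. u i) - g (\<Sum>i\<in>I - Q. u i)"
    proof -
      have "(\<Sum>i\<in>I. \<bar>g (u i)\<bar>) = (\<Sum>i\<in>Q. \<bar>g (u i)\<bar>) + (\<Sum>i\<in>I - Q. \<bar>g (u i)\<bar>)"
        using sum.subset_diff[of Q I "\<lambda>i. \<bar>g (u i)\<bar>"] I by (simp add: Q_def add.commute)
      also have "(\<Sum>i\<in>Q. \<bar>g (u i)\<bar>) = (\<Sum>i\<in>Q. g (u i))" by (intro sum.cong) (auto simp: Q_def)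
      also have "(\<Sum>i\<in>I - Q. \<bar>g (u i)\<bar>) = - (\<Sum>i\<in>I - Q. g (u i))"
        unfolding sum_negf[symmetric] by (intro sum.cong) (auto simp: Q_def)
      finally show ?thesis by (simp add: linear_sum[OF lin])
    qed
    also have "m * (g (\<Sum>i\<in>Q. u i) - g (\<Sum>i\<in>I - Q. u i)) \<le> m * 4"
    proof (rule mult_left_mono[OF _ m])
      have "Q \<subseteq> I" by (auto simp: Q_def)
      then show "g (\<Sum>i\<in>Q. u i) - g (\<Sum>i\<in>I - Q. u i) \<le> 4" using gb[of Q] gb[of "I - Q"] by auto
    qed
    finally show "norm (\<Sum>i\<in>I. a i *\<^sub>R u i) \<le> 4 * m" by (simp add: mult.commute)
  qed
qed

end

end

theorem theoremA:
  fixes e :: "nat \<Rightarrow> 'a::banach"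
  assumes "schauder_basis e"
  shows "((\<forall>(x::nat \<Rightarrow> 'a) (s::nat \<Rightarrow> linf).
             block_basis e x \<longrightarrow> normalized x \<longrightarrow> spreading_model x s \<longrightarrow> norm (s 0 + s 1) = 2)
           \<longrightarrow> (\<exists>Y::'a set. subspace Y \<and> closed Y \<and> isomorphic_to ell1 ell1_norm Y)) \<and>
         ((\<forall>(x::nat \<Rightarrow> 'a) (s::nat \<Rightarrow> linf).
             block_basis e x \<longrightarrow> normalized x \<longrightarrow> spreading_model x s \<longrightarrow> norm (s 0 + s 1) = 1)
           \<longrightarrow> (\<exists>Y::'a set. subspace Y \<and> closed Y \<and> isomorphic_to c0 c0_norm Y))"
proof (intro conjI impI)
  obtain K where K: "bounded_projections K e" and e0: "\<And>i. e i \<noteq> 0"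
    using schauder_basis_bounded_projections[OF assms] by blast
  {
    assume "\<forall>(x::nat \<Rightarrow> 'a) (s::nat \<Rightarrow> linf).
      block_basis e x \<longrightarrow> normalized x \<longrightarrow> spreading_model x s \<longrightarrow> norm (s 0 + s 1) = 2"
    then interpret pair_norm_two e K by unfold_locales (use K in auto)
    show "\<exists>Y::'a set. subspace Y \<and> closed Y \<and> isomorphic_to ell1 ell1_norm Y" by (rule contains_ell1[OF e0])
  next
    assume "\<forall>(x::nat \<Rightarrow> 'a) (s::nat \<Rightarrow> linf).
      block_basis e x \<longrightarrow> normalized x \<longrightarrow> spreading_model x s \<longrightarrow> norm (s 0 + s 1) = 1"
    then interpret pair_norm_one e K by unfold_locales (use K in auto)
    show "\<exists>Y::'a set. subspace Y \<and> closed Y \<and> isomorphic_to c0 c0_norm Y" by (rule contains_c0[OF e0])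
  }
qed

end
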